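(* The following two properties hold: (i) For every parameter $c\in\mathbb C\setminus\{-2\}$, the set $\mathcal Y_c$ is convex; for $c=-2$, the set $\mathcal Y_{-2}$ is the union of a convex set and the point $-\frac16$. (ii) For every parameter $c\in\mathbb C\setminus\mathbb M$, the set $\mathcal Y_c$ is bounded. A parameter $c\in\mathbb C\setminus\mathbb M$ belongs to $\mathcal X$ if and only if $0\in\mathcal Y_c$.
   Context: For $c\in\mathbb C$ let $f_c(z)=z^2+c$, and let $\mathbb M\subset\mathbb C$ be the Mandelbrot set, i.e. the set of $c$ for which the orbit of $0$ under $f_c$ is bounded. For a periodic orbit $\mathcal O$ of $f_c$, its period $|\mathcal O|$ is the number of distinct points in it, and its multiplier is $(f_c^{\circ|\mathcal O|})'(z)$ for any $z\in\mathcal O$. If a periodic orbit $\mathcal O$ of $f_{c_0}$ is not primitive parabolic (i.e. its multiplier is not equal to $1$), then $\mathcal O$ moves analytically with $c$ near $c_0$ and its multiplier is a locally analytic function $\rho_{\mathcal O}(c)$ in a neighborhood of $c_0$. If moreover $\rho_{\mathcal O}(c_0)\ne0$, define in a neighborhood of $c_0$ the analytic function $$\nu_{\mathcal O}(c):=\frac{\rho_{\mathcal O}'(c)}{|\mathcal O|\,\rho_{\mathcal O}(c)}.$$ Let $\Omega_c$ be the set of all repelling periodic orbits of $f_c$ in $\mathbb C$ (multiplier of modulus $>1$), and define $$\mathcal Y_c:=\overline{\{\nu_{\mathcal O}(c)\mid\mathcal O\in\Omega_c\}}\subset\mathbb C.$$ A parameter $c_0\in\mathbb C$ is a critical point of a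 period $n$ multiplier if $f_{c_0}$ has a periodic orbit $\mathcal O$ of period $n$ whose multiplier, viewed as a locally analytic function of $c$, satisfies $\rho_{\mathcal O}'(c_0)=0$. For $n\in\mathbb N$ let $X_n\subset\mathbb C$ be the set of all critical points of period $n$ multipliers, and $$\mathcal X:=\bigcap_{k=1}^\infty\left(\overline{\bigcup_{n=k}^\infty X_n}\right).$$ *)

theory Defs
  imports "HOL-Complex_Analysis.Complex_Analysis"
begin

definition quad :: "complex \<Rightarrow> complex \<Rightarrow> complex" where
  "quad c z = z\<^sup>2 + c"

definition mandelbrot :: "complex set" where
  "mandelbrot = {c. bounded (range (\<lambda>n. (quad c ^^ n) 0))}"

text \<open>A periodic orbit is represented by its set of points, so its period is its cardinality
  (the number of distinct points).\<close>

definition periodic_orbit :: "complex \<Rightarrow> complex set \<Rightarrow> bool" where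
  "periodic_orbit c \<O> \<longleftrightarrow>
     (\<exists>z n. n > 0 \<and> (quad c ^^ n) z = z \<and> \<O> = range (\<lambda>k. (quad c ^^ k) z))"

text \<open>By the chain rule the derivative is the same at all points of a periodic orbit, so the
  choice of the point is immaterial.\<close>

definition multiplier :: "complex \<Rightarrow> complex set \<Rightarrow> complex" where
  "multiplier c \<O> = deriv (quad c ^^ card \<O>) (SOME z. z \<in> \<O>)"

text \<open>If the multiplier of a periodic orbit of \<^term>\<open>quad c0\<close> differs from 1, the implicit
  function theorem yields, for each point of the orbit, a unique germ at \<^term>\<open>c0\<close> of an
  analytic function following that point as a periodic point. The function below is a
  representative of such a germ for one of the points; the values away from \<^term>\<open>c0\<close> are
  not determined. It is meaningful only for multiplier different from 1.\<close>

definition continued_point :: "complex \<Rightarrow> complex set \<Rightarrow> complex \<Rightarrow> complex" where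
  "continued_point c0 \<O> =
     (SOME \<zeta>. \<zeta> analytic_on {c0} \<and> \<zeta> c0 \<in> \<O> \<and>
        (\<forall>\<^sub>F c in nhds c0. (quad c ^^ card \<O>) (\<zeta> c) = \<zeta> c))"

text \<open>The multiplier as a locally analytic function of \<^term>\<open>c\<close> near \<^term>\<open>c0\<close>. For
  \<^term>\<open>c\<close> close to \<^term>\<open>c0\<close> the continued orbit still has exactly \<^term>\<open>card \<O>\<close> points,
  and the germ of this function at \<^term>\<open>c0\<close> does not depend on which point is followed.\<close>

definition rho :: "complex \<Rightarrow> complex set \<Rightarrow> complex \<Rightarrow> complex" where
  "rho c0 \<O> c = deriv (quad c ^^ card \<O>) (continued_point c0 \<O> c)"

definition nu :: "complex \<Rightarrow> complex set \<Rightarrow> complex \<Rightarrow> complex" where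
  "nu c0 \<O> c = deriv (rho c0 \<O>) c / (of_nat (card \<O>) * rho c0 \<O> c)"

definition repelling_orbits :: "complex \<Rightarrow> complex set set" where
  "repelling_orbits c = {\<O>. periodic_orbit c \<O> \<and> norm (multiplier c \<O>) > 1}"

definition Y_set :: "complex \<Rightarrow> complex set" where
  "Y_set c = closure {nu c \<O> c | \<O>. \<O> \<in> repelling_orbits c}"

text \<open>Orbits of multiplier 1 (primitive parabolic) are excluded, since their multiplier is not a
  locally analytic function of the parameter.\<close>

definition critical_params :: "nat \<Rightarrow> complex set" where
  "critical_params n =
     {c0. \<exists>\<O>. periodic_orbit c0 \<O> \<and> card \<O> = n \<and> multiplier c0 \<O> \<noteq> 1 \<and>
            deriv (rho c0 \<O>) c0 = 0}"

definition X_accum :: "complex set" where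
  "X_accum = (\<Inter>k\<in>{1..}. closure (\<Union>n\<in>{k..}. critical_params n))"

end

theory Submission
  imports Defs
begin

text \<open>A cycle \<open>z\<close> of period \<open>n\<close> moves with velocity \<open>v\<close>, where \<open>v (j + 1) = 2 z j v j + 1\<close>, and \<open>\<nu>\<close> is
  the mean of \<open>v j / z j\<close> over the cycle. Expansion along an orbit is measured by a weight \<open>\<beta>\<close> with
  \<open>1 + \<beta> (j + 1) \<le> 2 |z j| \<beta> j\<close>; a pseudo-orbit with bounded weight is shadowed by an orbit that is
  holomorphic in the parameter, and the velocities are close as well.

  Convexity: any two repelling cycles, except the fixed point \<open>2\<close> of \<open>z\<^sup>2 - 2\<close>, are joined in both
  directions by backward orbits that avoid the critical point. A periodic pseudo-orbit that follows
  one cycle and then the other in prescribed proportions is shadowed by a cycle whose \<open>\<nu>\<close> is close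
  to the corresponding convex combination.

  Outside the Mandelbrot set an Earle--Hamilton contraction gives weights that are bounded for all
  cycles, locally uniformly in \<open>c\<close>. Hence the functions \<open>\<nu>\<close> extend to a common disc and form a normal
  family there. If \<open>0\<close> is a limit of values at \<open>c\<close>, Hurwitz's theorem gives nearby zeros unless the
  limit function vanishes identically; the parameters where that happens form a bounded open set
  whose boundary lies in the Mandelbrot set, and by the maximum principle it is empty.\<close>

section \<open>Shadowing\<close>

text \<open>Behind a weight stands a series. The sum over k >= 1 of 1/|(f^k)'(z j)| turns the
  inequality for \<open>\<beta>\<close> into an equation, and every weight dominates this sum.
  Without absolute values the same series is the negative of the velocity. So one sequence controls
  shadowing errors, expansivity and velocities, and it splices easily: at a jump only two values
  have to be compared.

  The obstacle to convexity is that for parameters in the Mandelbrot set no bound need serve all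
  cycles. The bound used there depends on the two cycles and on the two connecting orbits, but not
  on the time spent near either cycle. As every spliced orbit has only two jumps, their effect on
  the mean vanishes when the period grows.

  The set \<open>X_accum\<close> asks for arbitrarily long periods, whereas points of
  \<open>Y_set\<close> may come from short cycles. Mixing in a small proportion of a second cycle
  produces long cycles with almost the same value; this is why the splicing also controls the number
  of points.\<close>

definition weight :: "(nat \<Rightarrow> complex) \<Rightarrow> (nat \<Rightarrow> real) \<Rightarrow> real \<Rightarrow> bool" where
  "weight z \<beta> B \<longleftrightarrow> (\<forall>j. 0 < \<beta> j \<and> \<beta> j \<le> B \<and> 1 + \<beta> (Suc j) \<le> 2 * cmod (z j) * \<beta> j)"

lemma weightD:
  assumes "weight z \<beta> B"
  shows "0 < \<beta> j" "\<beta> j \<le> B" "1 + \<beta> (Suc j) \<le> 2 * cmod (z j) * \<beta> j" "0 < B" "z j \<noteq> 0"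
    "1 \<le> 2 * B * cmod (z j)"
proof -
  show 1: "0 < \<beta> j" and 2: "\<beta> j \<le> B" and 3: "1 + \<beta> (Suc j) \<le> 2 * cmod (z j) * \<beta> j"
    using assms by (auto simp: weight_def)
  have 4: "0 < \<beta> (Suc j)" using assms by (auto simp: weight_def)
  from 1 2 show "0 < B" by linarith
  have 5: "1 \<le> 2 * cmod (z j) * \<beta> j" using 3 4 by linarith
  then show "z j \<noteq> 0" by auto
  have "cmod (z j) * \<beta> j \<le> cmod (z j) * B" by (intro mult_left_mono 2) auto
  then show "1 \<le> 2 * B * cmod (z j)" using 5 by (simp add: mult_ac)
qed

text \<open>Here \<open>n\<close> is some multiple of the exact period: a cycle that shadows a
  spliced orbit of length \<open>n\<close> might close up earlier.\<close>

definition cyc :: "complex \<Rightarrow> nat \<Rightarrow> (nat \<Rightarrow> complex) \<Rightarrow> bool" where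
  "cyc c n z \<longleftrightarrow> 0 < n \<and> (\<forall>j. z (Suc j) = (z j)\<^sup>2 + c) \<and> (\<forall>j. z (j + n) = z j)"

lemma cycD:
  assumes "cyc c n z"
  shows "0 < n" "z (Suc j) = (z j)\<^sup>2 + c" "z (j + n) = z j"
  using assms by (auto simp: cyc_def)

definition branch :: "complex set \<Rightarrow> nat \<Rightarrow> (nat \<Rightarrow> complex \<Rightarrow> complex) \<Rightarrow> bool" where
  "branch S n x \<longleftrightarrow> (\<forall>j. x j holomorphic_on S) \<and> (\<forall>c\<in>S. cyc c n (\<lambda>j. x j c))"

lemma branchD:
  assumes "branch S n x"
  shows "x j holomorphic_on S" "c \<in> S \<Longrightarrow> cyc c n (\<lambda>j. x j c)"
  using assms by (auto simp: branch_def)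

text \<open>With x = z + u the orbit equation reads 2 z_j u_j = u_(j+1) - u_j^2 - e_j, where e_j is
  the error of the pseudo-orbit. Divided by 2 z_j it is a fixed point equation, contracting in the
  supremum norm with weights 1/\<open>\<beta> j\<close>. The parameter enters only through e_j, so
  one pseudo-orbit gives a whole holomorphic family.\<close>

lemma shadowing:
  fixes z :: "nat \<Rightarrow> complex" and \<beta> :: "nat \<Rightarrow> real"
  assumes W: "weight z \<beta> B"
    and Z: "\<And>j. cmod (z j) \<le> Z" and s: "0 < s" "4 * B\<^sup>2 * s \<le> 1"
    and n: "n > 0" and per: "\<And>j. z (j + n) = z j" and S: "open S"
    and e: "\<And>c j. c \<in> S \<Longrightarrow> cmod ((z j)\<^sup>2 + c - z (Suc j)) \<le> s / 2"
  obtains x where "branch S n x"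
    "\<And>j c. c \<in> S \<Longrightarrow> cmod (x j c - z j) \<le> s * B"
proof -
  note w = weightD[OF W]
  \<comment> \<open>The successive approximations of u, started at 0.\<close>
  define U where "U = rec_nat (\<lambda>j c. 0) (\<lambda>k u j c. (u (Suc j) c - (u j c)\<^sup>2 - ((z j)\<^sup>2 + c - z (Suc j))) / (2 * z j))"
  have U0: "U 0 j c = 0" for j c by (simp add: U_def)
  have USuc: "U (Suc k) j c = (U k (Suc j) c - (U k j c)\<^sup>2 - ((z j)\<^sup>2 + c - z (Suc j))) / (2 * z j)" for k j c
    by (simp add: U_def)
  have Upos: "B > 0" by (rule w)
  have sb: "s * \<beta> j * \<beta> j \<le> 1/4" for j
  proof -
    have "\<beta> j * \<beta> j \<le> B * B" using w(1,2,4) by (intro mult_mono) (auto intro: less_imp_le)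
    then have "s * (\<beta> j * \<beta> j) \<le> s * (B * B)" using s by (intro mult_left_mono) auto
    also have "\<dots> \<le> 1/4" using s by (simp add: power2_eq_square mult_ac)
    finally show ?thesis by (simp add: mult_ac)
  qed
  have bd: "cmod (U k j c) \<le> s * \<beta> j" if "c \<in> S" for k j c
  proof (induction k arbitrary: j)
    case 0
    then show ?case using s w(1)[of j] by (simp add: U0)
  next
    case (Suc k)
    have z: "0 < cmod (z j)" using w(5) by simp
    have "cmod (U k (Suc j) c - (U k j c)\<^sup>2 - ((z j)\<^sup>2 + c - z (Suc j)))
        \<le> cmod (U k (Suc j) c) + cmod (U k j c) ^ 2 + cmod ((z j)\<^sup>2 + c - z (Suc j))"
      by (metis norm_power norm_triangle_ineq4 norm_triangle_le_diff add_mono_thms_linordered_semiring(3))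
    also have "\<dots> \<le> s * \<beta> (Suc j) + (s * \<beta> j)^2 + s/2"
      using Suc e[OF that, of j] by (intro add_mono power_mono) auto
    also have "\<dots> \<le> s * \<beta> (Suc j) + s * (1/4) + s/2"
      using mult_left_mono[OF sb[of j], of s] s by (simp add: power2_eq_square mult_ac)
    also have "\<dots> \<le> s * (1 + \<beta> (Suc j))" using s by (simp add: algebra_simps)
    also have "\<dots> \<le> s * (2 * cmod (z j) * \<beta> j)" using s w(3)[of j] by (intro mult_left_mono) auto
    finally show ?case using z by (simp add: USuc norm_divide norm_mult field_simps)
  qed
  \<comment> \<open>The quadratic term uses up at most 1/2 of the unit in the weight inequality. The
    remaining 1/2 is at least the fraction \<open>1 / (4 * Z * B)\<close> of
    \<open>2 * cmod (z j) * \<beta> j\<close>, and this is the gain per iteration.\<close>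
  define \<kappa> where "\<kappa> = 1 - 1 / (4 * Z * B)"
  have Zpos: "Z > 0" using Z[of 0] w(5)[of 0] by (smt (verit) zero_less_norm_iff)
  have ZB: "1 \<le> 2 * B * Z"
  proof -
    have "2 * B * cmod (z 0) \<le> 2 * B * Z" using Z[of 0] Upos by (intro mult_left_mono) auto
    then show ?thesis using w(6)[of 0] by linarith
  qed
  have \<kappa>: "0 \<le> \<kappa>" "\<kappa> < 1" using ZB Zpos Upos by (auto simp: \<kappa>_def field_simps)
  have d: "cmod (U (Suc k) j c - U k j c) \<le> s * \<beta> j * \<kappa> ^ k" if "c \<in> S" for k j c
  proof (induction k arbitrary: j)
    case 0
    then show ?case using bd[OF that, of 1 j] by (simp add: U0)
  next
    case (Suc k)
    have z: "0 < cmod (z j)" using w(5) by simp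
    let ?a = "U (Suc k)" and ?b = "U k"
    have "U (Suc (Suc k)) j c - U (Suc k) j c =
      ((?a (Suc j) c - ?b (Suc j) c) - (?a j c + ?b j c) * (?a j c - ?b j c)) / (2 * z j)"
      unfolding USuc[of "Suc k"] USuc[of k j c] diff_divide_distrib[symmetric]
      by (simp add: USuc[symmetric] algebra_simps power2_eq_square)
    then have "cmod (U (Suc (Suc k)) j c - U (Suc k) j c) * (2 * cmod (z j)) =
      cmod ((?a (Suc j) c - ?b (Suc j) c) - (?a j c + ?b j c) * (?a j c - ?b j c))"
      using z by (simp add: norm_divide norm_mult)
    also have "\<dots> \<le> cmod (?a (Suc j) c - ?b (Suc j) c) + cmod (?a j c + ?b j c) * cmod (?a j c - ?b j c)"
      by (metis norm_mult norm_triangle_ineq4)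
    also have "\<dots> \<le> s * \<beta> (Suc j) * \<kappa> ^ k + (s * \<beta> j + s * \<beta> j) * (s * \<beta> j * \<kappa> ^ k)"
      using Suc[of "Suc j"] Suc[of j] bd[OF that, of "Suc k" j] bd[OF that, of k j] s w(1)[of j]
      by (intro add_mono mult_mono) (auto intro: order_trans[OF norm_triangle_ineq] add_mono)
    also have "\<dots> = s * \<kappa> ^ k * (\<beta> (Suc j) + 2 * (s * \<beta> j * \<beta> j))" by (simp add: algebra_simps)
    also have "\<dots> \<le> s * \<kappa> ^ k * (2 * cmod (z j) * \<beta> j * \<kappa>)"
    proof (intro mult_left_mono)
      have "cmod (z j) * \<beta> j / (2 * Z * B) \<le> 1 / 2"
        using mult_mono[OF Z[of j] w(2)[of j]] w(1)[of j] Zpos Upos by (simp add: field_simps)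
      moreover have "2 * cmod (z j) * \<beta> j * \<kappa> = 2 * cmod (z j) * \<beta> j - cmod (z j) * \<beta> j / (2 * Z * B)"
        by (simp add: \<kappa>_def algebra_simps)
      ultimately show "\<beta> (Suc j) + 2 * (s * \<beta> j * \<beta> j) \<le> 2 * cmod (z j) * \<beta> j * \<kappa>"
        using w(3)[of j] sb[of j] by linarith
    qed (use s \<kappa> in auto)
    also have "\<dots> = s * \<beta> j * \<kappa> ^ Suc k * (2 * cmod (z j))" by (simp add: algebra_simps)
    finally show ?case using z by (simp add: mult_le_cancel_right)
  qed
  define u where "u j c = (\<Sum>i. U (Suc i) j c - U i j c)" for j c
  have tele: "(\<Sum>i<k. U (Suc i) j c - U i j c) = U k j c" for k j c
    using sum_lessThan_telescope[of "\<lambda>i. U i j c" k] by (simp add: U0)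
  have ul: "uniform_limit S (\<lambda>k. U k j) (u j) sequentially" for j
  proof -
    have "uniform_limit S (\<lambda>k c. \<Sum>i<k. U (Suc i) j c - U i j c) (\<lambda>c. \<Sum>i. U (Suc i) j c - U i j c) sequentially"
    proof (rule Weierstrass_m_test)
      show "summable (\<lambda>k. s * \<beta> j * \<kappa> ^ k)" using \<kappa> by (intro summable_mult summable_geometric) auto
    qed (use d in auto)
    then show ?thesis by (simp add: tele u_def[abs_def])
  qed
  have lim: "(\<lambda>k. U k j c) \<longlonglongrightarrow> u j c" if "c \<in> S" for j c
    using ul[of j] that by (rule tendsto_uniform_limitI)
  have Uhol: "(U k j) holomorphic_on S" for k j
  proof (induction k arbitrary: j)
    case 0
    then show ?case by (simp add: U_def)
  next
    case (Suc k)
    then show ?case using w(5) unfolding USuc[abs_def] by (intro holomorphic_intros) auto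
  qed
  have uhol: "u j holomorphic_on S" for j
  proof (rule holomorphic_uniform_sequence[OF S Uhol])
    fix x assume "x \<in> S"
    then obtain r where "r > 0" "cball x r \<subseteq> S" using S open_contains_cball by blast
    then show "\<exists>d>0. cball x d \<subseteq> S \<and> uniform_limit (cball x d) (\<lambda>n. U n j) (u j) sequentially"
      using ul uniform_limit_on_subset by blast
  qed
  have ueq: "u j c * (2 * z j) = u (Suc j) c - (u j c)\<^sup>2 - ((z j)\<^sup>2 + c - z (Suc j))" if "c \<in> S" for j c
  proof -
    have "(\<lambda>k. U (Suc k) j c) \<longlonglongrightarrow> (u (Suc j) c - (u j c)\<^sup>2 - ((z j)\<^sup>2 + c - z (Suc j))) / (2 * z j)"
      unfolding USuc by (intro tendsto_intros lim that) (use w(5) in auto)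
    then have "u j c = (u (Suc j) c - (u j c)\<^sup>2 - ((z j)\<^sup>2 + c - z (Suc j))) / (2 * z j)"
      using LIMSEQ_Suc[OF lim[OF that, of j]] LIMSEQ_unique by blast
    then show ?thesis using w(5)[of j] by (simp add: field_simps)
  qed
  have Uper: "U k (j + n) c = U k j c" for k j c
  proof (induction k arbitrary: j)
    case 0
    then show ?case by (simp add: U0)
  next
    case (Suc k)
    then show ?case using per[of j] per[of "Suc j"] Suc[of "Suc j"] by (simp add: USuc)
  qed
  show thesis
  proof
    have "z (Suc j) + u (Suc j) c = (z j + u j c)\<^sup>2 + c" if "c \<in> S" for j c
      using ueq[OF that, of j] by (simp add: algebra_simps power2_eq_square)
    moreover have "z (j + n) + u (j + n) c = z j + u j c" for j c
      by (simp add: u_def Uper per)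
    ultimately show "branch S n (\<lambda>j c. z j + u j c)"
      unfolding branch_def cyc_def using n uhol by (auto intro!: holomorphic_intros)
    show "cmod (z j + u j c - z j) \<le> s * B" if "c \<in> S" for j c
    proof -
      have "cmod (u j c) \<le> s * \<beta> j"
        by (rule LIMSEQ_le_const2[OF tendsto_norm[OF lim[OF that]]]) (use bd[OF that] in auto)
      also have "\<dots> \<le> s * B" using s w(2)[of j] by (intro mult_left_mono) auto
      finally show ?thesis by simp
    qed
  qed
qed

text \<open>The distance divided by \<open>\<beta> j\<close> grows at least by the factor
  \<open>\<omega>\<close> in each step but stays bounded, so it is zero. This provides the
  uniqueness of continued cycles.\<close>

lemma expansive:
  assumes W: "weight z \<beta> B" and x: "\<And>j. x (Suc j) = (x j)\<^sup>2 + c" and z: "\<And>j. z (Suc j) = (z j)\<^sup>2 + c"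
    and near: "\<And>j. cmod (x j - z j) \<le> \<mu>" and \<mu>: "2 * \<mu> * B \<le> 1"
    and Z: "\<And>j. cmod (z j) \<le> Z"
  shows "x i = z i"
proof -
  note w = weightD[OF W]
  define \<omega> where "\<omega> = 1 + 1 / (2 * B)"
  have \<omega>: "\<omega> > 1" using w(4) by (simp add: \<omega>_def)
  define a where "a j = cmod (x j - z j) / \<beta> j" for j
  have step: "\<omega> * a j \<le> a (Suc j)" for j
  proof -
    have "x (Suc j) - z (Suc j) = (2 * z j + (x j - z j)) * (x j - z j)"
      by (simp add: x z power2_eq_square algebra_simps)
    then have e: "cmod (x (Suc j) - z (Suc j)) = cmod (2 * z j + (x j - z j)) * cmod (x j - z j)"
      by (simp add: norm_mult)
    have 1: "2 * cmod (z j) - \<mu> \<le> cmod (2 * z j + (x j - z j))"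
      using near[of j] norm_diff_ineq[of "2 * z j" "x j - z j"] by (simp add: norm_mult)
    have m0: "\<mu> \<ge> 0" using near[of j] norm_ge_zero order_trans by blast
    have "\<mu> * \<beta> j \<le> \<mu> * B" using m0 w(2)[of j] by (intro mult_left_mono) auto
    then have "1/2 + \<beta> (Suc j) \<le> (2 * cmod (z j) - \<mu>) * \<beta> j"
      using w(3)[of j] \<mu> by (simp add: algebra_simps)
    moreover have "\<omega> * \<beta> (Suc j) \<le> 1/2 + \<beta> (Suc j)"
      using w(2)[of "Suc j"] w(4) by (simp add: \<omega>_def field_simps)
    ultimately have "\<omega> * \<beta> (Suc j) \<le> cmod (2 * z j + (x j - z j)) * \<beta> j"
      using mult_right_mono[OF 1, of "\<beta> j"] w(1)[of j] by linarith
    then have "(\<omega> * \<beta> (Suc j)) * cmod (x j - z j) \<le> (cmod (2 * z j + (x j - z j)) * \<beta> j) * cmod (x j - z j)"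
      by (intro mult_right_mono) auto
    then show ?thesis using w(1)[of j] w(1)[of "Suc j"] unfolding a_def e by (simp add: field_simps)
  qed
  have pw: "\<omega> ^ k * a i \<le> a (i + k)" for k
  proof (induction k)
    case (Suc k)
    have "\<omega> ^ Suc k * a i \<le> \<omega> * a (i + k)" using mult_left_mono[OF Suc, of \<omega>] \<omega> by (simp add: mult_ac)
    also have "\<dots> \<le> a (i + Suc k)" using step[of "i + k"] by simp
    finally show ?case .
  qed auto
  have ub: "a j \<le> \<mu> * (2 * (cmod (z j)))" for j
  proof -
    have "1 \<le> 2 * cmod (z j) * \<beta> j" using w(3)[of j] w(1)[of "Suc j"] by linarith
    then have "1 / \<beta> j \<le> 2 * cmod (z j)" using w(1)[of j] by (simp add: field_simps)
    then have "cmod (x j - z j) * (1 / \<beta> j) \<le> \<mu> * (2 * cmod (z j))"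
      using near[of j] w(1)[of j] by (intro mult_mono) (auto intro: order_trans[OF norm_ge_zero])
    then show ?thesis by (simp add: a_def)
  qed
  have "a i \<le> 0"
  proof (rule ccontr)
    assume "\<not> a i \<le> 0"
    then have ai: "a i > 0" by simp
    have m0: "\<mu> \<ge> 0" using near[of 0] norm_ge_zero order_trans by blast
    obtain k where "\<omega> ^ k > \<mu> * (2 * Z) / a i" using real_arch_pow[OF \<omega>] by blast
    then have "\<mu> * (2 * Z) < \<omega> ^ k * a i" using ai by (simp add: field_simps)
    also have "\<dots> \<le> \<mu> * (2 * cmod (z (i + k)))" using pw ub order_trans by blast
    also have "\<dots> \<le> \<mu> * (2 * Z)" using Z[of "i+k"] m0 by (intro mult_left_mono) auto
    finally show False by simp
  qed
  then show ?thesis using w(1)[of i] by (simp add: a_def field_simps)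
qed

section \<open>Cycles, multipliers and weights\<close>

lemma funpow_quad:
  assumes "\<And>j. z (Suc j) = (z j)\<^sup>2 + c"
  shows "(quad c ^^ k) (z j) = z (j + k)"
  by (induction k) (auto simp: quad_def assms)

lemma quad_funpow_deriv:
  "((quad c ^^ k) has_field_derivative (\<Prod>i<k. 2 * (quad c ^^ i) z)) (at z)"
proof (induction k)
  case 0
  show ?case by (auto intro!: derivative_eq_intros simp: id_def)
next
  case (Suc k)
  have "(quad c ^^ Suc k) = (\<lambda>z. ((quad c ^^ k) z)\<^sup>2 + c)" by (auto simp: quad_def)
  then show ?case by (auto intro!: derivative_eq_intros Suc)
qed

lemma deriv_quad_funpow: "deriv (quad c ^^ k) z = (\<Prod>i<k. 2 * (quad c ^^ i) z)"
  by (rule DERIV_imp_deriv[OF quad_funpow_deriv])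

lemma periodic_mult:
  assumes "\<And>j. g (j + n) = g (j::nat)"
  shows "g (j + k * n) = g j"
proof (induction k)
  case (Suc k)
  have "g (j + Suc k * n) = g (j + k * n + n)" by (simp add: algebra_simps)
  then show ?case using Suc assms by simp
qed auto

lemma periodic_mod:
  assumes "\<And>j. g (j + n) = g (j::nat)"
  shows "g (j mod n) = g j"
  using periodic_mult[of g n "j mod n" "j div n", OF assms] by simp

lemma periodic_bounded_by_max:
  fixes f :: "nat \<Rightarrow> real"
  assumes "n > 0" and f: "\<And>j. f (j + n) = f j"
  obtains i where "\<And>j. f j \<le> f i"
proof -
  have fin: "finite (f ` {..<n})" "f ` {..<n} \<noteq> {}" using assms(1) by auto
  obtain i where i: "f i = Max (f ` {..<n})" using Max_in[OF fin] by auto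
  have "f j \<le> f i" for j
    unfolding i using periodic_mod[of f n j, OF f, symmetric] assms(1) by (auto intro!: Max_ge)
  then show thesis by (rule that)
qed

lemma sum_shift_period:
  fixes g :: "nat \<Rightarrow> complex"
  assumes "\<And>j. g (j + n) = g j"
  shows "(\<Sum>j<n. g (i + j)) = (\<Sum>j<n. g j)"
proof (induction i)
  case (Suc i)
  have "(\<Sum>j<Suc n. g (i + j)) = g i + (\<Sum>j<n. g (Suc i + j))"
    by (subst sum.lessThan_Suc_shift) simp
  moreover have "(\<Sum>j<Suc n. g (i + j)) = (\<Sum>j<n. g (i + j)) + g i"
    using assms[of i] by simp
  ultimately show ?case using Suc by simp
qed auto

lemma sum_lessThan_add:
  fixes g :: "nat \<Rightarrow> 'a::comm_monoid_add"
  shows "(\<Sum>j<a+b. g j) = (\<Sum>j<a. g j) + (\<Sum>j<b. g (a + j))"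
  by (induction b) (auto simp: add_ac)

lemma prod_lessThan_add:
  fixes g :: "nat \<Rightarrow> 'a::comm_monoid_mult"
  shows "(\<Prod>j<a+b. g j) = (\<Prod>j<a. g j) * (\<Prod>j<b. g (a + j))"
  by (induction b) (auto simp: mult_ac)

lemma sum_period_mult:
  fixes g :: "nat \<Rightarrow> complex"
  assumes "\<And>j. g (j + n) = g j"
  shows "(\<Sum>j<k*n. g j) = of_nat k * (\<Sum>j<n. g j)"
proof (induction k)
  case (Suc k)
  have "(\<Sum>j<Suc k*n. g j) = (\<Sum>j<k*n. g j) + (\<Sum>j<n. g (k*n + j))"
    using sum_lessThan_add[of g "k*n" n] by (simp add: add.commute)
  then show ?case using Suc sum_shift_period[of g n "k*n", OF assms] by (simp add: algebra_simps)
qed auto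

lemma prod_period_mult:
  fixes g :: "nat \<Rightarrow> complex"
  assumes "\<And>j. g (j + n) = g j"
  shows "(\<Prod>j<k*n. g j) = (\<Prod>j<n. g j) ^ k"
proof (induction k)
  case (Suc k)
  have "(\<Prod>j<Suc k*n. g j) = (\<Prod>j<k*n. g j) * (\<Prod>j<n. g (k*n + j))"
    using prod_lessThan_add[of g "k*n" n] by (simp add: add.commute)
  moreover have "g (k*n + j) = g j" for j using periodic_mult[of g n j k, OF assms] by (simp add: add.commute)
  ultimately show ?case using Suc by (simp add: mult.commute)
qed auto

lemma cyc_range:
  assumes "cyc c n z"
  shows "range z = z ` {..<n}" "range (\<lambda>j. z (i + j)) = range z"
proof -
  note cc = cycD[OF assms]
  have "z j \<in> z ` {..<n}" for j
    using periodic_mod[of z n j, OF cc(3)] cc(1) by (intro image_eqI[of _ _ "j mod n"]) auto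
  then show "range z = z ` {..<n}" by auto
  have "z j \<in> range (\<lambda>j. z (i + j))" for j
  proof -
    have "z j = z (j + i * n)" by (rule periodic_mult[of z n j i, OF cc(3), symmetric])
    also have "j + i * n = i + (j + i * (n - 1))" using cc(1) by (cases n) auto
    finally show ?thesis by blast
  qed
  then show "range (\<lambda>j. z (i + j)) = range z" by blast
qed

text \<open>The first return time \<open>p\<close> equals the number of points: two equal points
  before time \<open>p\<close> would lead to an earlier return to \<open>z 0\<close>.\<close>

lemma cyc_card:
  assumes c: "cyc c n z" and m: "m = card (range z)"
  shows "cyc c m z" "m dvd n" "inj_on z {..<m}" "range z = z ` {..<m}"
proof -
  note cc = cycD[OF c]
  define p where "p = (LEAST p. 0 < p \<and> z p = z 0)"
  have ex: "\<exists>p. 0 < p \<and> z p = z 0" using cc(1) cc(3)[of 0] by auto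
  have p: "0 < p" "z p = z 0" using LeastI_ex[OF ex] by (auto simp: p_def)
  have least: "p \<le> q" if "0 < q" "z q = z 0" for q using that by (auto simp: p_def intro: Least_le)
  have per: "z (j + p) = z j" for j
    using funpow_quad[of z c j p, OF cc(2)] funpow_quad[of z c j 0, OF cc(2)] p by (simp add: add.commute)
  have inj: "inj_on z {..<p}"
  proof -
    have "False" if "i < j" "j < p" "z i = z j" for i j
    proof -
      have "z (i + (p - j)) = z (j + (p - j))"
        using funpow_quad[of z c "p - j", OF cc(2)] that(3) by metis
      also have "\<dots> = z 0" using that p by simp
      finally show False using least[of "i + (p - j)"] that by auto
    qed
    then show ?thesis unfolding inj_on_def by (metis lessThan_iff nat_neq_iff)
  qed
  have "cyc c p z" using p per cc by (auto simp: cyc_def)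
  note rg = cyc_range(1)[OF this]
  have mp: "m = p" using m rg card_image[OF inj] by simp
  show "cyc c m z" using p per cc by (auto simp: cyc_def mp)
  show "inj_on z {..<m}" "range z = z ` {..<m}" using inj rg mp by auto
  have "z (n mod p) = z 0" using periodic_mod[of z p n, OF per] cc(3)[of 0] by simp
  then have "n mod p = 0" using least[of "n mod p"] p by (meson mod_less_divisor not_gr0 not_le)
  then show "m dvd n" by (simp add: mp dvd_eq_mod_eq_0)
qed

lemma periodic_orbit_cyc:
  assumes "cyc c n z"
  shows "periodic_orbit c (range z)"
  unfolding periodic_orbit_def
  using cycD[OF assms] funpow_quad[of z c _ 0] 
  by (intro exI[of _ "z 0"] exI[of _ n]) (auto simp: funpow_quad[of z c _ 0, OF cycD(2)[OF assms]] cycD(3)[OF assms, of 0, simplified])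

lemma periodic_orbit_obtain:
  assumes "periodic_orbit c Q"
  obtains z where "cyc c (card Q) z" "Q = range z"
proof -
  obtain z0 n where z0: "n > 0" "(quad c ^^ n) z0 = z0" "Q = range (\<lambda>k. (quad c ^^ k) z0)"
    using assms by (auto simp: periodic_orbit_def)
  define z where "z k = (quad c ^^ k) z0" for k
  have "cyc c n z" unfolding cyc_def z_def using z0 by (auto simp: funpow_add quad_def)
  with cyc_card[OF this refl] z0 that[of z] show thesis by (auto simp: z_def[abs_def])
qed

text \<open>The choice operator in \<open>multiplier\<close> picks an unknown point of the orbit,
  hence the shift \<open>i\<close>.\<close>

lemma multiplier_cyc:
  assumes "cyc c n z" "n = card (range z)"
  shows "\<exists>i. multiplier c (range z) = (\<Prod>j<n. 2 * z (i + j))"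
proof -
  have "(SOME w. w \<in> range z) \<in> range z" by (rule someI_ex) auto
  then obtain i where i: "(SOME w. w \<in> range z) = z i" by auto
  show ?thesis
    unfolding multiplier_def i deriv_quad_funpow assms(2)[symmetric]
    by (intro exI[of _ i] prod.cong refl) (simp add: funpow_quad[of z c, OF cycD(2)[OF assms(1)]])
qed

text \<open>Dropping the unit in the weight inequality makes it strict; multiplied around the cycle,
  the values of \<open>\<beta>\<close> cancel.\<close>

lemma weight_multiplier:
  assumes c: "cyc c n z" and w: "weight z \<beta> B" and p: "\<And>j. \<beta> (j + n) = \<beta> j"
  shows "cmod (\<Prod>j<n. 2 * z j) > 1"
proof -
  note W = weightD[OF w]
  have "\<beta> (Suc k) < (\<Prod>j<Suc k. 2 * cmod (z j)) * \<beta> 0" for k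
  proof (induction k)
    case 0
    then show ?case using W(3)[of 0] by simp
  next
    case (Suc k)
    have "\<beta> (Suc (Suc k)) < 2 * cmod (z (Suc k)) * \<beta> (Suc k)" using W(3)[of "Suc k"] by simp
    also have "\<dots> \<le> 2 * cmod (z (Suc k)) * ((\<Prod>j<Suc k. 2 * cmod (z j)) * \<beta> 0)"
      using Suc by (intro mult_left_mono) auto
    finally show ?case by (simp add: mult_ac)
  qed
  from this[of "n - 1"] have "\<beta> n < (\<Prod>j<n. 2 * cmod (z j)) * \<beta> 0" using cycD(1)[OF c] by simp
  then have "1 < (\<Prod>j<n. 2 * cmod (z j))" using p[of 0] W(1)[of 0] by simp
  then show ?thesis by (simp add: prod_norm[symmetric] norm_mult)
qed

lemma weight_shift: "weight z \<beta> B \<Longrightarrow> weight (\<lambda>j. z (i + j)) (\<lambda>j. \<beta> (i + j)) B"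
  by (simp add: weight_def)

lemma cyc_shift: "cyc c n z \<Longrightarrow> cyc c n (\<lambda>j. z (i + j))"
  by (auto simp: cyc_def add.assoc[symmetric])

lemma cyc_mult: "cyc c n z \<Longrightarrow> 0 < k \<Longrightarrow> cyc c (k * n) z"
  by (auto simp: cyc_def periodic_mult)

text \<open>The product over \<open>n\<close> steps is a power of the true multiplier, so its
  modulus exceeds 1 only if that of the multiplier does.\<close>

lemma weight_repelling:
  assumes c: "cyc c n z" and w: "weight z \<beta> B" and p: "\<And>j. \<beta> (j + n) = \<beta> j"
  shows "range z \<in> repelling_orbits c"
proof -
  define m where "m = card (range z)"
  note cm = cyc_card[OF c m_def]
  obtain i where i: "multiplier c (range z) = (\<Prod>j<m. 2 * z (i + j))"
    using multiplier_cyc[OF cm(1) m_def] by auto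
  obtain k where k: "n = k * m" using cm(2) by (metis dvdE mult.commute)
  define P where "P = (\<Prod>j<m. 2 * z (i + j))"
  have per: "z (j + m) = z j" for j using cm(1) by (auto simp: cyc_def)
  have "P ^ k = (\<Prod>j<n. 2 * z (i + j))"
    using prod_period_mult[of "\<lambda>j. 2 * z (i + j)" m k] per by (simp add: k P_def add.assoc[symmetric])
  moreover have "cmod (\<Prod>j<n. 2 * z (i + j)) > 1"
    by (rule weight_multiplier[OF cyc_shift[OF c] weight_shift[OF w]]) (simp add: p add.assoc[symmetric])
  ultimately have "cmod (P ^ k) > 1" by (simp only:)
  then have "cmod P ^ k > 1" by (simp only: norm_power)
  then have "cmod P > 1" by (meson norm_ge_zero not_le power_le_one)
  then show ?thesis using i periodic_orbit_cyc[OF c] by (simp add: repelling_orbits_def P_def)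
qed

lemma repelling_weight_ex:
  assumes c: "cyc c n z" and r: "cmod (\<Prod>j<n. 2 * z j) > 1"
  obtains \<beta> B where "weight z \<beta> B" "\<And>j. \<beta> (j + n) = \<beta> j"
proof -
  note cc = cycD[OF c]
  define P where "P = cmod (\<Prod>j<n. 2 * z j)"
  \<comment> \<open>The mean expansion rate per step. Dividing the derivative after \<open>j\<close>
    steps by \<open>l ^ j\<close> gives a periodic sequence \<open>g\<close> along which every step
    expands by exactly \<open>l\<close>.\<close>
  define l where "l = root n P"
  have P: "P > 1" using r by (simp add: P_def)
  have l: "l > 1" "l ^ n = P" using cc(1) P by (auto simp: l_def)
  define D where "D j = (\<Prod>i<j. 2 * cmod (z i))" for j
  have Dn: "D n = P" by (simp add: D_def P_def prod_norm[symmetric] norm_mult)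
  have znz: "z j \<noteq> 0" for j
  proof -
    have "z (j mod n) \<noteq> 0"
    proof
      assume "z (j mod n) = 0"
      then have "(\<Prod>j<n. 2 * z j) = 0" using cc(1) by (intro prod_zero) auto
      then show False using r by (metis norm_zero not_one_less_zero)
    qed
    then show ?thesis using periodic_mod[of z n j] cc(3) by simp
  qed
  have Dpos: "D j > 0" for j unfolding D_def using znz by (intro prod_pos) auto
  have Dsuc: "D (Suc j) = D j * (2 * cmod (z j))" for j by (simp add: D_def)
  have Dper: "D (j + n) = D j * P" for j
  proof (induction j)
    case (Suc j)
    then show ?case using Dsuc[of "j+n"] Dsuc[of j] cc(3)[of j] by simp
  qed (simp add: Dn, simp add: D_def)
  define g where "g j = D j / l ^ j" for j
  have gpos: "g j > 0" for j using Dpos l by (simp add: g_def)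
  have gper: "g (j + n) = g j" for j using l P by (simp add: g_def Dper power_add)
  have gs: "2 * cmod (z j) * g j = l * g (Suc j)" for j using l by (simp add: g_def Dsuc)
  obtain i1 where i1: "\<And>j. g j \<le> g i1" using periodic_bounded_by_max[of n g, OF cc(1) gper] by blast
  obtain i2 where "\<And>j. - g j \<le> - g i2"
    using periodic_bounded_by_max[of n "\<lambda>j. - g j", OF cc(1)] gper by metis
  then have i2: "g i2 \<le> g j" for j by simp
  define mn mx where "mn = g i2" and "mx = g i1"
  have mn: "mn > 0" and bd: "mn \<le> g j" "g j \<le> mx" for j using gpos i1 i2 by (simp_all add: mn_def mx_def)
  \<comment> \<open>Scaled so that the surplus \<open>(l - 1) * K * g\<close> is at least 1
    everywhere.\<close>
  define K where "K = 1 / ((l - 1) * mn)"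
  have K: "K > 0" using l mn by (simp add: K_def)
  show thesis
  proof
    show "K * g (j + n) = K * g j" for j by (simp add: gper)
    show "weight z (\<lambda>j. K * g j) (K * mx)"
      unfolding weight_def
    proof (intro allI conjI)
      fix j
      show "0 < K * g j" "K * g j \<le> K * mx" using K gpos bd by auto
      have "1 = K * ((l - 1) * mn)" using l mn by (simp add: K_def)
      also have "\<dots> \<le> K * ((l - 1) * g (Suc j))" using K l bd(1)[of "Suc j"] by (intro mult_left_mono) auto
      finally show "1 + K * g (Suc j) \<le> 2 * cmod (z j) * (K * g j)"
        using gs[of j] by (simp add: algebra_simps)
    qed
  qed
qed

lemma repelling_obtain:
  assumes "Q \<in> repelling_orbits c"
  obtains z \<beta> B where "cyc c (card Q) z" "Q = range z"
    "weight z \<beta> B" "\<And>j. \<beta> (j + card Q) = \<beta> j"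
proof -
  have po: "periodic_orbit c Q" and m1: "cmod (multiplier c Q) > 1"
    using assms by (auto simp: repelling_orbits_def)
  obtain z where z: "cyc c (card Q) z" "Q = range z"
    by (rule periodic_orbit_obtain[OF po])
  define n where "n = card Q"
  note zn = z(1)[folded n_def]
  have "n = card (range z)" by (simp add: n_def flip: z(2))
  then obtain i where "multiplier c (range z) = (\<Prod>j<n. 2 * z (i + j))"
    using multiplier_cyc[OF zn] by auto
  then have "cmod (\<Prod>j<n. 2 * z (i + j)) > 1"
    using m1 by (simp only: z(2)[symmetric])
  from repelling_weight_ex[OF cyc_shift[OF zn] this] obtain \<beta> B
    where "weight (\<lambda>j. z (i + j)) \<beta> B" "\<And>j. \<beta> (j + n) = \<beta> j" by blast
  then show thesis
    using that[of "\<lambda>j. z (i + j)" \<beta> B] cyc_shift[OF zn] cyc_range(2)[OF zn] z(2) by (simp add: n_def)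
qed

section \<open>The velocity formula\<close>

lemma branch_variation:
  assumes b: "branch S n x" and S: "open S" "c \<in> S"
  shows "deriv (x (Suc j)) c = 2 * x j c * deriv (x j) c + 1" "deriv (x (j + n)) c = deriv (x j) c"
proof -
  have d: "(x j has_field_derivative deriv (x j) c) (at c)" for j
    using holomorphic_derivI[OF branchD(1)[OF b] S] .
  have ev: "eventually (\<lambda>y. y \<in> S) (nhds c)" using S by (rule eventually_nhds_in_open)
  have "deriv (x (Suc j)) c = deriv (\<lambda>c. (x j c)\<^sup>2 + c) c"
    by (rule deriv_cong_ev) (use ev cycD(2)[OF branchD(2)[OF b]] in \<open>auto elim!: eventually_mono\<close>)
  also have "\<dots> = 2 * x j c * deriv (x j) c + 1"
    by (rule DERIV_imp_deriv) (auto intro!: derivative_eq_intros d)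
  finally show "deriv (x (Suc j)) c = 2 * x j c * deriv (x j) c + 1" .
  show "deriv (x (j + n)) c = deriv (x j) c"
    by (rule deriv_cong_ev) (use ev cycD(3)[OF branchD(2)[OF b]] in \<open>auto elim!: eventually_mono\<close>)
qed

text \<open>The difference of two solutions is multiplied by the derivative along the cycle in each
  step; after \<open>n\<close> steps it must return to itself although the total factor is not
  1.\<close>

lemma linear_recursion_unique:
  assumes c: "cyc c n z" and w: "weight z \<beta> B" and p: "\<And>j. \<beta> (j + n) = \<beta> j"
    and v: "\<And>j. v (Suc j) = 2 * z j * v j + 1" "v n = v 0"
    and u: "\<And>j. u (Suc j) = 2 * z j * u j + 1" "u n = u 0"
  shows "u j = v j"
proof -
  define d where "d j = u j - v j" for j
  have ds: "d (Suc j) = 2 * z j * d j" for j by (simp add: d_def u v algebra_simps)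
  have "d k = (\<Prod>j<k. 2 * z j) * d 0" for k by (induction k) (auto simp: ds)
  from this[of n] have "(\<Prod>j<n. 2 * z j) * d 0 = d 0" by (simp add: d_def u v)
  moreover have "(\<Prod>j<n. 2 * z j) \<noteq> 1" using weight_multiplier[OF c w p] by auto
  ultimately have "d 0 = 0" by (simp del: prod_constant)
  then have "d j = 0" by (induction j) (auto simp: ds)
  then show ?thesis by (simp add: d_def)
qed

lemma cyc_bounded:
  assumes "cyc c n z"
  obtains Z where "\<And>j. cmod (z j) \<le> Z"
  using periodic_bounded_by_max[of n "\<lambda>j. cmod (z j)"] cycD(1,3)[OF assms] that by metis

text \<open>The implicit function theorem for a repelling cycle, on a disc whose size only depends on
  the bound of the weight.\<close>

lemma continuation:
  assumes c: "cyc c n z" and w: "weight z \<beta> B"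
  obtains x where "branch (ball c (1 / (8 * B\<^sup>2))) n x"
    "\<And>j y. y \<in> ball c (1 / (8 * B\<^sup>2)) \<Longrightarrow> cmod (x j y - z j) \<le> 1 / (4 * B)"
    "\<And>j. x j c = z j"
proof -
  note cc = cycD[OF c]
  obtain Z where Z: "\<And>j. cmod (z j) \<le> Z" using cyc_bounded[OF c] by blast
  have B: "B > 0" by (rule weightD[OF w])
  \<comment> \<open>The largest error scale that \<open>shadowing\<close> admits; along a true orbit
    the whole error \<open>s / 2\<close> is available for the parameter, which gives the
    radius.\<close>
  define s where "s = 1 / (4 * B\<^sup>2)"
  have s: "s > 0" "4 * B\<^sup>2 * s \<le> 1" "s / 2 = 1 / (8 * B\<^sup>2)" "s * B = 1 / (4 * B)"
    using B by (auto simp: s_def power2_eq_square)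
  have e: "cmod ((z j)\<^sup>2 + y - z (Suc j)) \<le> s / 2" if "y \<in> ball c (1 / (8 * B\<^sup>2))" for y j
    using that s(3) by (simp add: cc(2) dist_norm norm_minus_commute)
  obtain x where x: "branch (ball c (1 / (8 * B\<^sup>2))) n x"
    "\<And>j y. y \<in> ball c (1 / (8 * B\<^sup>2)) \<Longrightarrow> cmod (x j y - z j) \<le> s * B"
    using shadowing[OF w Z s(1,2) cc(1,3) open_ball e] by blast
  have cin: "c \<in> ball c (1 / (8 * B\<^sup>2))" using B by simp
  have "x j c = z j" for j
    by (rule expansive[OF w _ cc(2) _ _ Z, where x="\<lambda>j. x j c" and \<mu>="s * B"])
      (use cycD(2)[OF branchD(2)[OF x(1) cin]] x(2)[OF cin] s(4) B in auto)
  with x s(4) show thesis by (metis that)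
qed

text \<open>The logarithmic derivative of the product of the \<open>2 * x j\<close> is the sum of
  \<open>v j / x j\<close>. The germ chosen in \<open>continued_point\<close> is known only through
  its defining property, but that already makes its derivatives along the orbit a periodic solution
  of the velocity recursion, and there is just one. The mean may be taken over \<open>n\<close>
  steps because \<open>n\<close> is a multiple of the exact period.\<close>

lemma nu_formula:
  assumes c: "cyc c n z" and w: "weight z \<beta> B" and p: "\<And>j. \<beta> (j + n) = \<beta> j"
    and v: "\<And>j. v (Suc j) = 2 * z j * v j + 1" "\<And>j. v (j + n) = v j"
  shows "rho c (range z) c \<noteq> 0" "nu c (range z) c = (\<Sum>j<n. v j / z j) / of_nat n"
proof -
  define m where "m = card (range z)"
  note cm = cyc_card[OF c m_def]
  note cc = cycD[OF c] and cm1 = cycD[OF cm(1)] and W = weightD[OF w]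
  obtain k where k: "n = k * m" using cm(2) by (metis dvdE mult.commute)
  define P where "P \<zeta> \<longleftrightarrow> \<zeta> analytic_on {c} \<and> \<zeta> c \<in> range z \<and> (\<forall>\<^sub>F c' in nhds c. (quad c' ^^ m) (\<zeta> c') = \<zeta> c')" for \<zeta>
  have "\<exists>\<zeta>. P \<zeta>"
  proof -
    obtain x where x: "branch (ball c (1 / (8 * B\<^sup>2))) m x" "\<And>j. x j c = z j"
      using continuation[OF cm(1) w] by metis
    have cin: "c \<in> ball c (1 / (8 * B\<^sup>2))" using W(4) by simp
    have "P (x 0)"
      unfolding P_def
    proof (intro conjI)
      show "x 0 analytic_on {c}"
        using analytic_at[of "x 0" c] branchD(1)[OF x(1), of 0] cin open_ball by blast
      show "x 0 c \<in> range z" using x(2) by auto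
      have "eventually (\<lambda>y. y \<in> ball c (1 / (8 * B\<^sup>2))) (nhds c)"
        by (rule eventually_nhds_in_open[OF open_ball cin])
      then show "\<forall>\<^sub>F c' in nhds c. (quad c' ^^ m) (x 0 c') = x 0 c'"
      proof eventually_elim
        case (elim y)
        show ?case
          using funpow_quad[of "\<lambda>j. x j y" y m 0] cycD(2,3)[OF branchD(2)[OF x(1) elim]] by (metis add.commute add_0)
      qed
    qed
    then show ?thesis by blast
  qed
  then have P: "P (continued_point c (range z))"
    unfolding continued_point_def m_def[symmetric] P_def[symmetric] by (rule someI_ex)
  define \<zeta> where "\<zeta> = continued_point c (range z)"
  have an: "\<zeta> analytic_on {c}" and ev: "\<forall>\<^sub>F c' in nhds c. (quad c' ^^ m) (\<zeta> c') = \<zeta> c'"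
    using P by (auto simp: P_def \<zeta>_def)
  obtain i where i: "\<zeta> c = z i" using P by (auto simp: P_def \<zeta>_def)
  \<comment> \<open>The orbit of the chosen point as a function of the parameter; it starts at some
    \<open>z i\<close>, so all indices below are shifted by \<open>i\<close>.\<close>
  define Q where "Q j y = (quad y ^^ j) (\<zeta> y)" for j y
  have Q0: "Q 0 = \<zeta>" and QS: "Q (Suc j) = (\<lambda>y. (Q j y)\<^sup>2 + y)" for j by (auto simp: Q_def quad_def)
  have Qc: "Q j c = z (i + j)" for j
    using funpow_quad[of z c j i, OF cc(2)] by (simp add: Q_def i)
  have Qan: "Q j analytic_on {c}" for j
  proof (induction j)
    case (Suc j)
    then show ?case unfolding QS by (intro analytic_intros)
  qed (simp add: Q0 an)
  have Qd: "(Q j has_field_derivative deriv (Q j) c) (at c)" for j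
    using Qan[of j] by (intro analytic_derivI) auto
  define D where "D j = deriv (Q j) c" for j
  have D1: "D (Suc j) = 2 * z (i + j) * D j + 1" for j
    unfolding D_def QS by (rule DERIV_imp_deriv) (auto intro!: derivative_eq_intros Qd simp: Qc)
  have Qm: "\<forall>\<^sub>F y in nhds c. Q (j + m) y = Q j y" for j
    using ev by eventually_elim (simp add: Q_def funpow_add)
  have Dm: "D (j + m) = D j" for j unfolding D_def using Qm by (rule deriv_cong_ev) simp
  have Dn: "D (j + n) = D j" for j unfolding k by (rule periodic_mult) (rule Dm)
  have Dv: "D j = v (i + j)" for j
  proof (rule linear_recursion_unique[OF cyc_shift[OF c] weight_shift[OF w], where v="\<lambda>j. v (i + j)"])
    show "\<beta> (i + (j + n)) = \<beta> (i + j)" for j using p[of "i + j"] by (simp add: add.assoc)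
    show "v (i + Suc j) = 2 * z (i + j) * v (i + j) + 1" for j by (simp add: v)
    show "v (i + n) = v (i + 0)" by (simp add: v)
    show "D n = D 0" using Dn[of 0] by simp
  qed (rule D1)
  define R where "R = (\<Prod>j<m. 2 * z (i + j))"
  have R0: "R \<noteq> 0" using W(5) by (auto simp: R_def)
  have rho: "rho c (range z) = (\<lambda>y. \<Prod>j<m. 2 * Q j y)"
    by (auto simp: rho_def m_def[symmetric] \<zeta>_def[symmetric] deriv_quad_funpow Q_def)
  have rc: "rho c (range z) c = R" by (simp add: rho R_def Qc)
  with R0 show "rho c (range z) c \<noteq> 0" by simp
  have "(rho c (range z) has_field_derivative (\<Prod>j<m. 2 * Q j c) * (\<Sum>j<m. 2 * D j / (2 * Q j c))) (at c)"
    unfolding rho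
    by (rule has_field_derivative_prod') (use W(5) in \<open>auto simp: Qc D_def intro!: derivative_eq_intros Qd\<close>)
  then have dr: "deriv (rho c (range z)) c = R * (\<Sum>j<m. D j / z (i + j))"
    by (subst DERIV_imp_deriv) (auto simp: R_def Qc)
  define h where "h j = D j / z (i + j)" for j
  have hm: "h (j + m) = h j" for j using Dm cm1(3)[of "i + j"] by (simp add: h_def add.assoc)
  have "nu c (range z) c = (\<Sum>j<m. h j) / of_nat m"
    using R0 cm1(1) by (simp add: nu_def m_def[symmetric] rc dr h_def)
  also have "\<dots> = (\<Sum>j<n. h j) / of_nat n"
    using sum_period_mult[of h m k, OF hm] cc(1) by (simp add: k)
  also have "(\<Sum>j<n. h j) = (\<Sum>j<n. v (i + j) / z (i + j))" by (simp add: h_def Dv)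
  also have "\<dots> = (\<Sum>j<n. v j / z j)"
    by (rule sum_shift_period[of "\<lambda>j. v j / z j"]) (simp add: v cc)
  finally show "nu c (range z) c = (\<Sum>j<n. v j / z j) / of_nat n" .
qed

text \<open>A maximum principle: at an index where |v|/\<open>\<beta>\<close> is maximal, a maximum
  above 1 would contradict the weight inequality.\<close>

lemma variation_bound:
  assumes n: "n > 0" and w: "weight z \<beta> B" and p: "\<And>j. \<beta> (j + n) = \<beta> j"
    and v: "\<And>j. v (Suc j) = 2 * z j * v j + 1" "\<And>j. v (j + n) = v j"
  shows "cmod (v j) \<le> \<beta> j"
proof -
  note W = weightD[OF w]
  define a where "a j = cmod (v j) / \<beta> j" for j
  have aper: "a (j + n) = a j" for j by (simp add: a_def p v)
  obtain i where aM: "\<And>j. a j \<le> a i" using periodic_bounded_by_max[of n a, OF n aper] by blast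
  define M where "M = a i"
  note i = M_def[symmetric] and aM = aM[folded M_def]
  have M1: "M \<le> 1"
  proof (rule ccontr)
    assume "\<not> M \<le> 1"
    then have M: "M > 1" by simp
    have "2 * cmod (z i) * (M * \<beta> i) = cmod (2 * z i * v i)"
      using i W(1)[of i] by (simp add: a_def norm_mult field_simps)
    also have "\<dots> = cmod (v (Suc i) - 1)" by (simp add: v)
    also have "\<dots> \<le> cmod (v (Suc i)) + 1" using norm_triangle_ineq4[of "v (Suc i)" 1] by simp
    also have "\<dots> \<le> M * \<beta> (Suc i) + 1" using aM[of "Suc i"] W(1)[of "Suc i"] by (simp add: a_def field_simps)
    also have "\<dots> < M * (\<beta> (Suc i) + 1)" using M by (simp add: algebra_simps)
    also have "\<dots> \<le> M * (2 * cmod (z i) * \<beta> i)" using M W(3)[of i] by (intro mult_left_mono) auto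
    finally show False by (simp add: mult_ac)
  qed
  then have "a j \<le> 1" using aM order_trans by blast
  then show ?thesis using W(1)[of j] by (simp add: a_def)
qed

lemma variation_ex:
  assumes c: "cyc c n z" and w: "weight z \<beta> B"
  obtains v where "\<And>j. v (Suc j) = 2 * z j * v j + 1" "\<And>j. v (j + n) = v j"
proof -
  obtain x where x: "branch (ball c (1 / (8 * B\<^sup>2))) n x" "\<And>j. x j c = z j"
    using continuation[OF c w] by metis
  have cin: "c \<in> ball c (1 / (8 * B\<^sup>2))" using weightD(4)[OF w] by simp
  show thesis
    using that[of "\<lambda>j. deriv (x j) c"] branch_variation[OF x(1) open_ball cin] by (simp add: x(2))
qed

lemma repelling_variation:
  assumes "Q \<in> repelling_orbits c"
  obtains z \<beta> B v where "cyc c (card Q) z" "Q = range z"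
    "weight z \<beta> B" "\<And>j. \<beta> (j + card Q) = \<beta> j"
    "\<And>j. v (Suc j) = 2 * z j * v j + 1" "\<And>j. v (j + card Q) = v j"
    "nu c Q c = (\<Sum>j<card Q. v j / z j) / of_nat (card Q)"
proof -
  obtain z \<beta> B where z: "cyc c (card Q) z" "Q = range z"
    "weight z \<beta> B" "\<And>j. \<beta> (j + card Q) = \<beta> j" using repelling_obtain[OF assms] by blast
  obtain v where v: "\<And>j. v (Suc j) = 2 * z j * v j + 1" "\<And>j. v (j + card Q) = v j"
    using variation_ex[OF z(1,3)] by blast
  have "nu c (range z) c = (\<Sum>j<card Q. v j / z j) / of_nat (card Q)"
    by (rule nu_formula(2)[OF z(1,3,4) v])
  then have nu: "nu c Q c = (\<Sum>j<card Q. v j / z j) / of_nat (card Q)" by (simp only: z(2)[symmetric])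
  show thesis
    by (rule that[of z \<beta> B v]) (fact z nu v)+
qed

section \<open>Comparison of velocities\<close>

text \<open>Here \<open>u\<close> is only an approximate velocity, along a pseudo-orbit
  \<open>z\<close>. Its residual is measured in the sum norm, not in the supremum norm: it is large
  at jumps, but there are few of these, so after division by \<open>n\<close> their contribution is
  negligible.\<close>

lemma variation_compare:
  assumes n: "n > 0" and w: "weight x \<gamma> B" and p: "\<And>j. \<gamma> (j + n) = \<gamma> j"
    and v: "\<And>j. v (Suc j) = 2 * x j * v j + 1" "\<And>j. v (j + n) = v j"
    and wp: "\<And>j. u (j + n) = u j"
    and near: "\<And>j. cmod (x j - z j) \<le> \<sigma>" and M: "\<And>j. cmod (u j) \<le> M"
    and zB: "\<And>j. 1 \<le> 2 * B * cmod (z j)"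
  shows "cmod ((\<Sum>j<n. v j / x j) - (\<Sum>j<n. u j / z j)) \<le>
    2 * B\<^sup>2 * (1 + B) * ((\<Sum>j<n. cmod (u (Suc j) - 2 * z j * u j - 1)) + 2 * n * \<sigma> * M) + 4 * B\<^sup>2 * M * \<sigma> * n"
proof -
  note W = weightD[OF w]
  have B: "B > 0" by (rule W)
  have M0: "M \<ge> 0" using M[of 0] norm_ge_zero order_trans by blast
  have s0: "\<sigma> \<ge> 0" using near[of 0] norm_ge_zero order_trans by blast
  define d where "d j = v j - u j" for j
  define R where "R j = cmod (u (Suc j) - 2 * z j * u j - 1) + 2 * \<sigma> * M" for j
  define a where "a j = cmod (d j) / \<gamma> j" for j
  have a0: "a j \<ge> 0" for j using W(1)[of j] by (simp add: a_def)
  have R0: "R j \<ge> 0" for j using s0 M0 by (simp add: R_def)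
  have aper: "a (j + n) = a j" for j by (simp add: a_def d_def p v wp)
  have d1: "cmod (d (Suc j)) + R j \<ge> 2 * cmod (x j) * cmod (d j)" for j
  proof -
    have "2 * x j * d j = d (Suc j) + ((u (Suc j) - 2 * z j * u j - 1) - 2 * (x j - z j) * u j)"
      by (simp add: d_def v algebra_simps)
    then have "cmod (2 * x j * d j) \<le> cmod (d (Suc j)) + (cmod (u (Suc j) - 2 * z j * u j - 1) + cmod (2 * (x j - z j) * u j))"
      by (metis norm_triangle_ineq norm_triangle_ineq4 add_left_mono order_trans)
    moreover have "cmod (2 * (x j - z j) * u j) \<le> 2 * \<sigma> * M"
      unfolding norm_mult using near[of j] M[of j] s0 by (intro mult_mono) auto
    ultimately show ?thesis by (simp add: R_def norm_mult)
  qed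
  have a1: "a j \<le> B / (1 + B) * a (Suc j) + R j" for j
  proof -
    have "a j * (1 + \<gamma> (Suc j)) \<le> a j * (2 * cmod (x j) * \<gamma> j)" using a0 W(3)[of j] by (intro mult_left_mono)
    also have "\<dots> = 2 * cmod (x j) * cmod (d j)" using W(1)[of j] by (simp add: a_def)
    also have "\<dots> \<le> cmod (d (Suc j)) + R j" by (rule d1)
    also have "\<dots> = a (Suc j) * \<gamma> (Suc j) + R j" using W(1)[of "Suc j"] by (simp add: a_def)
    finally have 1: "a j * (1 + \<gamma> (Suc j)) \<le> a (Suc j) * \<gamma> (Suc j) + R j" .
    have "a (Suc j) * \<gamma> (Suc j) \<le> a (Suc j) * (B / (1 + B) * (1 + \<gamma> (Suc j)))"
      using a0 W(1,2)[of "Suc j"] B by (intro mult_left_mono) (auto simp: field_simps)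
    moreover have "R j \<le> R j * (1 + \<gamma> (Suc j))" using R0[of j] W(1)[of "Suc j"] by (simp add: algebra_simps)
    ultimately have "a j * (1 + \<gamma> (Suc j)) \<le> (B / (1 + B) * a (Suc j) + R j) * (1 + \<gamma> (Suc j))"
      using 1 by (simp add: algebra_simps)
    then show ?thesis using W(1)[of "Suc j"] by (simp add: mult_le_cancel_right)
  qed
  have shift: "(\<Sum>j<n. a (Suc j)) = (\<Sum>j<n. a j)"
  proof -
    have "(\<Sum>j<Suc n. a j) = a 0 + (\<Sum>j<n. a (Suc j))" by (rule sum.lessThan_Suc_shift)
    then show ?thesis using aper[of 0] by simp
  qed
  \<comment> \<open>Around the cycle both sides contain the same sum, and
    \<open>1 - B / (1 + B) = 1 / (1 + B)\<close>; the total error is therefore at most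
    \<open>1 + B\<close> times the total residual.\<close>
  have "(\<Sum>j<n. a j) \<le> B / (1 + B) * (\<Sum>j<n. a (Suc j)) + (\<Sum>j<n. R j)"
    unfolding sum_distrib_left sum.distrib[symmetric] by (intro sum_mono a1)
  then have "(\<Sum>j<n. a j) * (1 + B) \<le> B * (\<Sum>j<n. a j) + (1 + B) * (\<Sum>j<n. R j)"
    unfolding shift using B by (simp add: field_simps)
  then have suma: "(\<Sum>j<n. a j) \<le> (1 + B) * (\<Sum>j<n. R j)" by (simp add: algebra_simps)
  have trm: "cmod (v j / x j - u j / z j) \<le> 2 * B\<^sup>2 * a j + 4 * B\<^sup>2 * M * \<sigma>" for j
  proof -
    have zn: "z j \<noteq> 0" "x j \<noteq> 0" using zB[of j] W(5)[of j] by auto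
    have iz: "1 / cmod (z j) \<le> 2 * B" "1 / cmod (x j) \<le> 2 * B" 
      using zB[of j] W(6)[of j] zn by (simp_all add: field_simps)
    have da: "cmod (d j) \<le> B * a j"
      using W(1,2)[of j] a0[of j] mult_right_mono[OF W(2)[of j] a0[of j]] by (simp add: a_def)
    have "v j / x j - u j / z j = d j / x j + u j * (z j - x j) / (x j * z j)"
      using zn by (simp add: d_def field_simps)
    then have "cmod (v j / x j - u j / z j) \<le> cmod (d j) * (1 / cmod (x j)) + cmod (u j) * cmod (z j - x j) * ((1 / cmod (x j)) * (1 / cmod (z j)))"
      using norm_triangle_ineq[of "d j / x j" "u j * (z j - x j) / (x j * z j)"]
      by (simp add: norm_divide norm_mult)
    also have "\<dots> \<le> (B * a j) * (2 * B) + (M * \<sigma>) * ((2 * B) * (2 * B))"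
      using da iz M[of j] near[of j] M0 s0 B a0[of j]
      by (intro add_mono mult_mono) (auto simp: norm_minus_commute)
    finally show ?thesis by (simp add: power2_eq_square algebra_simps)
  qed
  have "cmod ((\<Sum>j<n. v j / x j) - (\<Sum>j<n. u j / z j)) \<le> (\<Sum>j<n. cmod (v j / x j - u j / z j))"
    unfolding sum_subtractf[symmetric] by (rule norm_sum)
  also have "\<dots> \<le> (\<Sum>j<n. 2 * B\<^sup>2 * a j + 4 * B\<^sup>2 * M * \<sigma>)" by (intro sum_mono trm)
  also have "\<dots> = 2 * B\<^sup>2 * (\<Sum>j<n. a j) + 4 * B\<^sup>2 * M * \<sigma> * n"
    by (simp add: sum.distrib sum_distrib_left)
  also have "\<dots> \<le> 2 * B\<^sup>2 * ((1 + B) * (\<Sum>j<n. R j)) + 4 * B\<^sup>2 * M * \<sigma> * n"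
    using suma by (intro add_right_mono mult_left_mono) auto
  also have "(\<Sum>j<n. R j) = (\<Sum>j<n. cmod (u (Suc j) - 2 * z j * u j - 1)) + 2 * n * \<sigma> * M"
    by (simp add: R_def sum.distrib)
  finally show ?thesis by (simp add: mult.assoc)
qed

section \<open>Asymptotics of linear recursions and Cesaro means\<close>

lemma contracting_tendsto_zero:
  fixes A e :: "nat \<Rightarrow> real"
  assumes k: "0 \<le> k" "k < 1" and A: "\<And>l. 0 \<le> A l" and e: "e \<longlonglongrightarrow> 0"
    and step: "\<forall>\<^sub>F l in sequentially. A (Suc l) \<le> k * A l + e l"
  shows "A \<longlonglongrightarrow> 0"
proof (rule LIMSEQ_I)
  fix r :: real assume r: "0 < r"
  define d where "d = r / 2"
  have d: "d > 0" "(1 - k) * d > 0" using r k by (auto simp: d_def)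
  have "\<forall>\<^sub>F l in sequentially. e l < (1 - k) * d" using order_tendstoD(2)[OF e d(2)] .
  then have "\<forall>\<^sub>F l in sequentially. A (Suc l) \<le> k * A l + (1 - k) * d"
    using step by eventually_elim auto
  then obtain N where N: "\<And>l. l \<ge> N \<Longrightarrow> A (Suc l) \<le> k * A l + (1 - k) * d"
    by (auto simp: eventually_sequentially)
  have ind: "A (N + i) \<le> k ^ i * A N + d" for i
  proof (induction i)
    case (Suc i)
    have "A (N + Suc i) \<le> k * A (N + i) + (1 - k) * d" using N[of "N + i"] by simp
    also have "\<dots> \<le> k * (k ^ i * A N + d) + (1 - k) * d" using Suc k by (intro add_right_mono mult_left_mono)
    finally show ?case by (simp add: algebra_simps)
  qed (use d in auto)
  have "(\<lambda>i. k ^ i * A N) \<longlonglongrightarrow> 0" using LIMSEQ_realpow_zero[OF k] by (rule tendsto_mult_left_zero)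
  then have "\<forall>\<^sub>F i in sequentially. k ^ i * A N < d" using d order_tendstoD(2) by blast
  then obtain I where I: "\<And>i. i \<ge> I \<Longrightarrow> k ^ i * A N < d" by (auto simp: eventually_sequentially)
  show "\<exists>no. \<forall>n\<ge>no. norm (A n - 0) < r"
  proof (intro exI allI impI)
    fix l assume l: "l \<ge> N + I"
    then have "A l \<le> k ^ (l - N) * A N + d" using ind[of "l - N"] by simp
    also have "\<dots> < d + d" using I[of "l - N"] l by (intro add_strict_right_mono) auto
    also have "\<dots> = r" by (simp add: d_def)
    finally show "norm (A l - 0) < r" using A[of l] by simp
  qed
qed

text \<open>Read backward in time, the velocity recursion divides by the derivative and so contracts
  in the weighted norm. Hence solutions whose coefficients agree asymptotically merge, whatever
  their initial values.\<close>

lemma recursion_asymp: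
  fixes y a t s :: "nat \<Rightarrow> complex"
  assumes b: "\<And>l. 0 < \<beta> l" "\<And>l. \<beta> l \<le> B" "\<And>l. 1 + \<beta> l \<le> cmod (t l) * \<beta> (Suc l)"
    and y: "\<And>l. t l * y (Suc l) = y l + e" "\<And>l. cmod (y l) \<le> M"
    and a: "\<And>l. s l * a (Suc l) = a l + e" and st: "(\<lambda>l. s l - t l) \<longlonglongrightarrow> 0"
  shows "(\<lambda>l. a l - y l) \<longlonglongrightarrow> 0"
proof -
  have B: "B > 0" using b(1,2)[of 0] by linarith
  define A where "A l = cmod (a l - y l) / \<beta> l" for l
  have A0: "A l \<ge> 0" for l using b(1)[of l] by (simp add: A_def)
  have M0: "M \<ge> 0" using y(2)[of 0] norm_ge_zero order_trans by blast
  have st': "(\<lambda>l. cmod (s l - t l)) \<longlonglongrightarrow> 0" using st by (rule tendsto_norm_zero)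
  \<comment> \<open>This closeness costs at most half of the unit in the inequality for
    \<open>\<beta>\<close>; the other half still gives the contraction factor
    \<open>B / (1/2 + B)\<close>.\<close>
  have "\<forall>\<^sub>F l in sequentially. cmod (s l - t l) < 1 / (2 * B)" using order_tendstoD(2)[OF st'] B by simp
  then have ev: "\<forall>\<^sub>F l in sequentially. A (Suc l) \<le> (B / (1/2 + B)) * A l + 2 * M * cmod (s l - t l)"
  proof eventually_elim
    case (elim l)
    let ?d = "a (Suc l) - y (Suc l)"
    have "s l * ?d = (a l - y l) + (t l - s l) * y (Suc l)" using a[of l] y(1)[of l] by (simp add: algebra_simps)
    then have "cmod (s l) * cmod ?d \<le> cmod (a l - y l) + cmod (s l - t l) * cmod (y (Suc l))"
      by (metis norm_mult norm_triangle_ineq norm_minus_commute)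
    also have "\<dots> \<le> A l * \<beta> l + cmod (s l - t l) * M"
      using y(2)[of "Suc l"] b(1)[of l] by (intro add_mono mult_left_mono) (auto simp: A_def)
    finally have 1: "cmod (s l) * cmod ?d \<le> A l * \<beta> l + cmod (s l - t l) * M" .
    have "cmod (t l) \<le> cmod (s l) + cmod (s l - t l)" by (metis norm_minus_commute norm_triangle_sub)
    then have "cmod (t l) * \<beta> (Suc l) \<le> (cmod (s l) + 1 / (2 * B)) * \<beta> (Suc l)"
      using elim b(1)[of "Suc l"] by (intro mult_right_mono) auto
    also have "\<dots> \<le> cmod (s l) * \<beta> (Suc l) + 1 / 2" using b(2)[of "Suc l"] B by (simp add: field_simps)
    finally have 2: "1 / 2 + \<beta> l \<le> cmod (s l) * \<beta> (Suc l)" using b(3)[of l] by linarith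
    have "A (Suc l) * (1/2 + \<beta> l) \<le> A (Suc l) * (cmod (s l) * \<beta> (Suc l))"
      using 2 A0 by (intro mult_left_mono)
    also have "\<dots> = cmod (s l) * cmod ?d" using b(1)[of "Suc l"] by (simp add: A_def)
    also note 1
    also have "A l * \<beta> l \<le> A l * (B / (1/2 + B) * (1/2 + \<beta> l))"
      using A0 b(1,2)[of l] B by (intro mult_left_mono) (auto simp: field_simps)
    also have "cmod (s l - t l) * M \<le> 2 * M * cmod (s l - t l) * (1/2 + \<beta> l)"
      using b(1)[of l] M0 by (simp add: algebra_simps)
    finally have "A (Suc l) * (1/2 + \<beta> l) \<le> (B / (1/2 + B) * A l + 2 * M * cmod (s l - t l)) * (1/2 + \<beta> l)"
      by (simp add: algebra_simps)
    then show ?case using b(1)[of l] by (simp add: mult_le_cancel_right)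
  qed
  have "A \<longlonglongrightarrow> 0"
  proof (rule contracting_tendsto_zero[OF _ _ A0 _ ev])
    show "(\<lambda>l. 2 * M * cmod (s l - t l)) \<longlonglongrightarrow> 0" using st' by (rule tendsto_mult_right_zero)
  qed (use B in \<open>auto simp: field_simps\<close>)
  then have "(\<lambda>l. B * A l) \<longlonglongrightarrow> 0" by (rule tendsto_mult_right_zero)
  then show ?thesis
  proof (rule Lim_null_comparison[rotated])
    show "\<forall>\<^sub>F l in sequentially. norm (a l - y l) \<le> B * A l"
    proof (rule always_eventually, rule allI)
      fix l
      show "norm (a l - y l) \<le> B * A l"
        using mult_right_mono[OF b(2)[of l] A0[of l]] b(1)[of l] by (simp add: A_def)
    qed
  qed
qed

lemma cesaro_zero:
  fixes f :: "nat \<Rightarrow> complex"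
  assumes "f \<longlonglongrightarrow> 0"
  shows "(\<lambda>n. (\<Sum>i<n. f i) / of_nat n) \<longlonglongrightarrow> 0"
proof (rule LIMSEQ_I)
  fix r :: real assume r: "0 < r"
  obtain N where N: "\<And>n. n \<ge> N \<Longrightarrow> cmod (f n) < r / 2" using LIMSEQ_D[OF assms, of "r/2"] r by auto
  define C where "C = (\<Sum>i<N. cmod (f i))"
  have bd: "(\<Sum>i<n. cmod (f i)) \<le> C + n * (r / 2)" for n
  proof (induction n)
    case (Suc n)
    show ?case
    proof (cases "n < N")
      case True
      have "(\<Sum>i<Suc n. cmod (f i)) \<le> C" unfolding C_def using True by (intro sum_mono2) auto
      then show ?thesis using r by (simp add: add_increasing2)
    next
      case False
      then show ?thesis using Suc N[of n] by (simp add: distrib_right add_divide_distrib)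
    qed
  qed (auto simp: C_def sum_nonneg)
  obtain m where m: "real m > 2 * C / r" using reals_Archimedean2 by blast
  show "\<exists>no. \<forall>n\<ge>no. norm ((\<Sum>i<n. f i) / of_nat n - 0) < r"
  proof (intro exI allI impI)
    fix n assume n: "n \<ge> Suc m"
    have "2 * C / r < n" using m n by linarith
    then have "C < n * (r / 2)" using r by (simp add: field_simps)
    then have "cmod (\<Sum>i<n. f i) < n * r" using bd[of n] norm_sum[of f "{..<n}"] by (simp add: field_simps)
    then show "norm ((\<Sum>i<n. f i) / of_nat n - 0) < r" using n by (simp add: norm_divide field_simps)
  qed
qed

text \<open>The partial sums of \<open>g\<close> minus its mean are periodic, hence bounded, and
  vanish after division by their length.\<close>

lemma cesaro_periodic:
  fixes f g :: "nat \<Rightarrow> complex"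
  assumes n: "n > 0" and g: "\<And>j. g (j + n) = g j" and fg: "(\<lambda>j. f j - g j) \<longlonglongrightarrow> 0"
  shows "(\<lambda>l. (\<Sum>i<l. f i) / of_nat l) \<longlonglongrightarrow> (\<Sum>j<n. g j) / of_nat n"
proof -
  define \<nu> where "\<nu> = (\<Sum>j<n. g j) / of_nat n"
  define G where "G l = (\<Sum>i<l. g i - \<nu>)" for l
  have Gn: "G (l + n) = G l" for l
  proof -
    have "G (l + n) = G l + (\<Sum>j<n. g (l + j) - \<nu>)" unfolding G_def by (rule sum_lessThan_add)
    moreover have "(\<Sum>j<n. g (l + j) - \<nu>) = 0"
      using sum_shift_period[of g n l, OF g] n by (simp add: sum_subtractf \<nu>_def)
    ultimately show ?thesis by simp
  qed
  obtain i where Gb: "\<And>l. cmod (G l) \<le> cmod (G i)"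
    using periodic_bounded_by_max[of n "\<lambda>l. cmod (G l)", OF n] Gn by metis
  have "(\<lambda>l. G l / of_nat l) \<longlonglongrightarrow> 0"
  proof (rule Lim_null_comparison)
    show "\<forall>\<^sub>F l in sequentially. norm (G l / of_nat l) \<le> cmod (G i) / real l"
      using Gb by (intro always_eventually allI) (simp add: norm_divide divide_right_mono)
    show "(\<lambda>l. cmod (G i) / real l) \<longlonglongrightarrow> 0" by (rule lim_const_over_n)
  qed
  then have "(\<lambda>l. (\<Sum>i<l. f i - g i) / of_nat l + G l / of_nat l + \<nu>) \<longlonglongrightarrow> 0 + 0 + \<nu>"
    by (intro tendsto_add tendsto_const cesaro_zero fg)
  moreover have "\<forall>\<^sub>F l in sequentially. (\<Sum>i<l. f i - g i) / of_nat l + G l / of_nat l + \<nu> = (\<Sum>i<l. f i) / of_nat l"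
    using eventually_gt_at_top[of 0]
    by eventually_elim (simp add: G_def sum_subtractf field_simps)
  ultimately show ?thesis unfolding \<nu>_def[symmetric] by (simp add: tendsto_cong)
qed

section \<open>Backward orbits\<close>

lemma nearest_root:
  obtains q :: complex where "q\<^sup>2 + c = y" "cmod (q - p) \<le> cmod (q + p)"
proof (cases "cmod (csqrt (y - c) - p) \<le> cmod (csqrt (y - c) + p)")
  case True
  show ?thesis by (rule that[of "csqrt (y - c)"]) (use True in auto)
next
  case False
  have "cmod (- csqrt (y - c) - p) = cmod (csqrt (y - c) + p)" "cmod (- csqrt (y - c) + p) = cmod (csqrt (y - c) - p)"
  proof -
    have "- csqrt (y - c) - p = - (csqrt (y - c) + p)" "- csqrt (y - c) + p = - (csqrt (y - c) - p)" by simp_all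
    then show "cmod (- csqrt (y - c) - p) = cmod (csqrt (y - c) + p)" "cmod (- csqrt (y - c) + p) = cmod (csqrt (y - c) - p)"
      by (simp_all only: norm_minus_cancel)
  qed
  then show ?thesis using False by (intro that[of "- csqrt (y - c)"]) auto
qed

text \<open>\<open>q (Suc l)\<close> is the preimage of \<open>q l\<close> nearer to
  \<open>p (Suc l)\<close>. As (q - p)(q + p) at \<open>Suc l\<close> is the difference at
  \<open>l\<close>, and the nearer choice gives |q + p| >= |p|, the distance contracts in the
  weighted norm.\<close>

lemma backward_orbit:
  assumes b: "\<And>l. 0 < \<beta> l" "\<And>l. \<beta> l \<le> B" "\<And>l. 1 + \<beta> l \<le> 2 * cmod (p (Suc l)) * \<beta> (Suc l)"
    and p: "\<And>l. p l = (p (Suc l))\<^sup>2 + c" and y: "cmod (y - p 0) \<le> \<beta> 0 / (8 * B ^ 3)"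
  obtains q where "q 0 = y" "\<And>l. q l = (q (Suc l))\<^sup>2 + c" "\<And>l. q (Suc l) \<noteq> 0" "(\<lambda>l. q l - p l) \<longlonglongrightarrow> 0"
proof -
  have B: "B > 0" using b(1,2)[of 0] by linarith
  have pB: "1 / (2 * B) \<le> cmod (p (Suc l))" for l
  proof -
    have "1 \<le> 2 * cmod (p (Suc l)) * \<beta> (Suc l)" using b(1)[of l] b(3)[of l] by linarith
    also have "\<dots> \<le> 2 * cmod (p (Suc l)) * B" using b(2)[of "Suc l"] by (intro mult_left_mono) auto
    finally show ?thesis using B by (simp add: field_simps)
  qed
  define N where "N l u = (SOME q. q\<^sup>2 + c = u \<and> cmod (q - p (Suc l)) \<le> cmod (q + p (Suc l)))" for l u
  have N: "(N l u)\<^sup>2 + c = u" "cmod (N l u - p (Suc l)) \<le> cmod (N l u + p (Suc l))" for l u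
  proof -
    have "\<exists>q. q\<^sup>2 + c = u \<and> cmod (q - p (Suc l)) \<le> cmod (q + p (Suc l))"
      using nearest_root[of c u "p (Suc l)"] by blast
    from someI_ex[OF this] show "(N l u)\<^sup>2 + c = u" "cmod (N l u - p (Suc l)) \<le> cmod (N l u + p (Suc l))"
      by (auto simp: N_def)
  qed
  define q where "q = rec_nat y N"
  have q0: "q 0 = y" and qs: "q (Suc l) = N l (q l)" for l by (auto simp: q_def)
  have qq: "q l = (q (Suc l))\<^sup>2 + c" for l using N(1)[of l "q l"] by (simp add: qs)
  define k where "k = B / (1/2 + B)"
  have k: "0 \<le> k" "k < 1" using B by (auto simp: k_def field_simps)
  have kb: "\<beta> l \<le> k * (1/2 + \<beta> l)" for l
    using b(1,2)[of l] B by (simp add: k_def field_simps)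
  \<comment> \<open>A distance of at most \<open>h * B\<close> is turned by one preimage into at
    most \<open>h * B * (2 * B) = 1 / (4 * B)\<close>. This is half of the lower bound for |p|, so
    \<open>q\<close> avoids 0 and the inequality for \<open>\<beta>\<close> survives with 1/2 in
    place of 1.\<close>
  define h where "h = 1 / (8 * B ^ 3)"
  have h: "h > 0" using B by (simp add: h_def)
  have small: "cmod (q (Suc l) - p (Suc l)) \<le> 1 / (4 * B) \<and> cmod (q (Suc l) - p (Suc l)) \<le> h * \<beta> (Suc l) * k ^ Suc l"
    if IH: "cmod (q l - p l) \<le> h * \<beta> l * k ^ l" for l
  proof -
    let ?d = "cmod (q (Suc l) - p (Suc l))" and ?s = "cmod (q (Suc l) + p (Suc l))"
    have "q l - p l = (q (Suc l) - p (Suc l)) * (q (Suc l) + p (Suc l))"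
      using qq[of l] p[of l] by (simp add: algebra_simps power2_eq_square)
    then have e: "?d * ?s = cmod (q l - p l)" by (simp add: norm_mult)
    have ds: "?d \<le> ?s" using N(2)[of l "q l"] by (simp add: qs)
    have tri: "2 * cmod (p (Suc l)) \<le> ?s + ?d"
      using norm_triangle_ineq4[of "q (Suc l) + p (Suc l)" "q (Suc l) - p (Suc l)"] by (simp add: norm_mult)
    then have "1 / (2 * B) \<le> ?s" using ds pB[of l] by linarith
    then have "?d * (1 / (2 * B)) \<le> cmod (q l - p l)" unfolding e[symmetric] by (intro mult_left_mono) auto
    also have "\<dots> \<le> h * B * 1"
      by (rule order_trans[OF IH], intro mult_mono) (use b(1,2)[of l] h B k power_le_one[of k l] in auto)
    finally have "?d \<le> h * B * (2 * B)" using B by (simp add: field_simps)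
    also have "\<dots> = 1 / (4 * B)" using B by (simp add: h_def power2_eq_square power3_eq_cube)
    finally have d4: "?d \<le> 1 / (4 * B)" .
    have "(2 * cmod (p (Suc l)) - 1 / (4 * B)) * \<beta> (Suc l) \<le> ?s * \<beta> (Suc l)"
      using tri d4 b(1)[of "Suc l"] by (intro mult_right_mono) auto
    moreover have "1 / (4 * B) * \<beta> (Suc l) \<le> 1/4" using b(2)[of "Suc l"] B by (simp add: field_simps)
    ultimately have s: "1/2 + \<beta> l \<le> ?s * \<beta> (Suc l)" using b(3)[of l] by (simp add: algebra_simps)
    have "?d * (1/2 + \<beta> l) \<le> ?d * (?s * \<beta> (Suc l))" using s by (intro mult_left_mono) auto
    also have "\<dots> = cmod (q l - p l) * \<beta> (Suc l)" by (simp add: e[symmetric])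
    also have "\<dots> \<le> h * \<beta> l * k ^ l * \<beta> (Suc l)" using IH b(1)[of "Suc l"] by (intro mult_right_mono) auto
    also have "\<dots> \<le> h * (k * (1/2 + \<beta> l)) * k ^ l * \<beta> (Suc l)"
      by (intro mult_right_mono mult_left_mono kb zero_le_power) (use h k b(1)[of "Suc l"] in auto)
    finally have "?d * (1/2 + \<beta> l) \<le> (h * \<beta> (Suc l) * k ^ Suc l) * (1/2 + \<beta> l)" by (simp add: algebra_simps)
    then have "?d \<le> h * \<beta> (Suc l) * k ^ Suc l" using b(1)[of l] by (simp add: mult_le_cancel_right)
    with d4 show ?thesis by blast
  qed
  have inv: "cmod (q l - p l) \<le> h * \<beta> l * k ^ l" for l
  proof (induction l)
    case 0
    then show ?case using y by (simp add: q0 h_def)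
  next
    case (Suc l)
    then show ?case using small by blast
  qed
  show thesis
  proof (rule that[of q])
    show "q (Suc l) \<noteq> 0" for l
    proof
      assume "q (Suc l) = 0"
      then have "cmod (p (Suc l)) \<le> 1 / (4 * B)" using small[OF inv[of l]] by simp
      then show False using pB[of l] B by (simp add: field_simps)
    qed
    show "(\<lambda>l. q l - p l) \<longlonglongrightarrow> 0"
    proof (rule Lim_null_comparison)
      show "(\<lambda>l. h * B * k ^ l) \<longlonglongrightarrow> 0" using LIMSEQ_realpow_zero[OF k] by (rule tendsto_mult_right_zero)
      show "\<forall>\<^sub>F l in sequentially. norm (q l - p l) \<le> h * B * k ^ l"
      proof (rule always_eventually, rule allI)
        fix l
        have "h * \<beta> l * k ^ l \<le> h * B * k ^ l"
          using b(2)[of l] h k by (intro mult_right_mono mult_left_mono) auto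
        then show "norm (q l - p l) \<le> h * B * k ^ l" using inv[of l] by linarith
      qed
    qed
  qed (fact q0 qq)+
qed

text \<open>If the iterates avoided \<open>v\<close> near the cycle, they would also avoid its two preimages, hence
  be normal by Schottky's theorem; but their derivatives at the cycle are unbounded.\<close>

lemma repelling_reaches:
  assumes c: "cyc c n p" and w: "weight p \<beta> B" and per: "\<And>j. \<beta> (j + n) = \<beta> j"
    and v: "v \<noteq> c" and e: "e > 0"
  shows "\<exists>y\<in>ball (p 0) e. \<exists>m. (quad c ^^ m) y = v"
proof (rule ccontr)
  assume "\<not> ?thesis"
  then have N: "(quad c ^^ m) y \<noteq> v" if "y \<in> ball (p 0) e" for y m using that by blast
  note cc = cycD[OF c]
  define v1 where "v1 = csqrt (v - c)"
  have v1: "v1\<^sup>2 + c = v" "(-v1)\<^sup>2 + c = v" "v1 \<noteq> 0" using v by (auto simp: v1_def)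
  have N1: "(quad c ^^ m) y \<noteq> v1" "(quad c ^^ m) y \<noteq> - v1" if "y \<in> ball (p 0) e" for y m
    using N[OF that, of "Suc m"] v1 by (auto simp: quad_def)
  define r where "r = e / 2"
  have r: "r > 0" using e by (simp add: r_def)
  have inb: "p 0 + of_real r * w \<in> ball (p 0) e" if "w \<in> cball 0 1" for w
  proof -
    have "r * cmod w \<le> r * 1" using that r by (intro mult_left_mono) auto
    also have "\<dots> < e" using e by (simp add: r_def)
    finally show ?thesis using r by (simp add: dist_norm norm_mult)
  qed
  define \<rho> where "\<rho> = (\<Prod>j<n. 2 * p j)"
  have \<rho>: "cmod \<rho> > 1" unfolding \<rho>_def by (rule weight_multiplier[OF c w per])
  \<comment> \<open>An affine normalisation: the omitted values \<open>v1\<close> and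
    \<open>- v1\<close> become the 0 and 1 of Schottky's theorem. They are distinct because
    \<open>v \<noteq> c\<close>.\<close>
  define h where "h k w = ((quad c ^^ (k * n)) (p 0 + of_real r * w) - v1) / (- 2 * v1)" for k w
  have hd: "(h k has_field_derivative ((\<Prod>i<k * n. 2 * (quad c ^^ i) (p 0 + of_real r * w)) * of_real r) / (- 2 * v1)) (at w)" for k w
  proof -
    have "((\<lambda>w. p 0 + of_real r * w) has_field_derivative of_real r) (at w)"
      by (auto intro!: derivative_eq_intros)
    from DERIV_chain2[OF quad_funpow_deriv[where c=c and k="k * n"] this]
    have "((\<lambda>w. (quad c ^^ (k * n)) (p 0 + of_real r * w) - v1) has_field_derivative
        (\<Prod>i<k * n. 2 * (quad c ^^ i) (p 0 + of_real r * w)) * of_real r - 0) (at w)"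
      by (intro DERIV_diff DERIV_const)
    then show ?thesis unfolding h_def by (intro DERIV_cdivide) simp
  qed
  have hol: "h k holomorphic_on S" for k S
    using hd field_differentiable_at_within unfolding holomorphic_on_def field_differentiable_def by blast
  have h0: "h k 0 = (p 0 - v1) / (- 2 * v1)" for k
  proof -
    have "(quad c ^^ (k * n)) (p 0) = p (0 + k * n)" by (rule funpow_quad[of p c "k*n" 0, OF cc(2)])
    also have "\<dots> = p 0" by (rule periodic_mult[of p n 0 k, OF cc(3)])
    finally show ?thesis by (simp add: h_def)
  qed
  define M where "M = exp (pi * exp (pi * (2 + 2 * cmod ((p 0 - v1) / (- 2 * v1)) + 12 * (1/2) / (1 - 1/2))))"
  have hM: "cmod (h k w) \<le> M" if "cmod w \<le> 1/2" for k w
    unfolding M_def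
  proof (rule Schottky[OF hol, where t="1/2"])
    fix w :: complex assume w: "w \<in> cball 0 1"
    have "(quad c ^^ (k * n)) (p 0 + of_real r * w) \<noteq> v1" "(quad c ^^ (k * n)) (p 0 + of_real r * w) \<noteq> - v1"
      using N1[OF inb[OF w]] by auto
    then show "\<not> (h k w = 0 \<or> h k w = 1)"
      using v1(3) by (auto simp: h_def field_simps eq_neg_iff_add_eq_0)
  qed (use that h0 in auto)
  have bound: "cmod \<rho> ^ k * r / (2 * cmod v1) \<le> 2 * M" for k
  proof -
    have "cmod ((deriv ^^ 1) (h k) 0) \<le> fact 1 * M / (1/2) ^ 1"
      by (rule Cauchy_inequality) (use hol hM in \<open>auto intro!: holomorphic_on_imp_continuous_on\<close>)
    moreover have "deriv (h k) 0 = \<rho> ^ k * of_real r / (- 2 * v1)"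
    proof -
      have "(\<Prod>i<k * n. 2 * (quad c ^^ i) (p 0)) = (\<Prod>i<k * n. 2 * p i)"
        using funpow_quad[of p c _ 0, OF cc(2)] by simp
      also have "\<dots> = \<rho> ^ k" unfolding \<rho>_def by (rule prod_period_mult) (simp add: cc)
      finally show ?thesis using DERIV_imp_deriv[OF hd[of k 0]] by simp
    qed
    ultimately show ?thesis using r by (simp add: norm_mult norm_divide norm_power)
  qed
  obtain k where "cmod \<rho> ^ k > 2 * M * (2 * cmod v1) / r" using real_arch_pow[OF \<rho>] by blast
  then have "cmod \<rho> ^ k * r / (2 * cmod v1) > 2 * M" using r v1(3) by (simp add: field_simps)
  with bound[of k] show False by simp
qed

text \<open>Every backward orbit of the fixed point \<open>2\<close> of \<open>z\<^sup>2 - 2\<close> off the cycle passes through the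
  critical point; this is the only such cycle.\<close>

lemma noncritical_preimage:
  assumes c: "cyc c n z" and w: "weight z \<beta> B" and ex: "\<not> (c = -2 \<and> range z = {2})"
  obtains v a where "(quad c ^^ a) v \<in> range z" "\<And>i. i < a \<Longrightarrow> (quad c ^^ i) v \<noteq> 0"
    "\<And>i. (quad c ^^ i) 0 \<noteq> v"
proof (cases "\<exists>i. (quad c ^^ i) 0 \<in> range z")
  case False
  \<comment> \<open>If the critical orbit misses the cycle, a point of the cycle itself will
    do.\<close>
  show ?thesis by (rule that[of 0 "z 0"]) (use False in auto)
next
  case True
  note cc = cycD[OF c] and W = weightD[OF w]
  define O' where "O' = range z"
  have O0: "0 \<notin> O'" using W(5) by (auto simp: O'_def)
  have fO: "y\<^sup>2 + c \<in> O'" if "y \<in> O'" for y using that cc(2) by (auto simp: O'_def) (metis rangeI)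
  have pre: "\<exists>w\<in>O'. w\<^sup>2 + c = y" if yO: "y \<in> O'" for y
  proof -
    obtain j where "y = z j" using yO unfolding O'_def by blast
    then have "y = (z (j + (n - 1)))\<^sup>2 + c" using cc(1) cc(2)[of "j + (n - 1)"] cc(3)[of j] by simp
    then show ?thesis by (auto simp: O'_def)
  qed
  have inj: "a = b" if ab: "a \<in> O'" "b \<in> O'" "a\<^sup>2 = b\<^sup>2" for a b
  proof -
    obtain i j where ij: "a = z i" "b = z j" using ab(1,2) unfolding O'_def by blast
    have s: "z (Suc i) = z (Suc j)" using ab(3) ij cc(2) by simp
    have "z (Suc i + (n - 1)) = z (Suc j + (n - 1))"
      using funpow_quad[of z c "n-1" "Suc i", OF cc(2)] funpow_quad[of z c "n-1" "Suc j", OF cc(2)] s by simp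
    then show ?thesis using cc(1) cc(3)[of i] cc(3)[of j] ij by simp
  qed
  define x where "x i = (quad c ^^ i) 0" for i
  have x0: "x 0 = 0" and xs: "x (Suc i) = (x i)\<^sup>2 + c" for i by (auto simp: x_def quad_def)
  define k where "k = (LEAST i. x i \<in> O')"
  have k: "x k \<in> O'" using LeastI_ex[of "\<lambda>i. x i \<in> O'"] True by (auto simp: k_def x_def O'_def)
  have kl: "x i \<notin> O'" if "i < k" for i using not_less_Least[of i "\<lambda>i. x i \<in> O'"] that by (auto simp: k_def)
  have after: "x (k + i) \<in> O'" for i by (induction i) (use k fO xs in auto)
  have kpos: "k > 0" using k O0 x0 by (cases k) auto
  show ?thesis
  proof (cases "\<exists>z'\<in>O'. z' \<noteq> x k")
    \<comment> \<open>Another point z' of the cycle is entered by the critical orbit only from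
      within the cycle, since the first landing is at \<open>x k\<close>. So the preimage of z' off
      the cycle is not on the critical orbit.\<close>
    case True
    then obtain z' where z': "z' \<in> O'" "z' \<noteq> x k" by blast
    obtain w' where w': "w' \<in> O'" "w'\<^sup>2 + c = z'" using pre[OF z'(1)] by blast
    have w0: "w' \<noteq> 0" using w' O0 by auto
    have nO: "- w' \<notin> O'" using inj[of "- w'" w'] w' w0 by auto
    show ?thesis
    proof (rule that[of 1 "- w'"])
      show "(quad c ^^ 1) (- w') \<in> range z" using w' z' by (simp add: quad_def O'_def)
      show "(quad c ^^ i) (- w') \<noteq> 0" if "i < 1" for i using that w0 by simp
      show "(quad c ^^ i) 0 \<noteq> - w'" for i
      proof
        assume "(quad c ^^ i) 0 = - w'"
        then have xi: "x i = - w'" by (simp add: x_def)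
        then have "x (Suc i) = z'" using xs[of i] w' by simp
        have "i < k" using xi nO after[of "i - k"] by (cases "i < k") auto
        moreover have "\<not> Suc i < k" using kl[of "Suc i"] \<open>x (Suc i) = z'\<close> z' by auto
        ultimately have "Suc i = k" by simp
        with \<open>x (Suc i) = z'\<close> z' show False by simp
      qed
    qed
  next
    case False
    \<comment> \<open>The cycle is a fixed point \<open>w\<close>, and its other preimage
      \<open>- w\<close> lies on the critical orbit. One has to go back one step further, to the
      preimage \<open>- u\<close> of \<open>- w\<close> that the critical orbit does not
      use.\<close>
    define w where "w = x k"
    have Ow: "O' = {w}" using False k unfolding w_def by blast
    have w0: "w \<noteq> 0" using O0 Ow by auto
    have fw: "w\<^sup>2 + c = w" using fO[of w] Ow by auto
    obtain k' where k': "k = Suc k'" using kpos by (cases k) auto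
    have "(x k')\<^sup>2 + c = w" using xs[of k'] k' by (simp add: w_def)
    with fw have "(x k')\<^sup>2 + c = w\<^sup>2 + c" by (simp only:)
    then have "(x k')\<^sup>2 = w\<^sup>2" by (simp only: add_right_cancel)
    moreover have "x k' \<noteq> w" using kl[of k'] k' Ow by auto
    ultimately have xk': "x k' = - w" by (simp add: power2_eq_iff)
    then obtain k2 where k2: "k' = Suc k2" using x0 w0 by (cases k') auto
    define u where "u = x k2"
    have fu: "u\<^sup>2 + c = - w" using xs[of k2] xk' k2 by (simp add: u_def)
    show ?thesis
    proof (cases "k2 = 0")
      case True
      \<comment> \<open>Here \<open>u\<close> and \<open>- u\<close> are both the critical point:
        exactly the exceptional case.\<close>
      then have "c = - w" using fu x0 by (simp add: u_def)
      with fw have "w * (w - 2) = 0" by (simp add: algebra_simps power2_eq_square)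
      with w0 have "w = 2" by simp
      with \<open>c = - w\<close> Ow ex show ?thesis by (simp add: O'_def)
    next
      case False
      have u0: "u \<noteq> 0"
      proof
        assume "u = 0"
        then have "x k2 = x 0" by (simp add: u_def x0)
        have per: "x (j + k2) = x j" for j by (induction j) (auto simp: xs \<open>x k2 = x 0\<close>)
        \<comment> \<open>A periodic critical point would make the first landing time too late by
          \<open>k2\<close>.\<close>
        have "x (k' - k2) = x k'" using per[of "k' - k2"] k2 by simp
        have "x (k - k2) = x k" using per[of "k - k2"] k2 k' by simp
        then show False using kl[of "k - k2"] k False k2 k' by simp
      qed
      show ?thesis
      proof (rule that[of 2 "- u"])
        have q2: "(quad c ^^ 2) (- u) = w" using fu fw by (simp add: quad_def numeral_2_eq_2)
        show "(quad c ^^ 2) (- u) \<in> range z" using q2 Ow by (simp add: O'_def)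
        show "(quad c ^^ i) (- u) \<noteq> 0" if "i < 2" for i
          using that u0 fu w0 by (auto simp: less_2_cases_iff quad_def)
        show "(quad c ^^ i) 0 \<noteq> - u" for i
        proof
          assume "(quad c ^^ i) 0 = - u"
          then have xi: "x i = - u" by (simp add: x_def)
          have x1: "x (Suc i) = - w" using xs[of i] xi fu by simp
          have x2: "x (Suc (Suc i)) = w" using xs[of "Suc i"] x1 fw by simp
          have "- w \<notin> O'" using Ow w0 by auto
          then have "Suc i < k" using x1 after[of "Suc i - k"] by (cases "Suc i < k") auto
          moreover have "\<not> Suc (Suc i) < k" using kl[of "Suc (Suc i)"] x2 Ow by auto
          ultimately have "i = k2" using k' k2 by simp
          then show False using xi u0 by (simp add: u_def)
        qed
      qed
    qed
  qed
qed

text \<open>The orbit \<open>q\<close> is indexed by backward time, the cycle by forward time;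
  \<open>n - 1\<close> steps forward along the cycle are one step back. \<open>L\<close> is a
  phase.\<close>

definition asymptotic_past :: "complex \<Rightarrow> nat \<Rightarrow> (nat \<Rightarrow> complex) \<Rightarrow> complex \<Rightarrow> (nat \<Rightarrow> complex) \<Rightarrow> nat \<Rightarrow> bool" where
  "asymptotic_past c n p y q L \<longleftrightarrow> q 0 = y \<and> (\<forall>l. q l = (q (Suc l))\<^sup>2 + c) \<and> (\<forall>l. q (Suc l) \<noteq> 0) \<and>
    (\<lambda>l. q l - p (L + (n - 1) * l)) \<longlonglongrightarrow> 0"

text \<open>Start at \<open>y\<close> close to the cycle, run through \<open>v\<close> to
  \<open>P\<close>, and continue the past of \<open>y\<close> toward the cycle. Between
  \<open>y\<close> and \<open>v\<close> the critical point cannot occur, for it would bring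
  \<open>v\<close> into the critical orbit; between \<open>v\<close> and \<open>P\<close> it is
  excluded by assumption, and before \<open>y\<close> by closeness to the cycle.\<close>

lemma heteroclinic:
  assumes c: "cyc c n p" and w: "weight p \<beta> B" and per: "\<And>j. \<beta> (j + n) = \<beta> j"
    and v: "(quad c ^^ a) v = P" "\<And>i. i < a \<Longrightarrow> (quad c ^^ i) v \<noteq> 0" "\<And>i. (quad c ^^ i) 0 \<noteq> v"
  shows "\<exists>q L. asymptotic_past c n p P q L"
proof -
  note cc = cycD[OF c] and W = weightD[OF w]
  have idx: "Suc ((n - 1) * Suc l) = (n - 1) * l + n" for l using cc(1) by (cases n) auto
  have p1: "p ((n - 1) * l) = (p ((n - 1) * Suc l))\<^sup>2 + c" for l
    using cc(2)[of "(n - 1) * Suc l"] cc(3)[of "(n - 1) * l"] by (simp only: idx)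
  have b1: "1 + \<beta> ((n - 1) * l) \<le> 2 * cmod (p ((n - 1) * Suc l)) * \<beta> ((n - 1) * Suc l)" for l
    using W(3)[of "(n - 1) * Suc l"] per[of "(n - 1) * l"] by (simp only: idx)
  have "v \<noteq> c" using v(3)[of 1] by (auto simp: quad_def)
  moreover have "\<beta> 0 / (8 * B ^ 3) > 0" using W(1)[of 0] W(4) by simp
  ultimately obtain y m where y: "y \<in> ball (p 0) (\<beta> 0 / (8 * B ^ 3))" "(quad c ^^ m) y = v"
    using repelling_reaches[OF c w per, of v] by blast
  obtain q' where q': "q' 0 = y" "\<And>l. q' l = (q' (Suc l))\<^sup>2 + c" "\<And>l. q' (Suc l) \<noteq> 0"
    "(\<lambda>l. q' l - p ((n - 1) * l)) \<longlonglongrightarrow> 0"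
  proof -
    have "cmod (y - p ((n - 1) * 0)) \<le> \<beta> ((n - 1) * 0) / (8 * B ^ 3)"
      using y by (simp add: dist_norm norm_minus_commute)
    from backward_orbit[of "\<lambda>l. \<beta> ((n - 1) * l)" B "\<lambda>l. p ((n - 1) * l)", OF W(1) W(2) b1 p1 this] that
    show ?thesis by blast
  qed
  define L where "L = m + a"
  define q where "q l = (if l \<le> L then (quad c ^^ (L - l)) y else q' (l - L))" for l
  have split: "(quad c ^^ (i + j)) y = (quad c ^^ i) ((quad c ^^ j) y)" for i j by (simp add: funpow_add)
  have nz: "(quad c ^^ i) y \<noteq> 0" if "i < L" for i
  proof (cases "i < m")
    case True
    then have "(quad c ^^ (m - i)) ((quad c ^^ i) y) = v" using split[of "m - i" i] y by simp
    then show ?thesis using v(3)[of "m - i"] by auto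
  next
    case False
    then have "(quad c ^^ i) y = (quad c ^^ (i - m)) v" using split[of "i - m" m] y by simp
    then show ?thesis using v(2)[of "i - m"] that False by (simp add: L_def)
  qed
  have qL: "q (l + L) = q' l" for l using q'(1) by (cases l) (auto simp: q_def)
  have "asymptotic_past c n p P q L"
    unfolding asymptotic_past_def
  proof (intro conjI allI)
    show "q 0 = P" using split[of a m] y v(1) by (simp add: q_def L_def add.commute)
    show "q l = (q (Suc l))\<^sup>2 + c" for l
    proof (cases "Suc l \<le> L")
      case True
      then have "L - l = Suc (L - Suc l)" by simp
      then have "(quad c ^^ (L - l)) y = quad c ((quad c ^^ (L - Suc l)) y)" by (simp only: funpow.simps o_apply)
      then show ?thesis using True unfolding q_def by (simp add: quad_def)
    next
      case False
      then obtain i where i: "l = i + L" by (metis le_add_diff_inverse2 not_less_eq_eq)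
      show ?thesis unfolding i add_Suc[symmetric] qL by (rule q'(2))
    qed
    show "q (Suc l) \<noteq> 0" for l
    proof (cases "Suc l \<le> L")
      case True
      then show ?thesis using nz[of "L - Suc l"] by (simp add: q_def)
    next
      case False
      then obtain i where i: "l = i + L" by (metis le_add_diff_inverse2 not_less_eq_eq)
      show ?thesis unfolding i add_Suc[symmetric] qL by (rule q'(3))
    qed
    have "p (L + (n - 1) * (l + L)) = p ((n - 1) * l)" for l
    proof -
      have "L + (n - 1) * (l + L) = (n - 1) * l + L * n" using cc(1) by (cases n) (auto simp: algebra_simps)
      then show ?thesis using periodic_mult[of p n "(n - 1) * l" L, OF cc(3)] by (simp only:)
    qed
    then have "(\<lambda>l. q (l + L) - p (L + (n - 1) * (l + L))) \<longlonglongrightarrow> 0"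
      using q'(4) by (simp only: qL)
    then show "(\<lambda>l. q l - p (L + (n - 1) * l)) \<longlonglongrightarrow> 0" 
      by (rule LIMSEQ_offset[where k=L and f="\<lambda>l. q l - p (L + (n - 1) * l)"])
  qed
  then show ?thesis by blast
qed

section \<open>Spliced orbits\<close>

text \<open>Two backward orbits, of lengths \<open>len True\<close> and \<open>len False\<close>, are traversed alternately in
  forward time: position \<open>(p, i)\<close> is \<open>i\<close> steps before the end of the piece \<open>p\<close>.\<close>

definition idx :: "(bool \<Rightarrow> nat) \<Rightarrow> nat \<Rightarrow> bool \<times> nat" where
  "idx len j = (let i = j mod (len True + len False) in
     if i < len True then (True, len True - i) else (False, len True + len False - i))"

text \<open>Position 0 of a piece is never visited: after position 1 the path jumps to the start of
  the other piece, which lies near that endpoint.\<close>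

lemma idx_cases:
  assumes "\<And>p. len p \<ge> (1::nat)"
  obtains (inner) p i where "i \<ge> 1" "idx len j = (p, Suc i)" "idx len (Suc j) = (p, i)"
  | (jump) p where "idx len j = (p, 1)" "idx len (Suc j) = (\<not> p, len (\<not> p))"
proof -
  define n where "n = len True + len False"
  have pos: "len True \<ge> 1" "len False \<ge> 1" using assms by auto
  define i where "i = j mod n"
  have i: "i < n" using pos by (simp add: i_def n_def)
  have si: "Suc j mod n = (if Suc i = n then 0 else Suc i)" by (simp add: mod_Suc i_def)
  have ij: "idx len j = (if i < len True then (True, len True - i) else (False, n - i))"
    by (simp add: idx_def Let_def n_def[symmetric] i_def)
  have isj: "idx len (Suc j) = (let i = (if Suc i = n then 0 else Suc i) in
     if i < len True then (True, len True - i) else (False, n - i))"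
    unfolding idx_def n_def[symmetric] si ..
  consider "Suc i < len True" | "Suc i = len True" | "i \<ge> len True" "Suc i < n" | "Suc i = n"
    using i by linarith
  then show thesis
  proof cases
    case 1
    then show ?thesis using inner[of "len True - Suc i" True] pos i
      by (simp add: ij isj n_def Suc_diff_Suc)
  next
    case 2
    then show ?thesis using jump[of True] pos i by (simp add: ij isj n_def)
  next
    case 3
    then show ?thesis using inner[of "n - Suc i" False] pos i
      by (simp add: ij isj Suc_diff_Suc)
  next
    case 4
    then show ?thesis using jump[of False] pos i by (auto simp: ij isj n_def)
  qed
qed

lemma idx_periodic: "idx len (j + (len True + len False)) = idx len j"
  by (simp add: idx_def)

lemma idx_sum:
  fixes f :: "bool \<Rightarrow> nat \<Rightarrow> 'a::comm_monoid_add"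
  shows "(\<Sum>j<len True + len False. f (fst (idx len j)) (snd (idx len j))) =
    (\<Sum>i<len True. f True (Suc i)) + (\<Sum>i<len False. f False (Suc i))"
proof -
  have "(\<Sum>j<len True. f (fst (idx len j)) (snd (idx len j))) = (\<Sum>j<len True. f True (Suc (len True - Suc j)))"
    by (intro sum.cong refl) (auto simp: idx_def Let_def Suc_diff_Suc)
  moreover have "(\<Sum>j<len False. f (fst (idx len (len True + j))) (snd (idx len (len True + j)))) =
      (\<Sum>j<len False. f False (Suc (len False - Suc j)))"
    by (intro sum.cong refl) (auto simp: idx_def Let_def Suc_diff_Suc)
  ultimately show ?thesis
    unfolding sum_lessThan_add
    using sum.nat_diff_reindex[of "\<lambda>i. f True (Suc i)" "len True"] sum.nat_diff_reindex[of "\<lambda>i. f False (Suc i)" "len False"]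
    by simp
qed

text \<open>The pseudo-orbit inherits the weight \<open>b\<close> and the approximate velocity
  \<open>W\<close> from its pieces. The hypotheses on \<open>jump\<close> say that the weight
  inequality and the orbit equation survive, the latter up to an error, at the two jumps. In the
  final bound the first term comes from the jumps, the second from the shadowing distance.\<close>

lemma spliced_orbit:
  fixes q W :: "bool \<Rightarrow> nat \<Rightarrow> complex" and b :: "bool \<Rightarrow> nat \<Rightarrow> real"
  assumes q: "\<And>p l. q p l = (q p (Suc l))\<^sup>2 + c"
    and b: "\<And>p l. 2 * cmod (q p (Suc l)) * b p (Suc l) = 1 + b p l" "\<And>p l. 0 < b p l" "\<And>p l. b p l \<le> B"
    and W: "\<And>p l. 2 * q p (Suc l) * W p (Suc l) = W p l - 1" "\<And>p l. cmod (W p l) \<le> B"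
    and s: "0 < s" "4 * B\<^sup>2 * s \<le> 1"
    and len: "\<And>p. len p \<ge> 1"
    and jump: "\<And>p. b (\<not> p) (len (\<not> p)) \<le> b p 0" "\<And>p. cmod (q p 0 - q (\<not> p) (len (\<not> p))) \<le> s / 4"
  defines "n \<equiv> len True + len False"
  shows "\<exists>x. cyc c n x \<and> range x \<in> repelling_orbits c \<and>
    (\<forall>j. cmod (x j - q (fst (idx len j)) (snd (idx len j))) \<le> s * B) \<and>
    cmod (nu c (range x) c - ((\<Sum>i<len True. W True (Suc i) / q True (Suc i)) + (\<Sum>i<len False. W False (Suc i) / q False (Suc i))) / of_nat n)
      \<le> 32 * B ^ 3 * (1 + 2 * B) / n + 32 * B ^ 4 * (1 + B) * s"
proof -
  have B: "B > 0" using b(2,3)[of True 0] by linarith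
  have n: "n > 0" using len[of True] by (simp add: n_def)
  define z where "z j = q (fst (idx len j)) (snd (idx len j))" for j
  define \<beta> where "\<beta> j = b (fst (idx len j)) (snd (idx len j))" for j
  define u where "u j = W (fst (idx len j)) (snd (idx len j))" for j
  have per: "z (j + n) = z j" "\<beta> (j + n) = \<beta> j" "u (j + n) = u j" for j
    by (simp_all add: z_def \<beta>_def u_def n_def idx_periodic)
  have w: "weight z \<beta> B"
    unfolding weight_def
  proof (intro allI conjI)
    fix j
    show "0 < \<beta> j" "\<beta> j \<le> B" using b by (auto simp: \<beta>_def)
    show "1 + \<beta> (Suc j) \<le> 2 * cmod (z j) * \<beta> j"
    proof (rule idx_cases[where len=len and j=j, OF len])
      fix p i assume "idx len j = (p, Suc i)" "idx len (Suc j) = (p, i)"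
      then show ?thesis using b(1)[of p i] by (simp add: z_def \<beta>_def)
    next
      fix p assume "idx len j = (p, 1)" "idx len (Suc j) = (\<not> p, len (\<not> p))"
      then show ?thesis using b(1)[of p 0] jump(1)[of p] by (simp add: z_def \<beta>_def)
    qed
  qed
  note ww = weightD[OF w]
  have e: "cmod ((z j)\<^sup>2 + c - z (Suc j)) \<le> s / 4" for j
  proof (rule idx_cases[where len=len and j=j, OF len])
    fix p i assume "idx len j = (p, Suc i)" "idx len (Suc j) = (p, i)"
    then show ?thesis using q[of p i] s by (simp add: z_def)
  next
    fix p assume "idx len j = (p, 1)" "idx len (Suc j) = (\<not> p, len (\<not> p))"
    then show ?thesis using q[of p 0] jump(2)[of p] by (simp add: z_def)
  qed
  obtain i0 where Z: "\<And>j. cmod (z j) \<le> cmod (z i0)"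
    using periodic_bounded_by_max[of n "\<lambda>j. cmod (z j)", OF n] per(1) by metis
  have e': "cmod ((z j)\<^sup>2 + y - z (Suc j)) \<le> s / 2" if "y \<in> ball c (s / 4)" for y j
  proof -
    have "cmod ((z j)\<^sup>2 + y - z (Suc j)) \<le> cmod ((z j)\<^sup>2 + c - z (Suc j)) + cmod (y - c)"
    proof -
      have eq: "(z j)\<^sup>2 + y - z (Suc j) = ((z j)\<^sup>2 + c - z (Suc j)) + (y - c)" by simp
      show ?thesis unfolding eq by (rule norm_triangle_ineq)
    qed
    then show ?thesis using e[of j] that by (simp add: dist_norm norm_minus_commute)
  qed
  obtain X where X: "branch (ball c (s / 4)) n X"
    "\<And>j y. y \<in> ball c (s / 4) \<Longrightarrow> cmod (X j y - z j) \<le> s * B"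
    using shadowing[OF w Z s n per(1) open_ball e'] by blast
  define x where "x j = X j c" for j
  have cin: "c \<in> ball c (s / 4)" using s by simp
  have cx: "cyc c n x" unfolding x_def using branchD(2)[OF X(1) cin] .
  have near: "cmod (x j - z j) \<le> s * B" for j using X(2)[OF cin] by (simp add: x_def)
  \<comment> \<open>Moving from \<open>z\<close> to the nearby \<open>x\<close> loses a part of the
    unit in the weight inequality; doubling the weight restores it.\<close>
  have wx: "weight x (\<lambda>j. 2 * \<beta> j) (2 * B)"
    unfolding weight_def
  proof (intro allI conjI)
    fix j
    show "0 < 2 * \<beta> j" "2 * \<beta> j \<le> 2 * B" using ww(1,2) by auto
    have "cmod (z j) \<le> cmod (x j) + s * B" using near[of j] norm_triangle_sub[of "z j" "x j"] by (simp add: norm_minus_commute)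
    then have "2 * cmod (z j) * \<beta> j \<le> 2 * (cmod (x j) + s * B) * \<beta> j" using ww(1)[of j] by (intro mult_right_mono) auto
    moreover have "s * B * \<beta> j \<le> 1/4"
    proof -
      have "s * B * \<beta> j \<le> s * B * B" using s B ww(2)[of j] by (intro mult_left_mono) auto
      then show ?thesis using s by (simp add: power2_eq_square algebra_simps)
    qed
    ultimately show "1 + 2 * \<beta> (Suc j) \<le> 2 * cmod (x j) * (2 * \<beta> j)"
      using ww(3)[of j] by (simp add: algebra_simps)
  qed
  have perx: "2 * \<beta> (j + n) = 2 * \<beta> j" for j using per by simp
  obtain v where v: "\<And>j. v (Suc j) = 2 * x j * v j + 1" "\<And>j. v (j + n) = v j"
    using variation_ex[OF cx wx] by blast
  have nu: "nu c (range x) c = (\<Sum>j<n. v j / x j) / of_nat n"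
    by (rule nu_formula(2)[OF cx wx perx v])
  define R where "R j = cmod (u (Suc j) - 2 * z j * u j - 1)" for j
  \<comment> \<open>The residual vanishes inside the pieces, and at each of the two jumps it is at
    most \<open>2 * B\<close>.\<close>
  have Rb: "R j \<le> (if snd (idx len j) = Suc 0 then 2 * B else 0)" for j
  proof (rule idx_cases[where len=len and j=j, OF len])
    fix p i assume "i \<ge> 1" "idx len j = (p, Suc i)" "idx len (Suc j) = (p, i)"
    then show ?thesis using W(1)[of p i] by (simp add: z_def u_def R_def)
  next
    fix p assume i: "idx len j = (p, 1)" "idx len (Suc j) = (\<not> p, len (\<not> p))"
    have "R j = cmod (W (\<not> p) (len (\<not> p)) - W p 0)" using W(1)[of p 0] i by (simp add: z_def u_def R_def)
    also have "\<dots> \<le> B + B" by (intro order_trans[OF norm_triangle_ineq4] add_mono W)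
    finally show ?thesis using i by simp
  qed
  have "(\<Sum>j<n. R j) \<le> (\<Sum>j<n. if snd (idx len j) = Suc 0 then 2 * B else 0)" by (intro sum_mono Rb)
  also have "\<dots> = (\<Sum>i<len True. if Suc i = Suc 0 then 2 * B else 0) + (\<Sum>i<len False. if Suc i = Suc 0 then 2 * B else 0)"
    unfolding n_def by (rule idx_sum[of "\<lambda>p i. if i = Suc 0 then 2 * B else 0"])
  also have "\<dots> = 4 * B" using len[of True] len[of False] by simp
  finally have SR: "(\<Sum>j<n. R j) \<le> 4 * B" .
  have zB: "1 \<le> 2 * (2 * B) * cmod (z j)" for j using ww(6)[of j] B by simp
  have ub: "cmod (u j) \<le> B" for j using W(2) by (simp add: u_def)
  have "cmod ((\<Sum>j<n. v j / x j) - (\<Sum>j<n. u j / z j)) \<le>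
    2 * (2 * B)\<^sup>2 * (1 + 2 * B) * ((\<Sum>j<n. R j) + 2 * real n * (s * B) * B) + 4 * (2 * B)\<^sup>2 * B * (s * B) * n"
    unfolding R_def
    by (rule variation_compare[where x=x and \<gamma>="\<lambda>j. 2 * \<beta> j" and v=v and u=u and z=z, OF n wx perx v(1) v(2) per(3) near ub zB])
  also have "\<dots> \<le> 2 * (2 * B)\<^sup>2 * (1 + 2 * B) * (4 * B + 2 * real n * (s * B) * B) + 4 * (2 * B)\<^sup>2 * B * (s * B) * n"
    using SR B by (intro add_right_mono mult_left_mono) auto
  also have "\<dots> = 32 * B ^ 3 * (1 + 2 * B) + 32 * B ^ 4 * (1 + B) * s * n"
    by (simp add: power2_eq_square power3_eq_cube power4_eq_xxxx algebra_simps)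
  finally have main: "cmod ((\<Sum>j<n. v j / x j) - (\<Sum>j<n. u j / z j)) \<le> 32 * B ^ 3 * (1 + 2 * B) + 32 * B ^ 4 * (1 + B) * s * n" .
  have us: "(\<Sum>j<n. u j / z j) = (\<Sum>i<len True. W True (Suc i) / q True (Suc i)) + (\<Sum>i<len False. W False (Suc i) / q False (Suc i))"
    unfolding u_def z_def n_def by (rule idx_sum[of "\<lambda>p i. W p i / q p i"])
  have "cmod (nu c (range x) c - (\<Sum>j<n. u j / z j) / of_nat n) = cmod ((\<Sum>j<n. v j / x j) - (\<Sum>j<n. u j / z j)) / n"
    unfolding nu diff_divide_distrib[symmetric] by (simp add: norm_divide)
  also have "\<dots> \<le> (32 * B ^ 3 * (1 + 2 * B) + 32 * B ^ 4 * (1 + B) * s * n) / n"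
    using main by (intro divide_right_mono) auto
  also have "\<dots> = 32 * B ^ 3 * (1 + 2 * B) / n + 32 * B ^ 4 * (1 + B) * s"
    using n by (simp add: add_divide_distrib)
  finally show ?thesis
    using cx near[unfolded z_def] weight_repelling[OF cx wx perx] unfolding us by blast
qed

text \<open>The data that one piece contributes to a splice, indexed backward from its end. The
  weight starts from \<open>K\<close> at the end of the piece and has sunk below \<open>K\<close>
  again far back, so that any sufficiently long piece may follow the end of another.
  \<open>W\<close> solves the velocity equation, and its mean along long pieces tends to
  \<open>\<nu>\<close>.\<close>

definition transit :: "(nat \<Rightarrow> complex) \<Rightarrow> real \<Rightarrow> complex \<Rightarrow> (nat \<Rightarrow> real) \<Rightarrow> (nat \<Rightarrow> complex) \<Rightarrow> real \<Rightarrow> bool" where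
  "transit q K \<nu> b W C \<longleftrightarrow> b 0 = K \<and> (\<forall>l. 2 * cmod (q (Suc l)) * b (Suc l) = 1 + b l) \<and> (\<forall>l. 0 < b l) \<and> (\<forall>l. b l \<le> C) \<and>
    (\<forall>l. 2 * q (Suc l) * W (Suc l) = W l - 1) \<and> (\<forall>l. cmod (W l) \<le> C) \<and> (\<forall>\<^sub>F l in sequentially. b l \<le> K) \<and>
    (\<lambda>l. (\<Sum>i<l. W (Suc i) / q (Suc i)) / of_nat l) \<longlonglongrightarrow> \<nu>"

text \<open>Near the cycle, twice the weight of the cycle is a weight along \<open>q\<close> as
  well. The weight computed backward from \<open>K\<close> relaxes toward such values, so far back
  it is at most \<open>3 * B\<close>, whence the condition on \<open>K\<close>.\<close>

lemma transit_ex: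
  fixes z q v :: "nat \<Rightarrow> complex"
  assumes c: "cyc c n z" and w: "weight z \<beta> B" and per: "\<And>j. \<beta> (j + n) = \<beta> j"
    and v: "\<And>j. v (Suc j) = 2 * z j * v j + 1" "\<And>j. v (j + n) = v j"
    and q: "\<And>l. q (Suc l) \<noteq> 0" "(\<lambda>l. q l - z (L + (n - 1) * l)) \<longlonglongrightarrow> 0"
    and K: "3 * B \<le> K"
  shows "\<exists>b W C. transit q K ((\<Sum>j<n. v j / z j) / of_nat n) b W C"
proof -
  note cc = cycD[OF c] and ww = weightD[OF w]
  have B: "B > 0" by (rule ww)
  define p where "p l = z (L + (n - 1) * l)" for l
  define \<gamma> where "\<gamma> l = \<beta> (L + (n - 1) * l)" for l
  define y where "y l = v (L + (n - 1) * l)" for l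
  have ix: "Suc (L + (n - 1) * Suc l) = L + (n - 1) * l + n" for l using cc(1) by (cases n) auto
  have \<gamma>: "0 < \<gamma> l" "\<gamma> l \<le> B" "1 + \<gamma> l \<le> cmod (2 * p (Suc l)) * \<gamma> (Suc l)" for l
  proof -
    show "0 < \<gamma> l" "\<gamma> l \<le> B" using ww by (auto simp: \<gamma>_def)
    have "1 + \<beta> (L + (n - 1) * l + n) \<le> 2 * cmod (p (Suc l)) * \<gamma> (Suc l)"
      using ww(3)[of "L + (n - 1) * Suc l"] unfolding ix p_def \<gamma>_def .
    then show "1 + \<gamma> l \<le> cmod (2 * p (Suc l)) * \<gamma> (Suc l)" unfolding per \<gamma>_def by (simp add: norm_mult)
  qed
  have y1: "2 * p (Suc l) * y (Suc l) = y l + (-1)" for l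
  proof -
    have "v (L + (n - 1) * l + n) = 2 * p (Suc l) * y (Suc l) + 1"
      using v(1)[of "L + (n - 1) * Suc l"] unfolding ix p_def y_def .
    then show ?thesis unfolding v(2) y_def by simp
  qed
  have yb: "cmod (y l) \<le> B" for l
    unfolding y_def using variation_bound[OF cc(1) w per v(1) v(2)] ww(2) order_trans by blast
  have qp: "(\<lambda>l. q l - p l) \<longlonglongrightarrow> 0" using q(2) by (simp only: p_def)
  have st: "(\<lambda>l. 2 * q (Suc l) - 2 * p (Suc l)) \<longlonglongrightarrow> 0"
    using tendsto_mult_right_zero[OF LIMSEQ_Suc[OF qp], of 2] by (simp add: algebra_simps)
  define b where "b = rec_nat K (\<lambda>l u. (1 + u) / (2 * cmod (q (Suc l))))"
  \<comment> \<open>The initial value 0 is arbitrary: all backward solutions approach the velocity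
    of the cycle.\<close>
  define W where "W = rec_nat (0::complex) (\<lambda>l u. (u - 1) / (2 * q (Suc l)))"
  have b0: "b 0 = K" and bs: "2 * cmod (q (Suc l)) * b (Suc l) = 1 + b l" for l using q(1) by (auto simp: b_def)
  have W0: "W 0 = 0" and Ws: "2 * q (Suc l) * W (Suc l) = W l - 1" for l using q(1) by (auto simp: W_def)
  have bpos: "0 < b l" for l
  proof (induction l)
    case 0
    show ?case using b0 K B by simp
  next
    case (Suc l)
    then have "0 < 2 * cmod (q (Suc l)) * b (Suc l)" unfolding bs by simp
    then show ?case using q(1)[of l] by (simp add: zero_less_mult_iff)
  qed
  have Wb: "cmod (W l) \<le> b l" for l
  proof (induction l)
    case 0
    show ?case using bpos[of 0] by (simp add: W0)
  next
    case (Suc l)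
    have "2 * cmod (q (Suc l)) * cmod (W (Suc l)) = cmod (W l - 1)" unfolding Ws[of l, symmetric] by (simp add: norm_mult)
    also have "\<dots> \<le> 1 + b l" using norm_triangle_ineq4[of "W l" 1] Suc by simp
    also have "\<dots> = 2 * cmod (q (Suc l)) * b (Suc l)" by (simp add: bs)
    finally show ?case using q(1)[of l] by simp
  qed
  have ev3: "\<forall>\<^sub>F l in sequentially. b l \<le> 3 * B"
  proof -
    \<comment> \<open>The excess over twice the weight \<open>\<gamma>\<close>. Since only
      \<open>1/2 + \<gamma> l \<le> 2 |q| \<gamma> (Suc l)\<close> is left along \<open>q\<close>,
      the recursion for \<open>b\<close> pushes the ratio \<open>b / \<gamma>\<close> toward at most
      2.\<close>
    define A where "A l = max (b l / \<gamma> l - 2) 0" for l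
    have st': "(\<lambda>l. cmod (2 * q (Suc l) - 2 * p (Suc l))) \<longlonglongrightarrow> 0" using st by (rule tendsto_norm_zero)
    have "\<forall>\<^sub>F l in sequentially. cmod (2 * q (Suc l) - 2 * p (Suc l)) < 1 / (2 * B)"
      using order_tendstoD(2)[OF st'] B by simp
    then have step: "\<forall>\<^sub>F l in sequentially. A (Suc l) \<le> B / (1/2 + B) * A l + 0"
    proof eventually_elim
      case (elim l)
      have "cmod (2 * p (Suc l)) \<le> cmod (2 * q (Suc l)) + 1 / (2 * B)"
        using elim norm_triangle_sub[of "2 * p (Suc l)" "2 * q (Suc l)"] by (simp add: norm_minus_commute)
      then have "cmod (2 * p (Suc l)) * \<gamma> (Suc l) \<le> (cmod (2 * q (Suc l)) + 1 / (2 * B)) * \<gamma> (Suc l)"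
        using \<gamma>(1)[of "Suc l"] by (intro mult_right_mono) auto
      also have "\<dots> \<le> cmod (2 * q (Suc l)) * \<gamma> (Suc l) + 1 / 2" using \<gamma>(2)[of "Suc l"] B by (simp add: field_simps)
      finally have 1: "1/2 + \<gamma> l \<le> cmod (2 * q (Suc l)) * \<gamma> (Suc l)" using \<gamma>(3)[of l] by linarith
      have A0: "A l \<ge> 0" and bA: "b l \<le> (A l + 2) * \<gamma> l"
        using \<gamma>(1)[of l] by (auto simp: A_def field_simps max_def)
      have "b (Suc l) / \<gamma> (Suc l) * (1/2 + \<gamma> l) \<le> b (Suc l) / \<gamma> (Suc l) * (cmod (2 * q (Suc l)) * \<gamma> (Suc l))"
        using 1 bpos[of "Suc l"] \<gamma>(1)[of "Suc l"] by (intro mult_left_mono) auto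
      also have "\<dots> = 1 + b l" using \<gamma>(1)[of "Suc l"] bs[of l] by (simp add: norm_mult mult_ac)
      also have "\<dots> \<le> A l * \<gamma> l + 2 * (1/2 + \<gamma> l)" using bA by (simp add: algebra_simps)
      also have "A l * \<gamma> l \<le> A l * (B / (1/2 + B) * (1/2 + \<gamma> l))"
        using A0 \<gamma>(1,2)[of l] B by (intro mult_left_mono) (auto simp: field_simps)
      finally have "b (Suc l) / \<gamma> (Suc l) * (1/2 + \<gamma> l) \<le> (A l * (B / (1/2 + B)) + 2) * (1/2 + \<gamma> l)"
        by (simp add: algebra_simps)
      then have "b (Suc l) / \<gamma> (Suc l) \<le> A l * (B / (1/2 + B)) + 2"
        by (rule mult_right_le_imp_le) (use \<gamma>(1)[of l] in simp)
      moreover have "A l * (B / (1/2 + B)) \<ge> 0" using A0 B by simp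
      ultimately show ?case by (simp add: A_def mult.commute)
    qed
    have "A \<longlonglongrightarrow> 0"
      by (rule contracting_tendsto_zero[OF _ _ _ _ step]) (use B in \<open>auto simp: A_def field_simps\<close>)
    then have "\<forall>\<^sub>F l in sequentially. A l < 1" using order_tendstoD(2) by fastforce
    then show ?thesis
    proof eventually_elim
      case (elim l)
      then have "b l / \<gamma> l \<le> 3" by (simp add: A_def)
      then have "b l \<le> 3 * \<gamma> l" using \<gamma>(1)[of l] by (simp add: field_simps)
      then show ?case using \<gamma>(2)[of l] by linarith
    qed
  qed
  then obtain N where N: "\<And>l. l \<ge> N \<Longrightarrow> b l \<le> 3 * B" by (auto simp: eventually_sequentially)
  define C where "C = max (3 * B) (Max (b ` {..N}))"
  have bC: "b l \<le> C" for l
  proof (cases "l \<ge> N")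
    case True
    then have "b l \<le> 3 * B" by (rule N)
    then show ?thesis by (simp add: C_def)
  next
    case False
    then have "b l \<le> Max (b ` {..N})" by (intro Max_ge) auto
    then show ?thesis by (simp add: C_def)
  qed
  have Wy: "(\<lambda>l. W l - y l) \<longlonglongrightarrow> 0"
    by (rule recursion_asymp[OF \<gamma>(1) \<gamma>(2) \<gamma>(3) y1 yb _ st]) (simp add: Ws)
  have pB: "1 / (2 * B) \<le> cmod (p l)" for l unfolding p_def using ww(6) B by (simp add: field_simps)
  have quot: "(\<lambda>l. W l / q l - y l / p l) \<longlonglongrightarrow> 0"
  proof (rule Lim_null_comparison)
    show "(\<lambda>l. 4 * B * cmod (W l - y l) + 8 * B ^ 3 * cmod (q l - p l)) \<longlonglongrightarrow> 0"
      using tendsto_add[OF tendsto_mult_right_zero[OF tendsto_norm_zero[OF Wy], of "4 * B"]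
        tendsto_mult_right_zero[OF tendsto_norm_zero[OF qp], of "8 * B ^ 3"]] by simp
    have "\<forall>\<^sub>F l in sequentially. cmod (q l - p l) < 1 / (4 * B)"
      using order_tendstoD(2)[OF tendsto_norm_zero[OF qp]] B by simp
    then show "\<forall>\<^sub>F l in sequentially. norm (W l / q l - y l / p l) \<le> 4 * B * cmod (W l - y l) + 8 * B ^ 3 * cmod (q l - p l)"
    proof eventually_elim
      case (elim l)
      have h: "1 / (2 * B) = 1 / (4 * B) + 1 / (4 * B)" by (simp add: field_simps)
      have qB: "1 / (4 * B) \<le> cmod (q l)"
      proof -
        have "cmod (p l) \<le> cmod (q l) + cmod (q l - p l)" by (metis norm_minus_commute norm_triangle_sub)
        then show ?thesis using elim pB[of l] h by linarith
      qed
      have nz: "q l \<noteq> 0" "p l \<noteq> 0" using qB pB[of l] B by auto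
      have iq: "1 / cmod (q l) \<le> 4 * B" "1 / cmod (p l) \<le> 2 * B" using qB pB[of l] nz B by (auto simp: field_simps)
      have "W l / q l - y l / p l = (W l - y l) / q l + y l * (p l - q l) / (q l * p l)"
        using nz by (simp add: field_simps)
      then have "norm (W l / q l - y l / p l) \<le> (1 / cmod (q l)) * cmod (W l - y l) + cmod (y l) * ((1 / cmod (q l)) * (1 / cmod (p l))) * cmod (q l - p l)"
        using norm_triangle_ineq[of "(W l - y l) / q l" "y l * (p l - q l) / (q l * p l)"]
        by (simp add: norm_divide norm_mult norm_minus_commute)
      also have "\<dots> \<le> (4 * B) * cmod (W l - y l) + B * ((4 * B) * (2 * B)) * cmod (q l - p l)"
        using iq yb[of l] B by (intro add_mono mult_mono) auto
      finally show ?case by (simp add: power3_eq_cube mult_ac)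
    qed
  qed
  define h where "h j = v j / z j" for j
  have hn: "h (j + n) = h j" for j by (simp add: h_def v cc)
  have lim: "(\<lambda>l. (\<Sum>i<l. W (Suc i) / q (Suc i)) / of_nat l) \<longlonglongrightarrow> (\<Sum>i<n. y (Suc i) / p (Suc i)) / of_nat n"
  proof (rule cesaro_periodic[OF cc(1)])
    show "y (Suc (j + n)) / p (Suc (j + n)) = y (Suc j) / p (Suc j)" for j
    proof -
      have "L + (n - 1) * Suc (j + n) = L + (n - 1) * Suc j + (n - 1) * n"
        using cc(1) by (cases n) (auto simp: algebra_simps)
      then have "h (L + (n - 1) * Suc (j + n)) = h (L + (n - 1) * Suc j)" 
        using periodic_mult[of h n "L + (n - 1) * Suc j" "n - 1", OF hn] by (simp only:)
      then show ?thesis by (simp only: y_def p_def h_def)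
    qed
    show "(\<lambda>j. W (Suc j) / q (Suc j) - y (Suc j) / p (Suc j)) \<longlonglongrightarrow> 0" by (rule LIMSEQ_Suc[OF quot])
  qed
  \<comment> \<open>Stepping back \<open>n\<close> times runs once through the whole cycle, in
    reverse order.\<close>
  have "(\<Sum>i<n. y (Suc i) / p (Suc i)) = (\<Sum>i<n. h (L + (n - Suc i)))"
  proof (intro sum.cong refl)
    fix i assume i: "i \<in> {..<n}"
    then obtain m where m: "n = Suc (i + m)" using less_iff_Suc_add by auto
    have "L + (n - 1) * Suc i = L + (n - Suc i) + i * n" unfolding m by (simp add: algebra_simps)
    then have "h (L + (n - 1) * Suc i) = h (L + (n - Suc i))"
      using periodic_mult[of h n "L + (n - Suc i)" i, OF hn] by (simp only:)
    then show "y (Suc i) / p (Suc i) = h (L + (n - Suc i))" by (simp only: y_def p_def h_def)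
  qed
  also have "\<dots> = (\<Sum>i<n. h (L + i))" by (rule sum.nat_diff_reindex)
  also have "\<dots> = (\<Sum>i<n. h i)" by (rule sum_shift_period[of h n L, OF hn])
  finally have hs: "(\<Sum>i<n. y (Suc i) / p (Suc i)) = (\<Sum>j<n. v j / z j)" by (simp only: h_def)
  have "\<forall>\<^sub>F l in sequentially. b l \<le> K" using ev3 K by (auto elim!: eventually_mono)
  moreover have "cmod (W l) \<le> C" for l using Wb bC order_trans by blast
  ultimately have "transit q K ((\<Sum>j<n. v j / z j) / of_nat n) b W C"
    unfolding transit_def by (intro conjI allI b0 bs bpos bC Ws lim[unfolded hs])
  then show ?thesis by blast
qed

text \<open>The last three conjuncts provide a point \<open>w\<close> over \<open>z 0\<close> whose backward orbits avoid the critical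
  point, as does its way to \<open>z 0\<close>.\<close>

definition marked :: "complex \<Rightarrow> complex set \<Rightarrow> (nat \<Rightarrow> complex) \<Rightarrow> (nat \<Rightarrow> real) \<Rightarrow> real \<Rightarrow> (nat \<Rightarrow> complex) \<Rightarrow> nat \<Rightarrow> complex \<Rightarrow> bool" where
  "marked c Q z \<beta> B v a w \<longleftrightarrow> cyc c (card Q) z \<and> Q = range z \<and> weight z \<beta> B \<and> (\<forall>j. \<beta> (j + card Q) = \<beta> j) \<and>
    (\<forall>j. v (Suc j) = 2 * z j * v j + 1) \<and> (\<forall>j. v (j + card Q) = v j) \<and>
    nu c Q c = (\<Sum>j<card Q. v j / z j) / of_nat (card Q) \<and>
    (quad c ^^ a) w = z 0 \<and> (\<forall>i<a. (quad c ^^ i) w \<noteq> 0) \<and> (\<forall>i. (quad c ^^ i) 0 \<noteq> w)"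

lemma marked_ex:
  assumes Q: "Q \<in> repelling_orbits c" and ex: "\<not> (c = -2 \<and> Q = {2})"
  shows "\<exists>z \<beta> B v a w. marked c Q z \<beta> B v a w"
proof -
  obtain z \<beta> B v where z: "cyc c (card Q) z" "Q = range z" "weight z \<beta> B" "\<And>j. \<beta> (j + card Q) = \<beta> j"
    "\<And>j. v (Suc j) = 2 * z j * v j + 1" "\<And>j. v (j + card Q) = v j"
    "nu c Q c = (\<Sum>j<card Q. v j / z j) / of_nat (card Q)"
  proof (rule repelling_variation[OF Q])
    fix z \<beta> B v
    assume "cyc c (card Q) z" "Q = range z" "weight z \<beta> B" "\<And>j. \<beta> (j + card Q) = \<beta> j"
      "\<And>j. v (Suc j) = 2 * z j * v j + 1" "\<And>j. v (j + card Q) = v j"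
      "nu c Q c = (\<Sum>j<card Q. v j / z j) / of_nat (card Q)"
    then show thesis by (rule that)
  qed
  have ex': "\<not> (c = -2 \<and> range z = {2})" using ex unfolding z(2) .
  obtain w a where w: "(quad c ^^ a) w \<in> range z" "\<And>i. i < a \<Longrightarrow> (quad c ^^ i) w \<noteq> 0" "\<And>i. (quad c ^^ i) 0 \<noteq> w"
  proof (rule noncritical_preimage[OF z(1,3) ex'])
    fix w a
    assume "(quad c ^^ a) w \<in> range z" "\<And>i. i < a \<Longrightarrow> (quad c ^^ i) w \<noteq> 0" "\<And>i. (quad c ^^ i) 0 \<noteq> w"
    then show thesis by (rule that)
  qed
  obtain i where i: "(quad c ^^ a) w = z i" using w(1) by auto
  have rg: "range (\<lambda>j. z (i + j)) = Q" using cyc_range(2)[OF z(1)] z(2) by simp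
  have "marked c Q (\<lambda>j. z (i + j)) (\<lambda>j. \<beta> (i + j)) B (\<lambda>j. v (i + j)) a w"
    unfolding marked_def
  proof (intro conjI allI impI)
    show "cyc c (card Q) (\<lambda>j. z (i + j))" by (rule cyc_shift[OF z(1)])
    show "weight (\<lambda>j. z (i + j)) (\<lambda>j. \<beta> (i + j)) B" by (rule weight_shift[OF z(3)])
    show "\<beta> (i + (j + card Q)) = \<beta> (i + j)" for j using z(4)[of "i + j"] by (simp add: add.assoc)
    show "v (i + Suc j) = 2 * z (i + j) * v (i + j) + 1" for j using z(5)[of "i + j"] by simp
    show "v (i + (j + card Q)) = v (i + j)" for j using z(6)[of "i + j"] by (simp add: add.assoc)
    have "(\<Sum>j<card Q. v (i + j) / z (i + j)) = (\<Sum>j<card Q. v j / z j)"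
      by (rule sum_shift_period[of "\<lambda>j. v j / z j"]) (use z(6) cycD(3)[OF z(1)] in simp)
    then show "nu c Q c = (\<Sum>j<card Q. v (i + j) / z (i + j)) / of_nat (card Q)" using z(7) by simp
    show "(quad c ^^ a) w = z (i + 0)" using i by simp
  qed (use rg w(2,3) in auto)
  then show ?thesis by blast
qed

section \<open>Mixing two cycles in prescribed proportions\<close>

lemma floor_multiple_asymp:
  assumes t: "0 < t"
  defines "N k \<equiv> nat \<lfloor>t * real k\<rfloor>"
  shows "(\<lambda>k. real (L + M * N k) / real k) \<longlonglongrightarrow> real M * t"
    and "filterlim N at_top sequentially"
proof -
  have Nr: "real (N k) = of_int \<lfloor>t * real k\<rfloor>" for k using t by (simp add: N_def)
  have b: "t * real k - 1 \<le> real (N k)" "real (N k) \<le> t * real k" for k unfolding Nr by linarith+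
  have lim: "(\<lambda>k. real (N k) / real k) \<longlonglongrightarrow> t"
  proof (rule tendsto_sandwich)
    show "\<forall>\<^sub>F k in sequentially. t - 1 / real k \<le> real (N k) / real k"
      using eventually_gt_at_top[of 0]
    proof eventually_elim
      case (elim k)
      then have "t - 1 / real k = (t * real k - 1) / real k" by (simp add: field_simps)
      then show ?case using b(1)[of k] by (simp add: divide_right_mono)
    qed
    show "\<forall>\<^sub>F k in sequentially. real (N k) / real k \<le> t"
      using eventually_gt_at_top[of 0]
    proof eventually_elim
      case (elim k)
      then show ?case using b(2)[of k] by (simp add: field_simps)
    qed
    show "(\<lambda>k. t - 1 / real k) \<longlonglongrightarrow> t"
      using tendsto_diff[OF tendsto_const[of t] lim_const_over_n[of 1]] by simp
  qed auto
  have "(\<lambda>k. real L / real k + real M * (real (N k) / real k)) \<longlonglongrightarrow> 0 + real M * t"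
    by (intro tendsto_add tendsto_mult tendsto_const lim lim_const_over_n)
  then show "(\<lambda>k. real (L + M * N k) / real k) \<longlonglongrightarrow> real M * t"
    by (simp add: add_divide_distrib)
  have fl: "filterlim (\<lambda>k. real (N k) / real k * real k) at_top sequentially"
    by (rule filterlim_tendsto_pos_mult_at_top[OF lim t filterlim_real_sequentially])
  have "\<forall>\<^sub>F k in sequentially. real (N k) / real k * real k = real (N k)"
    using eventually_gt_at_top[of 0] by eventually_elim simp
  then have "filterlim (\<lambda>k. real (N k)) at_top sequentially"
    using fl by (rule iffD1[OF filterlim_cong[OF refl refl]])
  then show "filterlim N at_top sequentially"
    by (rule iffD2[OF filterlim_sequentially_iff_filterlim_real])
qed

text \<open>Piece \<open>p\<close> comes out of the cycle \<open>Q p\<close> and ends at the point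
  \<open>z (\<not> p) 0\<close> of the other cycle, near which the next piece begins. Lengths in the
  ratio \<open>T True : T False\<close> make the mean of the velocities tend to the convex
  combination.\<close>

lemma mixed_orbit:
  fixes Q :: "bool \<Rightarrow> complex set"
  assumes Q: "\<And>p. Q p \<in> repelling_orbits c" "Q True \<noteq> Q False" and ex: "\<And>p. \<not> (c = -2 \<and> Q p = {2})"
    and T: "\<And>p. T p > 0" "T True + T False = 1" and e: "e > 0"
  shows "\<exists>R\<in>repelling_orbits c. m \<le> card R \<and>
    cmod (nu c R c - (of_real (T True) * nu c (Q True) c + of_real (T False) * nu c (Q False) c)) < e"
proof -
  have "\<forall>p. \<exists>z \<beta> B v a w. marked c (Q p) z \<beta> B v a w" using marked_ex[OF Q(1) ex] by blast
  then obtain z \<beta> B v a w where mk: "\<And>p. marked c (Q p) (z p) (\<beta> p) (B p) (v p) (a p) (w p)"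
    by metis
  define n where "n p = card (Q p)" for p
  have z: "cyc c (n p) (z p)" "Q p = range (z p)" "weight (z p) (\<beta> p) (B p)" "\<beta> p (j + n p) = \<beta> p j"
    "v p (Suc j) = 2 * z p j * v p j + 1" "v p (j + n p) = v p j"
    "nu c (Q p) c = (\<Sum>j<n p. v p j / z p j) / of_nat (n p)"
    "(quad c ^^ a p) (w p) = z p 0" "i < a p \<Longrightarrow> (quad c ^^ i) (w p) \<noteq> 0" "(quad c ^^ i) 0 \<noteq> w p" for p i j
    using mk[of p] unfolding marked_def n_def by blast+
  have npos: "n p > 0" for p using cycD(1)[OF z(1)] .
  have "\<exists>q L. asymptotic_past c (n p) (z p) (z (\<not> p) 0) q L" for p
    by (rule heteroclinic[OF z(1)[of p] z(3)[of p] z(4)[of p] z(8)[of "\<not> p"] z(9)[of _ "\<not> p"] z(10)[of _ "\<not> p"]])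
  then obtain q L where ap: "\<And>p. asymptotic_past c (n p) (z p) (z (\<not> p) 0) (q p) (L p)" by metis
  have q: "q p 0 = z (\<not> p) 0" "q p l = (q p (Suc l))\<^sup>2 + c" "q p (Suc l) \<noteq> 0"
    "(\<lambda>l. q p l - z p (L p + (n p - 1) * l)) \<longlonglongrightarrow> 0" for p l
    using ap[of p] unfolding asymptotic_past_def by blast+
  define K where "K = 3 * max (B True) (B False)"
  have K: "3 * B p \<le> K" for p by (cases p) (auto simp: K_def)
  have "\<exists>b W C. transit (q p) K (nu c (Q p) c) b W C" for p
    unfolding z(7) by (rule transit_ex[OF z(1)[of p] z(3)[of p] z(4)[of p] z(5)[of p] z(6)[of p] q(3)[of p] q(4)[of p] K[of p]])
  then obtain b W C where tr: "\<And>p. transit (q p) K (nu c (Q p) c) (b p) (W p) (C p)" by metis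
  have b: "b p 0 = K" "2 * cmod (q p (Suc l)) * b p (Suc l) = 1 + b p l" "0 < b p l" 
    "b p l \<le> C p" "2 * q p (Suc l) * W p (Suc l) = W p l - 1" "cmod (W p l) \<le> C p"
    "\<forall>\<^sub>F l in sequentially. b p l \<le> K"
    "(\<lambda>l. (\<Sum>i<l. W p (Suc i) / q p (Suc i)) / of_nat l) \<longlonglongrightarrow> nu c (Q p) c" for p l
    using tr[of p] unfolding transit_def by blast+
  \<comment> \<open>A bound for weights and velocities along both pieces at all lengths, so that the
    accuracy \<open>s\<close> can be fixed before the lengths are.\<close>
  define D where "D = max (C True) (C False)"
  have CD: "C p \<le> D" for p by (cases p) (auto simp: D_def)
  have bD: "b p l \<le> D" and WD: "cmod (W p l) \<le> D" for p l using b(4,6) CD order_trans by blast+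
  have D: "D > 0" using bD[of True 0] b(3)[of True 0] by linarith
  \<comment> \<open>Separation of the two cycles, used only to show that the new cycle has many
    points.\<close>
  obtain \<delta> where \<delta>: "\<delta> > 0" "\<And>y. y \<in> Q True \<Longrightarrow> 4 * \<delta> < dist (z False 0) y"
  proof -
    have disj: "z False 0 \<notin> Q True"
    proof
      assume "z False 0 \<in> Q True"
      then obtain i where i: "z False 0 = z True i" using z(2)[of True] by blast
      have sh: "z False k = z True (i + k)" for k
        using funpow_quad[of "z False" c k 0, OF cycD(2)[OF z(1)]] funpow_quad[of "z True" c k i, OF cycD(2)[OF z(1)]] i by simp
      have "Q False = range (\<lambda>j. z True (i + j))" unfolding z(2) using sh by simp
      also have "\<dots> = Q True" unfolding cyc_range(2)[OF z(1)] z(2)[of True] ..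
      finally show False using Q(2) by simp
    qed
    have fin: "finite (Q True)" using npos[of True] unfolding n_def using card_ge_0_finite by blast
    obtain d where "d > 0" "\<forall>y\<in>Q True. y \<noteq> z False 0 \<longrightarrow> d \<le> dist (z False 0) y"
      using finite_set_avoid[OF fin, of "z False 0"] by blast
    then show thesis using that[of "d / 5"] disj by force
  qed
  define E where "E = 32 * D ^ 4 * (1 + D)"
  have E: "E > 0" using D by (simp add: E_def)
  define s where "s = min (min (1 / (4 * D\<^sup>2)) (e / (4 * E))) (min (\<delta> / D) \<delta>)"
  have s0: "s > 0" using D E e \<delta> by (simp add: s_def)
  have sle: "s \<le> 1 / (4 * D\<^sup>2)" "s \<le> e / (4 * E)" "s \<le> \<delta> / D" "s \<le> \<delta>" by (auto simp: s_def)
  have s: "4 * D\<^sup>2 * s \<le> 1" "E * s \<le> e / 4" "s * D \<le> \<delta>"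
    using sle D E by (auto simp: field_simps)
  define N where "N p k = nat \<lfloor>T p * real k\<rfloor>" for p k
  \<comment> \<open>A common multiple of the periods: lengthening a piece by multiples of
    \<open>M\<close> keeps its start near the point \<open>z p 0\<close>, where the other piece
    ends.\<close>
  define M where "M = n True * n False"
  have M: "M > 0" using npos by (simp add: M_def)
  define len where "len k p = L p + M * N p k" for k p
  have Nlim: "(\<lambda>k. real (len k p) / real k) \<longlonglongrightarrow> real M * T p" "filterlim (N p) at_top sequentially" for p
    unfolding len_def N_def by (rule floor_multiple_asymp[OF T(1)])+
  have lentop: "filterlim (\<lambda>k. len k p) at_top sequentially" for p
    by (rule filterlim_at_top_mono[OF Nlim(2)[of p]]) (use M in \<open>auto simp: len_def intro!: always_eventually trans_le_add2\<close>)
  have ev_len: "\<forall>\<^sub>F k in sequentially. P (len k p)" if "\<forall>\<^sub>F l in sequentially. P l" for P p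
    using eventually_compose_filterlim[OF that lentop] .
  have sync: "z p (L p + (n p - 1) * len k p) = z p 0" for k p
  proof -
    define r where "r = L p + n (\<not> p) * N p k * (n p - 1)"
    have "M = n p * n (\<not> p)" by (cases p) (auto simp: M_def)
    then have "L p + (n p - 1) * len k p = 0 + r * n p"
      using npos[of p] unfolding len_def r_def by (cases "n p") (auto simp: algebra_simps)
    then show ?thesis using periodic_mult[of "z p" "n p" 0 r, OF cycD(3)[OF z(1)]] by (simp only:)
  qed
  have ev1: "\<forall>\<^sub>F k in sequentially. 1 \<le> len k p" for p by (rule ev_len[OF eventually_ge_at_top])
  have ev2: "\<forall>\<^sub>F k in sequentially. b p (len k p) \<le> K" for p by (rule ev_len[OF b(7)])
  have ev3: "\<forall>\<^sub>F k in sequentially. cmod (q p (len k p) - z p 0) \<le> s / 4" for p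
  proof -
    have "\<forall>\<^sub>F l in sequentially. cmod (q p l - z p (L p + (n p - 1) * l)) < s / 4"
      by (rule order_tendstoD(2)[OF tendsto_norm_zero[OF q(4)]]) (use s0 in simp)
    from ev_len[OF this, of p] show ?thesis by (rule eventually_mono) (simp only: sync less_imp_le)
  qed
  have "\<forall>\<^sub>F l in sequentially. cmod (q True l - z True (L True + (n True - 1) * l)) < \<delta>"
    by (rule order_tendstoD(2)[OF tendsto_norm_zero[OF q(4)]]) (rule \<delta>(1))
  then obtain N1 where N1: "\<And>l. l \<ge> N1 \<Longrightarrow> cmod (q True l - z True (L True + (n True - 1) * l)) < \<delta>"
    by (auto simp: eventually_sequentially)
  have ev4: "\<forall>\<^sub>F k in sequentially. N1 + m \<le> len k True" by (rule ev_len[OF eventually_ge_at_top])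
  define S where "S p l = (\<Sum>i<l. W p (Suc i) / q p (Suc i))" for p l
  define nn where "nn k = len k True + len k False" for k
  have Slim: "(\<lambda>k. S p (len k p) / of_nat (len k p)) \<longlonglongrightarrow> nu c (Q p) c" for p
    using filterlim_compose[OF b(8)[of p] lentop[of p]] by (simp add: S_def)
  have nnlim: "(\<lambda>k. real (nn k) / real k) \<longlonglongrightarrow> real M"
  proof -
    have "real M * T True + real M * T False = real M" using T(2) by (metis distrib_left mult.right_neutral)
    then show ?thesis using tendsto_add[OF Nlim(1)[of True] Nlim(1)[of False]] by (simp add: nn_def add_divide_distrib)
  qed
  have ratio: "(\<lambda>k. real (len k p) / real (nn k)) \<longlonglongrightarrow> T p" for p
  proof -
    have "(\<lambda>k. (real (len k p) / real k) / (real (nn k) / real k)) \<longlonglongrightarrow> real M * T p / real M"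
      by (rule tendsto_divide[OF Nlim(1) nnlim]) (use M in simp)
    moreover have "\<forall>\<^sub>F k in sequentially. (real (len k p) / real k) / (real (nn k) / real k) = real (len k p) / real (nn k)"
      using eventually_gt_at_top[of 0] by eventually_elim simp
    ultimately have "(\<lambda>k. real (len k p) / real (nn k)) \<longlonglongrightarrow> real M * T p / real M"
      by (rule Lim_transform_eventually)
    then show ?thesis using M by simp
  qed
  have Srat: "(\<lambda>k. S p (len k p) / of_nat (nn k)) \<longlonglongrightarrow> of_real (T p) * nu c (Q p) c" for p
  proof -
    have "(\<lambda>k. of_real (real (len k p) / real (nn k)) * (S p (len k p) / of_nat (len k p))) \<longlonglongrightarrow> of_real (T p) * nu c (Q p) c"
      by (intro tendsto_mult tendsto_of_real ratio Slim)
    moreover have "\<forall>\<^sub>F k in sequentially. of_real (real (len k p) / real (nn k)) * (S p (len k p) / of_nat (len k p)) = S p (len k p) / of_nat (nn k)"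
      using ev1[of p] by eventually_elim simp
    ultimately show ?thesis by (rule Lim_transform_eventually)
  qed
  define target where "target = of_real (T True) * nu c (Q True) c + of_real (T False) * nu c (Q False) c"
  have tl: "(\<lambda>k. (S True (len k True) + S False (len k False)) / of_nat (nn k) - target) \<longlonglongrightarrow> 0"
    using tendsto_diff[OF tendsto_add[OF Srat[of True] Srat[of False]] tendsto_const[of target]]
    by (simp add: target_def add_divide_distrib)
  have ev5: "\<forall>\<^sub>F k in sequentially. cmod ((S True (len k True) + S False (len k False)) / of_nat (nn k) - target) < e / 4"
    by (rule order_tendstoD(2)[OF tendsto_norm_zero[OF tl]]) (use e in simp)
  have ev6: "\<forall>\<^sub>F k in sequentially. 32 * D ^ 3 * (1 + 2 * D) / nn k < e / 4"
  proof -
    have "\<forall>\<^sub>F l in sequentially. 32 * D ^ 3 * (1 + 2 * D) / real l < e / 4"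
      by (rule order_tendstoD(2)[OF lim_const_over_n]) (use e in simp)
    moreover have "filterlim nn at_top sequentially"
      by (rule filterlim_at_top_mono[OF lentop[of True]]) (auto simp: nn_def)
    ultimately show ?thesis by (rule eventually_compose_filterlim)
  qed
  have "\<forall>\<^sub>F k in sequentially. (1 \<le> len k True \<and> 1 \<le> len k False \<and> b True (len k True) \<le> K \<and> b False (len k False) \<le> K) \<and>
    cmod (q True (len k True) - z True 0) \<le> s / 4 \<and> cmod (q False (len k False) - z False 0) \<le> s / 4 \<and>
    N1 + m \<le> len k True \<and> cmod ((S True (len k True) + S False (len k False)) / of_nat (nn k) - target) < e / 4 \<and>
    32 * D ^ 3 * (1 + 2 * D) / nn k < e / 4" (is "\<forall>\<^sub>F k in sequentially. ?P k")
    by (intro eventually_conj ev1 ev2 ev3 ev4 ev5 ev6)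
  then obtain k where "?P k" using eventually_happens trivial_limit_sequentially by blast
  then have k0: "1 \<le> len k True" "1 \<le> len k False" "b True (len k True) \<le> K" "b False (len k False) \<le> K"
    and k1: "cmod (q True (len k True) - z True 0) \<le> s / 4" "cmod (q False (len k False) - z False 0) \<le> s / 4"
    and k2: "N1 + m \<le> len k True"
    and k3: "cmod ((S True (len k True) + S False (len k False)) / of_nat (nn k) - target) < e / 4" "32 * D ^ 3 * (1 + 2 * D) / nn k < e / 4"
    by blast+
  have len1: "len k p \<ge> 1" for p using k0 by (cases p) auto
  have j1: "b (\<not> p) (len k (\<not> p)) \<le> b p 0" for p using k0 by (cases p) (auto simp: b(1))
  have j2: "cmod (q p 0 - q (\<not> p) (len k (\<not> p))) \<le> s / 4" for p
    using k1 by (cases p) (auto simp: q(1) norm_minus_commute)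
  obtain x where x: "cyc c (nn k) x" "range x \<in> repelling_orbits c"
    "\<And>j. cmod (x j - q (fst (idx (len k) j)) (snd (idx (len k) j))) \<le> s * D"
    "cmod (nu c (range x) c - (S True (len k True) + S False (len k False)) / of_nat (nn k)) \<le> 32 * D ^ 3 * (1 + 2 * D) / nn k + E * s"
    using spliced_orbit[of q c b D W s "len k", OF q(2) b(2) b(3) bD b(5) WD s0 s(1) len1 j1 j2]
    unfolding S_def nn_def E_def by blast
  have "cmod (nu c (range x) c - target) \<le> cmod (nu c (range x) c - (S True (len k True) + S False (len k False)) / of_nat (nn k))
     + cmod ((S True (len k True) + S False (len k False)) / of_nat (nn k) - target)"
    unfolding dist_norm[symmetric] by (rule dist_triangle)
  then have near: "cmod (nu c (range x) c - target) < e" using x(4) k3 s(2) e by linarith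
  \<comment> \<open>With fewer than \<open>m\<close> points, the point where the second piece
    begins, near \<open>z False 0\<close>, would recur among the first \<open>m\<close> points of
    the first piece. Those are far from the end of that piece and hence near \<open>Q True\<close>,
    contrary to the separation by \<open>4 * \<delta>\<close>.\<close>
  have card: "m \<le> card (range x)"
  proof (rule ccontr)
    assume "\<not> m \<le> card (range x)"
    then have lt: "card (range x) < m" by simp
    have i0: "idx (len k) (len k True) = (False, len k False)" using len1[of False] by (simp add: idx_def Let_def)
    have "x (len k True) \<in> x ` {..<card (range x)}" using cyc_card(4)[OF x(1) refl] by blast
    then obtain j where j: "j < card (range x)" "x (len k True) = x j" by blast
    then have jl: "j < len k True" "N1 \<le> len k True - j" using lt k2 by auto
    then have ij: "idx (len k) j = (True, len k True - j)" by (simp add: idx_def Let_def)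
    define y where "y = z True (L True + (n True - 1) * (len k True - j))"
    have "y \<in> Q True" unfolding y_def z(2)[of True] by blast
    then have "4 * \<delta> < dist (z False 0) y" by (rule \<delta>(2))
    also have "\<dots> \<le> cmod (q False (len k False) - z False 0) + cmod (x (len k True) - q False (len k False)) + cmod (x j - q True (len k True - j)) + cmod (q True (len k True - j) - y)"
    proof -
      have "dist (z False 0) y \<le> dist (q False (len k False)) (z False 0) + dist (x j) (q False (len k False)) + dist (x j) (q True (len k True - j)) + dist (q True (len k True - j)) y"
        using dist_triangle[of "z False 0" y "q False (len k False)"] dist_triangle[of "q False (len k False)" y "x j"]
          dist_triangle[of "x j" y "q True (len k True - j)"]
        by (simp add: dist_commute)
      then show ?thesis unfolding j(2) dist_norm .
    qed
    also have "\<dots> \<le> s / 4 + s * D + s * D + \<delta>"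
      using k1(2) x(3)[of "len k True"] x(3)[of j] N1[OF jl(2)] unfolding i0 ij y_def fst_conv snd_conv by linarith
    also have "\<dots> \<le> 4 * \<delta>" using s(3) sle(4) s0 by linarith
    finally show False by simp
  qed
  show ?thesis
  proof (rule bexI[where x="range x"])
    show "m \<le> card (range x) \<and>
      cmod (nu c (range x) c - (of_real (T True) * nu c (Q True) c + of_real (T False) * nu c (Q False) c)) < e"
      using card near[unfolded target_def] by (rule conjI)
  qed (rule x(2))
qed

section \<open>Expansion outside the Mandelbrot set\<close>

text \<open>By the maximum principle the interior of a loop in a component stays in the sublevel
  set, and being connected with the loop it stays in the component.\<close>

lemma simply_connected_sublevel_component:
  assumes p: "p holomorphic_on UNIV" and V: "V \<in> components {z. cmod (p z) < R}"
  shows "simply_connected V"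
proof -
  define U where "U = {z. cmod (p z) < R}"
  have contp: "continuous_on A p" for A
    using holomorphic_on_imp_continuous_on[OF p] continuous_on_subset by blast
  have oU: "open U" unfolding U_def by (intro open_Collect_less continuous_intros contp)
  have VU: "V \<in> components U" using V by (simp add: U_def)
  have oV: "open V" using open_components[OF oU VU] .
  have VsU: "V \<subseteq> U" using in_components_subset[OF VU] .
  show ?thesis
    unfolding simply_connected_eq_winding_number_zero[OF oV]
  proof (intro conjI allI impI)
    show "connected V" using in_components_connected[OF VU] .
    fix g z assume g: "path g \<and> path_image g \<subseteq> V \<and> pathfinish g = pathstart g \<and> z \<notin> V"
    define K where "K = path_image g"
    have K: "compact K" "connected K" "K \<noteq> {}" "K \<subseteq> V"
      using g by (auto simp: K_def compact_path_image connected_path_image)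
    obtain x where x: "x \<in> K" "\<And>y. y \<in> K \<Longrightarrow> cmod (p y) \<le> cmod (p x)"
      using continuous_attains_sup[OF K(1,3), of "\<lambda>z. cmod (p z)"] contp continuous_on_norm by blast
    have xR: "cmod (p x) < R" using x(1) K(4) VsU by (auto simp: U_def)
    have clK: "closed K" using K(1) compact_imp_closed by blast
    have "inside K \<subseteq> U"
    proof
      fix y assume y: "y \<in> inside K"
      have "cmod (p y) \<le> cmod (p x)"
      proof (rule maximum_modulus_frontier[of p "inside K"])
        show "p holomorphic_on interior (inside K)" using p holomorphic_on_subset by blast
        show "bounded (inside K)" using bounded_inside K(1) compact_imp_bounded by blast
        show "cmod (p w) \<le> cmod (p x)" if "w \<in> frontier (inside K)" for w
          using that frontier_inside_subset[OF clK] x(2) by blast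
      qed (use contp y in auto)
      then show "y \<in> U" using xR by (simp add: U_def)
    qed
    moreover have "connected (K \<union> inside K)" using connected_with_inside[OF clK K(2)] .
    ultimately have "K \<union> inside K \<subseteq> V"
      using components_maximal[OF VU, of "K \<union> inside K"] K(3,4) VsU by blast
    then have "z \<notin> K" "z \<notin> inside K" using g by blast+
    then have "z \<in> outside K" using inside_Un_outside[of K] by blast
    then show "winding_number g z = 0"
      using g winding_number_zero_in_outside[of g z] by (auto simp: K_def)
  qed
qed

text \<open>This yields an inverse branch of the quadratic map on the whole sublevel set, chosen
  separately on each component; it exists because the critical value \<open>c\<close> lies
  outside.\<close>

lemma sqrt_on_sublevel:
  assumes p: "p holomorphic_on UNIV" and c: "\<not> cmod (p c) < R"
  obtains s where "s holomorphic_on {z. cmod (p z) < R}" "\<And>w. cmod (p w) < R \<Longrightarrow> (s w)\<^sup>2 = w - c"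
proof -
  define U where "U = {z. cmod (p z) < R}"
  have contp: "continuous_on A p" for A
    using holomorphic_on_imp_continuous_on[OF p] continuous_on_subset by blast
  have oU: "open U" unfolding U_def by (intro open_Collect_less continuous_intros contp)
  define G where "G V = (SOME g. g holomorphic_on V \<and> (\<forall>w\<in>V. w - c = (g w)\<^sup>2))" for V
  have G: "G V holomorphic_on V" "\<And>w. w \<in> V \<Longrightarrow> w - c = (G V w)\<^sup>2" if V: "V \<in> components U" for V
  proof -
    have oV: "open V" using open_components[OF oU V] .
    have sc: "simply_connected V" using simply_connected_sublevel_component[OF p] V by (simp add: U_def)
    have "c \<notin> V" using in_components_subset[OF V] c by (auto simp: U_def)
    then have "\<exists>g. g holomorphic_on V \<and> (\<forall>w\<in>V. w - c = (g w)\<^sup>2)"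
      using sc unfolding simply_connected_eq_holomorphic_sqrt[OF oV] 
      by (elim conjE allE[of _ "\<lambda>w. w - c"] impE) (auto intro!: holomorphic_intros)
    from someI_ex[OF this] show "G V holomorphic_on V" "\<And>w. w \<in> V \<Longrightarrow> w - c = (G V w)\<^sup>2"
      unfolding G_def by blast+
  qed
  define s where "s w = G (connected_component_set U w) w" for w
  have comp: "connected_component_set U w \<in> components U" if "w \<in> U" for w
    using that by (auto simp: components_def)
  have self: "w \<in> connected_component_set U w" if "w \<in> U" for w using that by simp
  show thesis
  proof (rule that[of s])
    show "(s w)\<^sup>2 = w - c" if "cmod (p w) < R" for w
    proof -
      have "w \<in> U" using that by (simp add: U_def)
      then show ?thesis using G(2)[OF comp self] by (simp add: s_def)
    qed
    show "s holomorphic_on {z. cmod (p z) < R}"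
      unfolding U_def[symmetric] holomorphic_on_def
    proof
      fix w assume w: "w \<in> U"
      let ?V = "connected_component_set U w"
      have oV: "open ?V" using open_components[OF oU comp[OF w]] .
      have "s holomorphic_on ?V \<longleftrightarrow> G ?V holomorphic_on ?V"
      proof (rule holomorphic_cong[OF refl])
        fix y assume "y \<in> ?V"
        then have "connected_component_set U y = ?V" using connected_component_eq by blast
        then show "s y = G ?V y" by (simp add: s_def)
      qed
      then have "s holomorphic_on ?V" using G(1)[OF comp[OF w]] by simp
      then have "s field_differentiable (at w)"
        using holomorphic_on_imp_differentiable_at[OF _ oV self[OF w]] by blast
      then show "s field_differentiable at w within U" by (rule field_differentiable_at_within)
    qed
  qed
qed

text \<open>Caratheodory's infinitesimal metric.\<close>

definition cmetric :: "complex set \<Rightarrow> complex \<Rightarrow> real" where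
  "cmetric U z = Sup {cmod (deriv h z) | h. h holomorphic_on U \<and> h ` U \<subseteq> ball 0 1}"

lemma cmetric_bound_aux:
  assumes "h holomorphic_on U" "h ` U \<subseteq> ball 0 1" "ball z e \<subseteq> U" "e > 0"
  shows "cmod (deriv h z) \<le> 2 / e"
proof -
  have sub: "cball z (e / 2) \<subseteq> U" using assms(3,4) by auto
  then have hol: "h holomorphic_on cball z (e / 2)" using assms(1) holomorphic_on_subset by blast
  have "cmod ((deriv ^^ 1) h z) \<le> fact 1 * 1 / (e / 2) ^ 1"
  proof (rule Cauchy_inequality)
    show "h holomorphic_on ball z (e / 2)" using hol ball_subset_cball holomorphic_on_subset by blast
    show "continuous_on (cball z (e / 2)) h" using hol holomorphic_on_imp_continuous_on by blast
    show "cmod (h x) \<le> 1" if "cmod (z - x) = e / 2" for x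
    proof -
      have "x \<in> U" using that sub by (auto simp: dist_norm)
      then have "h x \<in> ball 0 1" using assms(2) by blast
      then show ?thesis by simp
    qed
  qed (use assms in auto)
  then show ?thesis by simp
qed

lemma cmetric_ge:
  assumes "open U" "z \<in> U" "h holomorphic_on U" "h ` U \<subseteq> ball 0 1"
  shows "cmod (deriv h z) \<le> cmetric U z"
proof -
  obtain e where e: "e > 0" "ball z e \<subseteq> U" using assms(1,2) open_contains_ball by blast
  show ?thesis unfolding cmetric_def
  proof (rule cSup_upper)
    show "bdd_above {cmod (deriv h z) | h. h holomorphic_on U \<and> h ` U \<subseteq> ball 0 1}"
      by (rule bdd_aboveI[of _ "2 / e"]) (use cmetric_bound_aux[OF _ _ e(2,1)] in auto)
  qed (use assms in blast)
qed

lemma cmetric_le: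
  assumes "\<And>h. h holomorphic_on U \<Longrightarrow> h ` U \<subseteq> ball 0 1 \<Longrightarrow> cmod (deriv h z) \<le> b"
  shows "cmetric U z \<le> b"
  unfolding cmetric_def
proof (rule cSup_least)
  have "(\<lambda>_. 0) holomorphic_on U \<and> (\<lambda>_. 0::complex) ` U \<subseteq> ball 0 1" by auto
  then show "{cmod (deriv h z) | h. h holomorphic_on U \<and> h ` U \<subseteq> ball 0 1} \<noteq> {}" by blast
qed (use assms in blast)

lemma cmetric_lower:
  assumes "open U" "z \<in> U" "U \<subseteq> ball 0 R" "R > 0"
  shows "1 / R \<le> cmetric U z"
proof -
  have d: "((\<lambda>w. w / of_real R) has_field_derivative (1 / of_real R)) (at z)"
    using assms(4) by (auto intro!: derivative_eq_intros)
  have "cmod (deriv (\<lambda>w. w / of_real R) z) \<le> cmetric U z"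
    by (rule cmetric_ge[OF assms(1,2)]) (use assms(3,4) in \<open>auto intro!: holomorphic_on_divide simp: norm_divide dist_norm\<close>)
  then show ?thesis using DERIV_imp_deriv[OF d] assms(4) by (simp add: norm_divide)
qed

text \<open>The Earle--Hamilton argument: a branch \<open>g\<close> of the inverse maps \<open>U\<close> well inside itself, so
  \<open>w \<mapsto> g w + \<eta> (g w - y)\<close> still maps \<open>U\<close> to itself, and the metric contracts by \<open>1 + \<eta>\<close>.\<close>

lemma cmetric_expand:
  assumes U: "open U" "U \<subseteq> ball 0 R" and s: "s holomorphic_on U" "\<And>w. w \<in> U \<Longrightarrow> (s w)\<^sup>2 = w - c"
    and pre: "\<And>w. quad c w \<in> U \<Longrightarrow> ball w e \<subseteq> U" and e: "e > 0" and R: "R > 0"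
    and y: "quad c y \<in> U" "y \<noteq> 0"
  shows "cmetric U y * (1 + e / (2 * R)) \<le> 2 * cmod y * cmetric U (quad c y)"
proof -
  \<comment> \<open>The \<open>\<eta>\<close> of the argument above: as |g w - y| < 2 R, the
    displacement stays below \<open>e\<close>.\<close>
  define k where "k = e / (2 * R)"
  have k: "k > 0" using e R by (simp add: k_def)
  \<comment> \<open>The sign of the square root is chosen globally so that the branch returns to
    \<open>y\<close>.\<close>
  obtain g where g: "g holomorphic_on U" "\<And>w. w \<in> U \<Longrightarrow> (g w)\<^sup>2 = w - c" "g (quad c y) = y"
  proof -
    have "(s (quad c y))\<^sup>2 = y\<^sup>2" using s(2)[OF y(1)] by (simp add: quad_def)
    then consider "s (quad c y) = y" | "s (quad c y) = - y" by (auto simp: power2_eq_iff)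
    then show thesis
    proof cases
      case 1
      then show ?thesis using that[of s] s by blast
    next
      case 2
      then show ?thesis using that[of "\<lambda>w. - s w"] s by (auto intro!: holomorphic_intros)
    qed
  qed
  have gp: "quad c (g w) = w" if "w \<in> U" for w using g(2)[OF that] by (simp add: quad_def)
  have yU: "y \<in> U" using pre[OF y(1)] e by auto
  define G where "G w = g w + of_real k * (g w - y)" for w
  have Ghol: "G holomorphic_on U" unfolding G_def by (intro holomorphic_intros g)
  have GU: "G w \<in> U" if "w \<in> U" for w
  proof -
    have b: "ball (g w) e \<subseteq> U" using pre gp[OF that] that by simp
    then have gU: "g w \<in> U" using e by auto
    have "cmod (g w - y) < 2 * R"
    proof -
      have "cmod (g w) < R" "cmod y < R" using gU yU U(2) by auto
      then show ?thesis using norm_triangle_ineq4[of "g w" y] by linarith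
    qed
    then have "k * cmod (g w - y) < e" using R e by (simp add: k_def field_simps)
    then have "G w \<in> ball (g w) e" using k by (simp add: G_def dist_norm norm_mult)
    then show ?thesis using b by blast
  qed
  have gd: "(g has_field_derivative deriv g (quad c y)) (at (quad c y))"
    using holomorphic_derivI[OF g(1) U(1) y(1)] .
  have gder: "2 * y * deriv g (quad c y) = 1"
  proof -
    have "((\<lambda>w. (g w)\<^sup>2) has_field_derivative 2 * y * deriv g (quad c y)) (at (quad c y))"
      by (auto intro!: derivative_eq_intros gd simp: g(3))
    then have "((\<lambda>w. w - c) has_field_derivative 2 * y * deriv g (quad c y)) (at (quad c y))"
      by (rule has_field_derivative_transform_within_open[OF _ U(1) y(1)]) (use g(2) in auto)
    moreover have "((\<lambda>w. w - c) has_field_derivative 1) (at (quad c y))"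
      by (auto intro!: derivative_eq_intros)
    ultimately show ?thesis by (rule DERIV_unique)
  qed
  have Gd: "(G has_field_derivative (1 + of_real k) * deriv g (quad c y)) (at (quad c y))"
    unfolding G_def by (auto intro!: derivative_eq_intros gd simp: algebra_simps)
  have Gy: "G (quad c y) = y" by (simp add: G_def g(3))
  have nk: "cmod (1 + of_real k) = 1 + k"
  proof -
    have "cmod (of_real (1 + k)) = 1 + k" using k by (subst norm_of_real) simp
    then show ?thesis by simp
  qed
  have "cmetric U y \<le> 2 * cmod y * cmetric U (quad c y) / (1 + k)"
  proof (rule cmetric_le)
    fix h assume h: "h holomorphic_on U" "h ` U \<subseteq> ball 0 1"
    have "(h has_field_derivative deriv h y) (at (G (quad c y)))"
      unfolding Gy using holomorphic_derivI[OF h(1) U(1) yU] .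
    from DERIV_chain[OF this Gd]
    have D: "deriv (h \<circ> G) (quad c y) = deriv h y * ((1 + of_real k) * deriv g (quad c y))"
      by (rule DERIV_imp_deriv)
    have "cmod (deriv (h \<circ> G) (quad c y)) \<le> cmetric U (quad c y)"
    proof (rule cmetric_ge[OF U(1) y(1)])
      show "(h \<circ> G) holomorphic_on U"
        using holomorphic_on_compose_gen[OF Ghol h(1)] GU by blast
      show "(h \<circ> G) ` U \<subseteq> ball 0 1" using GU h(2) by (auto simp: image_subset_iff)
    qed
    then have "cmod (deriv h y) * ((1 + k) * cmod (deriv g (quad c y))) \<le> cmetric U (quad c y)"
      unfolding D norm_mult nk .
    then have "2 * cmod y * (cmod (deriv h y) * ((1 + k) * cmod (deriv g (quad c y)))) \<le> 2 * cmod y * cmetric U (quad c y)"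
      by (intro mult_left_mono) auto
    moreover have "2 * cmod y * (cmod (deriv h y) * ((1 + k) * cmod (deriv g (quad c y)))) = cmod (deriv h y) * (1 + k)"
    proof -
      have 1: "2 * cmod y * cmod (deriv g (quad c y)) = 1"
        using arg_cong[OF gder, of cmod] by (simp add: norm_mult)
      have "2 * cmod y * (cmod (deriv h y) * ((1 + k) * cmod (deriv g (quad c y)))) =
          (2 * cmod y * cmod (deriv g (quad c y))) * (cmod (deriv h y) * (1 + k))" by (simp add: mult_ac)
      then show ?thesis unfolding 1 by simp
    qed
    ultimately show "cmod (deriv h y) \<le> 2 * cmod y * cmetric U (quad c y) / (1 + k)"
      using k by (simp add: field_simps)
  qed
  then have "cmetric U y * (1 + k) \<le> 2 * cmod y * cmetric U (quad c y)" using k by (simp add: field_simps)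
  then show ?thesis unfolding k_def .
qed

section \<open>Escaping orbits and uniform expansion\<close>

lemma escape_step:
  assumes "cmod c \<le> C" "C + 2 \<le> cmod z" "0 \<le> C"
  shows "2 * cmod z \<le> cmod (quad c z)"
proof -
  have "(C + 2) * cmod z \<le> cmod z * cmod z" using assms by (intro mult_right_mono) auto
  moreover have "C * 1 \<le> C * cmod z" using assms by (intro mult_left_mono) auto
  moreover have "cmod z * cmod z - cmod c \<le> cmod (quad c z)"
    using norm_diff_ineq[of "z\<^sup>2" c] by (simp add: quad_def norm_mult power2_eq_square)
  ultimately show ?thesis using assms(1) by (simp add: algebra_simps)
qed

lemma escape_iter:
  assumes "cmod c \<le> C" "C + 2 \<le> cmod z" "0 \<le> C"
  shows "2 ^ k * cmod z \<le> cmod ((quad c ^^ k) z)"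
proof (induction k)
  case (Suc k)
  have "1 * cmod z \<le> 2 ^ k * cmod z" by (intro mult_right_mono) auto
  then have "C + 2 \<le> cmod ((quad c ^^ k) z)" using Suc assms by linarith
  from escape_step[OF assms(1) this assms(3)] Suc show ?case by simp
qed auto

lemma quad_param_holomorphic: "(\<lambda>c. (quad c ^^ m) (g c)) holomorphic_on S" if "g holomorphic_on S"
proof (induction m)
  case (Suc m)
  have "(\<lambda>c. (quad c ^^ Suc m) (g c)) = (\<lambda>c. ((quad c ^^ m) (g c))\<^sup>2 + c)" by (auto simp: quad_def)
  then show ?case using Suc by (auto intro!: holomorphic_intros)
qed (use that in simp)

lemma quad_iter_holomorphic: "(quad c ^^ m) holomorphic_on S"
  using quad_funpow_deriv field_differentiable_at_within
  unfolding holomorphic_on_def field_differentiable_def by blast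

definition uniform_weight :: "complex set \<Rightarrow> real \<Rightarrow> bool" where
  "uniform_weight S B \<longleftrightarrow> (\<forall>c\<in>S. \<forall>n z. cyc c n z \<longrightarrow> (\<exists>\<beta>. weight z \<beta> B \<and> (\<forall>j. \<beta> (j + n) = \<beta> j)))"

lemma uniform_weight_subset: "uniform_weight S B \<Longrightarrow> T \<subseteq> S \<Longrightarrow> uniform_weight T B"
  unfolding uniform_weight_def by blast

text \<open>For all parameters near \<open>c0\<close> the critical value leaves the sublevel set U
  of the \<open>m\<close>-th iterate, and the preimage of U lies in U at a depth \<open>e\<close>
  that does not depend on the parameter. \<open>cmetric_expand\<close> then expands along every
  cycle at a common rate, and the reciprocal of the metric is a weight up to scale.\<close>

theorem hyperbolic_outside_mandelbrot:
  assumes "c0 \<notin> mandelbrot"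
  obtains d B where "d > 0" "uniform_weight (ball c0 d) B" "d \<le> 1 / (16 * B\<^sup>2)"
proof -
  \<comment> \<open>It bounds the parameters within distance 1 of \<open>c0\<close>, and
    \<open>C \<ge> 1\<close> gives the margin \<open>R + C \<le> (C + 1)^2\<close> below.\<close>
  define C where "C = cmod c0 + 1"
  define R where "R = C + 2"
  have C: "C \<ge> 1" "C \<ge> 0" by (auto simp: C_def)
  have R: "R > 0" "R \<ge> 1" using C by (auto simp: R_def)
  have "\<not> bounded (range (\<lambda>n. (quad c0 ^^ n) 0))" using assms by (simp add: mandelbrot_def)
  then obtain m where m: "cmod ((quad c0 ^^ m) 0) > R"
    unfolding bounded_iff by (auto simp: not_le)
  have c0C: "cmod c0 \<le> C" by (simp add: C_def)
  have m1: "cmod ((quad c0 ^^ m) c0) > R"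
  proof -
    have "(quad c0 ^^ m) c0 = quad c0 ((quad c0 ^^ m) 0)"
      by (metis funpow_swap1 quad_def zero_power2 add_0)
    moreover have "2 * cmod ((quad c0 ^^ m) 0) \<le> cmod (quad c0 ((quad c0 ^^ m) 0))"
      by (rule escape_step[OF c0C _ C(2)]) (use m in \<open>simp add: R_def\<close>)
    ultimately show ?thesis using m R by simp
  qed
  have "isCont (\<lambda>c. cmod ((quad c ^^ m) c)) c0"
    using holomorphic_on_imp_continuous_on[OF quad_param_holomorphic[where g="\<lambda>c. c" and S=UNIV and m=m]]
    by (intro continuous_norm) (simp add: continuous_on_eq_continuous_at)
  then have "\<forall>\<^sub>F c in at c0. R < cmod ((quad c ^^ m) c)"
    using m1 order_tendstoD(1) unfolding isCont_def by blast
  then obtain r0 where r0: "r0 > 0" "\<And>c. c \<noteq> c0 \<Longrightarrow> dist c c0 < r0 \<Longrightarrow> R < cmod ((quad c ^^ m) c)"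
    unfolding eventually_at by blast
  define r where "r = min r0 1"
  \<comment> \<open>Along the points in question the \<open>m\<close>-th iterate has Lipschitz
    constant at most \<open>(2 * R + 1) ^ m\<close>, so a displacement below \<open>e\<close>
    changes it by at most 1/2. On the preimage of U its modulus is below
    \<open>R - 1\<close>.\<close>
  define e where "e = 1 / (2 * (2 * R + 1) ^ m)"
  have e: "e > 0" using R by (simp add: e_def)
  define k where "k = e / (2 * R)"
  \<comment> \<open>Since the metric is at most \<open>2 / e\<close>, this makes the gain
    \<open>k * K / \<alpha>\<close> at least 1.\<close>
  define K where "K = 2 / (k * e)"
  have k: "k > 0" and K: "K > 0" using e R by (auto simp: k_def K_def)
  have r: "r > 0" using r0 by (simp add: r_def)
  have "\<exists>\<beta>. weight z \<beta> (K * R) \<and> (\<forall>j. \<beta> (j + n) = \<beta> j)" if cr: "c \<in> ball c0 r" and cz: "cyc c n z" for c n z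
  proof -
    note cc = cycD[OF cz]
    have cC: "cmod c \<le> C"
    proof -
      have "cmod (c - c0) < 1" using cr by (simp add: r_def dist_norm norm_minus_commute)
      then show ?thesis using norm_triangle_sub[of c c0] by (simp add: C_def)
    qed
    have cR: "R < cmod ((quad c ^^ m) c)" using r0(2)[of c] m1 cr by (cases "c = c0") (auto simp: r_def dist_commute)
    define U where "U = {w. cmod ((quad c ^^ m) w) < R}"
    have oU: "open U" unfolding U_def
      by (intro open_Collect_less continuous_intros holomorphic_on_imp_continuous_on quad_iter_holomorphic)
    obtain s where s: "s holomorphic_on U" "\<And>w. w \<in> U \<Longrightarrow> (s w)\<^sup>2 = w - c"
    proof -
      have nc: "\<not> cmod ((quad c ^^ m) c) < R" using cR by simp
      obtain s where "s holomorphic_on {z. cmod ((quad c ^^ m) z) < R}" "\<And>w. cmod ((quad c ^^ m) w) < R \<Longrightarrow> (s w)\<^sup>2 = w - c"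
        using sqrt_on_sublevel[OF quad_iter_holomorphic nc] by blast
      then show thesis using that[of s] by (simp add: U_def)
    qed
    have Uit: "cmod ((quad c ^^ i) w) < R" if "w \<in> U" "i \<le> m" for w i
    proof (rule ccontr)
      assume "\<not> cmod ((quad c ^^ i) w) < R"
      then have big: "C + 2 \<le> cmod ((quad c ^^ i) w)" by (simp add: R_def)
      have "(quad c ^^ m) w = (quad c ^^ (m - i)) ((quad c ^^ i) w)"
        using that(2) by (simp flip: funpow_add[THEN fun_cong, unfolded o_apply])
      then have "2 ^ (m - i) * cmod ((quad c ^^ i) w) \<le> cmod ((quad c ^^ m) w)"
        using escape_iter[OF cC big C(2), of "m - i"] by simp
      moreover have "1 * cmod ((quad c ^^ i) w) \<le> 2 ^ (m - i) * cmod ((quad c ^^ i) w)"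
        by (intro mult_right_mono) auto
      ultimately show False using that(1) big by (simp add: U_def R_def)
    qed
    have UR: "U \<subseteq> ball 0 R" using Uit[of _ 0] by auto
    have pre: "ball w e \<subseteq> U" if w: "quad c w \<in> U" for w
    proof -
      define y where "y = (quad c ^^ m) w"
      have "(quad c ^^ m) (quad c w) = y\<^sup>2 + c" by (simp add: y_def funpow_swap1[of "quad c", symmetric] quad_def[of c "(quad c ^^ m) w"])
      then have "cmod (y\<^sup>2 + c) < R" using w by (simp add: U_def)
      then have "(cmod y)\<^sup>2 < R + C" using cC norm_triangle_ineq4[of "y\<^sup>2 + c" c] by (simp add: norm_power)
      also have "\<dots> \<le> (C + 1)\<^sup>2"
        using C mult_mono[of 1 C 1 C] by (simp add: R_def power2_eq_square algebra_simps)
      finally have "cmod y < C + 1" using C by (simp add: power2_less_imp_less)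
      then have yR: "cmod ((quad c ^^ m) w) < R - 1" by (simp add: y_def R_def)
      then have wU: "w \<in> U" by (simp add: U_def)
      show ?thesis
      proof
        fix x assume "x \<in> ball w e"
        then have xw: "cmod (x - w) < e" by (simp add: dist_norm norm_minus_commute)
        have "i \<le> m \<Longrightarrow> cmod ((quad c ^^ i) x - (quad c ^^ i) w) \<le> e * (2 * R + 1) ^ i" for i
        proof (induction i)
          case 0
          then show ?case using xw by simp
        next
          case (Suc i)
          let ?a = "(quad c ^^ i) x" and ?b = "(quad c ^^ i) w"
          have IH: "cmod (?a - ?b) \<le> e * (2 * R + 1) ^ i" using Suc by simp
          have "e * (2 * R + 1) ^ i \<le> e * (2 * R + 1) ^ m"
            using e R Suc by (intro mult_left_mono power_increasing) auto
          also have "\<dots> \<le> 1" using R by (simp add: e_def field_simps)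
          finally have "cmod (?a - ?b) \<le> 1" using IH by linarith
          then have "cmod (?a + ?b) \<le> 2 * R + 1"
            using Uit[OF wU, of i] Suc norm_triangle_ineq[of "?a - ?b" "2 * ?b"] by (simp add: norm_mult add.commute[of ?a])
          then have "cmod (?a - ?b) * cmod (?a + ?b) \<le> (e * (2 * R + 1) ^ i) * (2 * R + 1)"
            using IH e R by (intro mult_mono) auto
          moreover have "quad c ?a - quad c ?b = (?a - ?b) * (?a + ?b)"
            by (simp add: quad_def algebra_simps power2_eq_square)
          ultimately show ?case by (simp add: norm_mult mult_ac)
        qed
        from this[of m] have "cmod ((quad c ^^ m) x - (quad c ^^ m) w) \<le> 1 / 2"
          using R by (simp add: e_def)
        then have "cmod ((quad c ^^ m) x) < R"
          using yR norm_triangle_sub[of "(quad c ^^ m) x" "(quad c ^^ m) w"] by linarith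
        then show "x \<in> U" by (simp add: U_def)
      qed
    qed
    obtain Z where Z: "\<And>j. cmod (z j) \<le> Z" using cyc_bounded[OF cz] by blast
    have zR: "cmod (z j) < R" for j
    proof (rule ccontr)
      assume "\<not> cmod (z j) < R"
      then have big: "C + 2 \<le> cmod (z j)" by (simp add: R_def)
      obtain i where i: "2 ^ i > Z" using real_arch_pow[of 2 Z] by auto
      have "2 ^ i * 1 \<le> 2 ^ i * cmod (z j)" using big C by (intro mult_left_mono) auto
      also have "\<dots> \<le> cmod ((quad c ^^ i) (z j))" by (rule escape_iter[OF cC big C(2)])
      also have "\<dots> = cmod (z (j + i))" using funpow_quad[of z c i j, OF cc(2)] by simp
      also have "\<dots> \<le> Z" by (rule Z)
      finally show False using i by simp
    qed
    have zU: "z j \<in> U" for j using funpow_quad[of z c m j, OF cc(2)] zR by (simp add: U_def)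
    have zq: "quad c (z j) = z (Suc j)" for j using cc(2) by (simp add: quad_def)
    have znz: "z j \<noteq> 0" for j
    proof
      assume "z j = 0"
      then have "c \<in> U" using zU[of "Suc j"] cc(2)[of j] by simp
      then show False using cR by (simp add: U_def)
    qed
    define \<alpha> where "\<alpha> j = cmetric U (z j)" for j
    have al: "1 / R \<le> \<alpha> j" for j unfolding \<alpha>_def by (rule cmetric_lower[OF oU zU UR R(1)])
    have apos: "\<alpha> j > 0" for j using al[of j] R by (smt (verit) divide_pos_pos)
    have au: "\<alpha> j \<le> 2 / e" for j unfolding \<alpha>_def
      by (rule cmetric_le) (rule cmetric_bound_aux[OF _ _ pre e], use zq zU in auto)
    have ex: "\<alpha> j * (1 + k) \<le> 2 * cmod (z j) * \<alpha> (Suc j)" for j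
      using cmetric_expand[OF oU UR s pre e R(1), of "z j"] zq zU znz unfolding \<alpha>_def k_def by simp
    have "weight z (\<lambda>j. K / \<alpha> j) (K * R)"
      unfolding weight_def
    proof (intro allI conjI)
      fix j
      show "0 < K / \<alpha> j" using K apos by simp
      show "K / \<alpha> j \<le> K * R" using al[of j] apos[of j] K R by (simp add: field_simps)
      have "1 \<le> k * K / \<alpha> (Suc j)" using au[of "Suc j"] apos[of "Suc j"] k e by (simp add: K_def field_simps)
      then have "1 + K / \<alpha> (Suc j) \<le> (1 + k) * (K / \<alpha> (Suc j))"
        by (simp add: algebra_simps add_divide_distrib)
      also have "\<dots> \<le> 2 * cmod (z j) * (K / \<alpha> j)"
        using mult_left_mono[OF ex[of j], of K] K apos[of j] apos[of "Suc j"] by (simp add: field_simps)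
      finally show "1 + K / \<alpha> (Suc j) \<le> 2 * cmod (z j) * (K / \<alpha> j)" .
    qed
    moreover have "K / \<alpha> (j + n) = K / \<alpha> j" for j by (simp add: \<alpha>_def cc(3))
    ultimately show ?thesis by blast
  qed
  then have u: "uniform_weight (ball c0 r) (K * R)" unfolding uniform_weight_def by blast
  show thesis
  \<comment> \<open>So small a disc lies in the disc of radius \<open>1 / (8 * B\<^sup>2)\<close>
    about each of its points, on which \<open>continuation\<close> works.\<close>
  proof (rule that[of "min r (1 / (16 * (K * R)\<^sup>2))" "K * R"])
    show "uniform_weight (ball c0 (min r (1 / (16 * (K * R)\<^sup>2)))) (K * R)"
      by (rule uniform_weight_subset[OF u]) auto
    show "min r (1 / (16 * (K * R)\<^sup>2)) > 0" using r K R by simp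
  qed simp
qed

section \<open>Holomorphic branches of cycles\<close>

definition branch_nu :: "nat \<Rightarrow> (nat \<Rightarrow> complex \<Rightarrow> complex) \<Rightarrow> complex \<Rightarrow> complex" where
  "branch_nu n x c = (\<Sum>j<n. deriv (x j) c / x j c) / of_nat n"

lemma branch_subset: "branch S n x \<Longrightarrow> T \<subseteq> S \<Longrightarrow> branch T n x"
  unfolding branch_def using holomorphic_on_subset by blast

lemma branch_nu_eq:
  assumes u: "uniform_weight S B" and b: "branch S n x" and S: "open S" "c \<in> S"
  shows "range (\<lambda>j. x j c) \<in> repelling_orbits c" "rho c (range (\<lambda>j. x j c)) c \<noteq> 0"
    "nu c (range (\<lambda>j. x j c)) c = branch_nu n x c" "cmod (branch_nu n x c) \<le> 2 * B\<^sup>2"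
proof -
  have cy: "cyc c n (\<lambda>j. x j c)" using b S(2) by (auto simp: branch_def)
  obtain \<beta> where w: "weight (\<lambda>j. x j c) \<beta> B" and p: "\<And>j. \<beta> (j + n) = \<beta> j"
    using u S(2) cy unfolding uniform_weight_def by blast
  note W = weightD[OF w]
  define v where "v j = deriv (x j) c" for j
  have v: "v (Suc j) = 2 * x j c * v j + 1" "v (j + n) = v j" for j
    using branch_variation[OF b S] by (simp_all add: v_def)
  show "range (\<lambda>j. x j c) \<in> repelling_orbits c" by (rule weight_repelling[OF cy w p])
  show "rho c (range (\<lambda>j. x j c)) c \<noteq> 0" by (rule nu_formula(1)[OF cy w p v])
  show "nu c (range (\<lambda>j. x j c)) c = branch_nu n x c"
    using nu_formula(2)[OF cy w p v] by (simp add: branch_nu_def v_def)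
  have n: "n > 0" using cycD(1)[OF cy] .
  have t: "cmod (v j / x j c) \<le> 2 * B\<^sup>2" for j
  proof -
    have "cmod (v j) \<le> B" using variation_bound[OF n w p v] W(2) order_trans by blast
    moreover have "1 / cmod (x j c) \<le> 2 * B" using W(5,6)[of j] by (simp add: field_simps)
    ultimately have "cmod (v j) * (1 / cmod (x j c)) \<le> B * (2 * B)" using W(4) by (intro mult_mono) auto
    then show ?thesis by (simp add: norm_divide power2_eq_square)
  qed
  have "cmod (\<Sum>j<n. v j / x j c) \<le> (\<Sum>j<n. 2 * B\<^sup>2)" by (intro sum_norm_le t)
  then have "cmod (\<Sum>j<n. v j / x j c) / n \<le> 2 * B\<^sup>2" using n by (simp add: field_simps)
  then show "cmod (branch_nu n x c) \<le> 2 * B\<^sup>2" by (simp add: branch_nu_def v_def norm_divide)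
qed

lemma branch_nu_holomorphic:
  assumes u: "uniform_weight S B" and b: "branch S n x" and S: "open S"
  shows "branch_nu n x holomorphic_on S"
proof (cases "S = {}")
  case False
  have nz: "x j c \<noteq> 0" if cS: "c \<in> S" for c j
  proof -
    have "cyc c n (\<lambda>j. x j c)" using b cS by (auto simp: branch_def)
    then obtain \<beta> where "weight (\<lambda>j. x j c) \<beta> B" using u cS unfolding uniform_weight_def by blast
    then show ?thesis by (rule weightD(5))
  qed
  have hol: "x j holomorphic_on S" for j using b by (auto simp: branch_def)
  have "n \<noteq> 0" using b False by (auto simp: branch_def cyc_def)
  then show ?thesis unfolding branch_nu_def using nz hol S
    by (intro holomorphic_intros holomorphic_deriv) auto
qed (simp add: holomorphic_on_def)

text \<open>All cycles over the disc continue to the whole disc, whatever their period, because the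
  radius depends on \<open>B\<close> alone. The exact period is used for the continuation, so that
  the number of points can be followed.\<close>

lemma branch_ex:
  assumes u: "uniform_weight (ball c0 d) B" and d: "d \<le> 1 / (16 * B\<^sup>2)" and c: "c \<in> ball c0 d" and z: "cyc c n z"
  obtains x where "branch (ball c0 d) n x" "\<And>j. x j c = z j"
    "\<And>y. y \<in> ball c0 d \<Longrightarrow> card (range (\<lambda>j. x j y)) = card (range z)"
proof -
  define m where "m = card (range z)"
  note zm = cyc_card[OF z m_def]
  obtain \<beta> where w: "weight z \<beta> B" using u c z unfolding uniform_weight_def by blast
  have B: "B > 0" using weightD(4)[OF w] .
  obtain x where x: "branch (ball c (1 / (8 * B\<^sup>2))) m x"
    "\<And>j y. y \<in> ball c (1 / (8 * B\<^sup>2)) \<Longrightarrow> cmod (x j y - z j) \<le> 1 / (4 * B)" "\<And>j. x j c = z j"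
    using continuation[OF zm(1) w] by blast
  have sub: "ball c0 d \<subseteq> ball c (1 / (8 * B\<^sup>2))"
  proof
    fix y assume "y \<in> ball c0 d"
    then have "dist c y < 2 * d" using c dist_triangle[of c y c0] by (simp add: dist_commute)
    also have "\<dots> \<le> 1 / (8 * B\<^sup>2)" using d by simp
    finally show "y \<in> ball c (1 / (8 * B\<^sup>2))" by simp
  qed
  have xm: "cyc y m (\<lambda>j. x j y)" if "y \<in> ball c0 d" for y
    using branchD(2)[OF x(1)] sub that by blast
  obtain k where k: "n = k * m" using zm(2) by (metis dvdE mult.commute)
  have k0: "k > 0" using k cycD(1)[OF z] by (cases k) auto
  obtain Z where Z: "\<And>j. cmod (z j) \<le> Z" using cyc_bounded[OF z] by blast
  show thesis
  proof (rule that[of x])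
    show "branch (ball c0 d) n x"
      unfolding branch_def
    proof (intro conjI allI ballI)
      show "x j holomorphic_on ball c0 d" for j using branchD(1)[OF x(1)] sub holomorphic_on_subset by blast
      show "cyc y n (\<lambda>j. x j y)" if "y \<in> ball c0 d" for y
        unfolding k by (rule cyc_mult[OF xm[OF that] k0])
    qed
    show "x j c = z j" for j by (rule x(3))
    fix y assume y: "y \<in> ball c0 d"
    have y': "y \<in> ball c (1 / (8 * B\<^sup>2))" using y sub by blast
    \<comment> \<open>If two points merged at \<open>y\<close>, the corresponding points over
      \<open>c\<close> and their whole orbits would stay within \<open>1 / (2 * B)\<close> of each
      other, and expansivity would identify them.\<close>
    have inj: "inj_on (\<lambda>j. x j y) {..<m}"
    proof (rule inj_onI)
      fix i j assume ij: "i \<in> {..<m}" "j \<in> {..<m}" "x i y = x j y"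
      have xx: "x (i + t) y = x (j + t) y" for t
        using funpow_quad[of "\<lambda>j. x j y" y t i, OF cycD(2)[OF xm[OF y]]]
          funpow_quad[of "\<lambda>j. x j y" y t j, OF cycD(2)[OF xm[OF y]]] ij(3) by simp
      have "z (j + 0) = z (i + 0)"
      proof (rule expansive[OF weight_shift[OF w, of i], where x="\<lambda>t. z (j + t)" and c=c and \<mu>="1 / (2 * B)"])
        show "cmod (z (j + t) - z (i + t)) \<le> 1 / (2 * B)" for t
        proof -
          have "z (j + t) - z (i + t) = (x (i + t) y - z (i + t)) - (x (j + t) y - z (j + t))" by (simp add: xx)
          then have "cmod (z (j + t) - z (i + t)) \<le> 1 / (4 * B) + 1 / (4 * B)"
            using norm_triangle_ineq4[of "x (i + t) y - z (i + t)" "x (j + t) y - z (j + t)"]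
              x(2)[OF y', of "i + t"] x(2)[OF y', of "j + t"] by simp
          then show ?thesis by (simp add: field_simps)
        qed
        show "2 * (1 / (2 * B)) * B \<le> 1" using B by simp
        show "cmod (z (i + t)) \<le> Z" for t by (rule Z)
        show "z (j + Suc t) = (z (j + t))\<^sup>2 + c" for t using cycD(2)[OF z, of "j + t"] by simp
        show "z (i + Suc t) = (z (i + t))\<^sup>2 + c" for t using cycD(2)[OF z, of "i + t"] by simp
      qed
      then show "i = j" using zm(3) ij by (auto dest: inj_onD)
    qed
    have "range (\<lambda>j. x j y) = (\<lambda>j. x j y) ` {..<m}" by (rule cyc_range(1)[OF xm[OF y]])
    then show "card (range (\<lambda>j. x j y)) = card (range z)" using card_image[OF inj] by (simp add: m_def)
  qed
qed

text \<open>Expansivity gives equality near \<open>c\<close>, and the identity theorem carries it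
  through \<open>S\<close>.\<close>

lemma branch_unique:
  assumes u: "uniform_weight S B" and x: "branch S n x" and y: "branch S n y"
    and S: "open S" "connected S" "c \<in> S" and eq: "\<And>j. x j c = y j c" and w: "w \<in> S"
  shows "x j w = y j w"
proof -
  have hx: "x j holomorphic_on S" and hy: "y j holomorphic_on S" for j using x y by (auto simp: branch_def)
  have cx: "cyc a n (\<lambda>j. x j a)" and cy: "cyc a n (\<lambda>j. y j a)" if "a \<in> S" for a
    using x y that by (auto simp: branch_def)
  obtain \<beta> where "weight (\<lambda>j. x j c) \<beta> B" using u S(3) cx unfolding uniform_weight_def by blast
  then have B: "B > 0" by (rule weightD(4))
  have ev: "\<forall>\<^sub>F a in nhds c. cmod (x j a - y j a) < 1 / (2 * B)" for j
  proof -
    have "isCont (\<lambda>a. cmod (x j a - y j a)) c"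
      using continuous_on_interior[OF holomorphic_on_imp_continuous_on[OF hx[of j]]]
        continuous_on_interior[OF holomorphic_on_imp_continuous_on[OF hy[of j]]] S(1,3)
      by (intro continuous_intros) (auto simp: interior_open)
    then have "((\<lambda>a. cmod (x j a - y j a)) \<longlongrightarrow> cmod (x j c - y j c)) (nhds c)"
      unfolding isCont_def by (rule tendsto_at_iff_tendsto_nhds[THEN iffD1])
    then show ?thesis by (rule order_tendstoD(2)) (use B eq in simp)
  qed
  have "\<forall>\<^sub>F a in nhds c. \<forall>j\<in>{..<n}. cmod (x j a - y j a) < 1 / (2 * B)"
    using ev by (simp add: eventually_ball_finite_distrib)
  then obtain V where V: "open V" "c \<in> V" "\<And>a j. a \<in> V \<Longrightarrow> j < n \<Longrightarrow> cmod (x j a - y j a) < 1 / (2 * B)"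
    unfolding eventually_nhds by auto
  have loc: "x j a = y j a" if a: "a \<in> V \<inter> S" for a j
  proof -
    have aS: "a \<in> S" using a by simp
    obtain \<beta> where wa: "weight (\<lambda>j. y j a) \<beta> B" using u aS cy unfolding uniform_weight_def by blast
    obtain Z where Z: "\<And>j. cmod (y j a) \<le> Z" using cyc_bounded[OF cy[OF aS]] by blast
    have near: "cmod (x j a - y j a) \<le> 1 / (2 * B)" for j
    proof -
      have "x j a - y j a = x (j mod n) a - y (j mod n) a"
        using periodic_mod[of "\<lambda>j. x j a" n j, OF cycD(3)[OF cx[OF aS]]] periodic_mod[of "\<lambda>j. y j a" n j, OF cycD(3)[OF cy[OF aS]]] by simp
      moreover have "j mod n < n" using cycD(1)[OF cx[OF aS]] by simp
      ultimately show ?thesis using V(3)[of a "j mod n"] a by simp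
    qed
    show ?thesis
      by (rule expansive[where x="\<lambda>j. x j a" and z="\<lambda>j. y j a" and c=a, OF wa cycD(2)[OF cx[OF aS]] cycD(2)[OF cy[OF aS]] near _ Z])
        (use B in simp)
  qed
  show ?thesis
    by (rule analytic_continuation_open[of "V \<inter> S" S "x j" "y j"])
      (use V S hx hy loc w in auto)
qed

lemma branch_nu_cong:
  assumes S: "open S" "c \<in> S" and eq: "\<And>j w. w \<in> S \<Longrightarrow> x j w = y j w"
  shows "branch_nu n x c = branch_nu n y c"
proof -
  have "deriv (x j) c = deriv (y j) c" for j
    by (rule deriv_cong_ev) (use eventually_nhds_in_open[OF S] eq in \<open>auto elim!: eventually_mono\<close>)
  then show ?thesis using eq[OF S(2)] by (simp add: branch_nu_def)
qed

text \<open>Normality comes from the bound \<open>2 * B\<^sup>2\<close>, which is the same for all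
  periods.\<close>

lemma branch_nu_Montel:
  assumes u: "uniform_weight S B" and S: "open S" and x: "\<And>k::nat. branch S (n k) (x k)"
  defines "H \<equiv> \<lambda>k. branch_nu (n k) (x k)"
  obtains g q where "g holomorphic_on S" "strict_mono (q :: nat \<Rightarrow> nat)"
    "\<And>K. compact K \<Longrightarrow> K \<subseteq> S \<Longrightarrow> uniform_limit K (\<lambda>k. H (q k)) g sequentially"
    "\<And>w. w \<in> S \<Longrightarrow> (\<And>k. cmod (H k w) \<le> 1 / Suc k) \<Longrightarrow> g w = 0"
proof -
  have Hhol: "h holomorphic_on S" if "h \<in> range H" for h
    using that branch_nu_holomorphic[OF u x S] by (auto simp: H_def)
  have Hb: "\<exists>b. \<forall>h\<in>range H. \<forall>z\<in>K. cmod (h z) \<le> b" if "compact K" "K \<subseteq> S" for K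
    using branch_nu_eq(4)[OF u x S] that by (intro exI[of _ "2 * B\<^sup>2"]) (auto simp: H_def)
  obtain g q where g: "g holomorphic_on S" "strict_mono (q :: nat \<Rightarrow> nat)"
    "\<And>w. w \<in> S \<Longrightarrow> (\<lambda>k. H (q k) w) \<longlonglongrightarrow> g w"
    "\<And>K. compact K \<Longrightarrow> K \<subseteq> S \<Longrightarrow> uniform_limit K (H \<circ> q) g sequentially"
    using Montel[OF S Hhol Hb subset_refl] by metis
  have "g w = 0" if w: "w \<in> S" and small: "\<And>k. cmod (H k w) \<le> 1 / Suc k" for w
  proof -
    have "(\<lambda>k. H (q k) w) \<longlonglongrightarrow> 0"
    proof (rule Lim_null_comparison)
      show "\<forall>\<^sub>F k in sequentially. cmod (H (q k) w) \<le> 1 / Suc k"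
      proof (rule always_eventually, rule allI)
        fix k
        have "1 / real (Suc (q k)) \<le> 1 / Suc k"
          using seq_suble[OF g(2), of k] by (intro divide_left_mono) auto
        then show "cmod (H (q k) w) \<le> 1 / Suc k" using small[of "q k"] by linarith
      qed
      show "(\<lambda>k. 1 / real (Suc k)) \<longlonglongrightarrow> 0" by (rule LIMSEQ_Suc[OF lim_const_over_n])
    qed
    then show ?thesis using g(3)[OF w] LIMSEQ_unique by blast
  qed
  with g show thesis by (intro that[of g q]) (auto simp: o_def)
qed

section \<open>The Mandelbrot set, and cycles for large parameters\<close>

lemma mandelbrot_iff: "c \<in> mandelbrot \<longleftrightarrow> (\<forall>m. cmod ((quad c ^^ m) 0) \<le> cmod c + 2)"
proof
  assume "\<forall>m. cmod ((quad c ^^ m) 0) \<le> cmod c + 2"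
  then show "c \<in> mandelbrot" by (auto simp: mandelbrot_def bounded_iff)
next
  assume c: "c \<in> mandelbrot"
  then obtain b where b: "\<And>m. cmod ((quad c ^^ m) 0) \<le> b" by (auto simp: mandelbrot_def bounded_iff)
  show "\<forall>m. cmod ((quad c ^^ m) 0) \<le> cmod c + 2"
  proof (rule ccontr)
    assume "\<not> ?thesis"
    then obtain m where m: "cmod c + 2 \<le> cmod ((quad c ^^ m) 0)" by (auto simp: not_le intro: less_imp_le)
    obtain k where k: "2 ^ k > b" using real_arch_pow[of 2 b] by auto
    have "1 \<le> cmod ((quad c ^^ m) 0)" using m norm_ge_zero[of c] by linarith
    then have "2 ^ k * 1 \<le> 2 ^ k * cmod ((quad c ^^ m) 0)" by (intro mult_left_mono) auto
    also have "\<dots> \<le> cmod ((quad c ^^ k) ((quad c ^^ m) 0))" by (rule escape_iter[OF order_refl m norm_ge_zero])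
    also have "\<dots> = cmod ((quad c ^^ (k + m)) 0)" by (simp add: funpow_add)
    also have "\<dots> \<le> b" by (rule b)
    finally show False using k by simp
  qed
qed

lemma closed_mandelbrot: "closed mandelbrot"
proof -
  have eq: "mandelbrot = (\<Inter>m. {c. cmod ((quad c ^^ m) 0) \<le> cmod c + 2})" using mandelbrot_iff by auto
  have "closed {c. cmod ((quad c ^^ m) 0) \<le> cmod c + 2}" for m
    by (intro closed_Collect_le continuous_intros holomorphic_on_imp_continuous_on quad_param_holomorphic)
      (auto intro!: holomorphic_intros)
  then show ?thesis unfolding eq by (intro closed_INT ballI)
qed

text \<open>Near infinity the points of a cycle are close to \<open>\<plusminus>\<close> the square root of \<open>-c\<close>, so that
  \<open>2 c \<nu>\<close> is close to 1.\<close>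

lemma branch_nu_large:
  assumes b: "branch S n x" and S: "open S" "c \<in> S" and c: "cmod c \<ge> 200"
  shows "cmod (branch_nu n x c) \<ge> 1 / (4 * cmod c)"
proof -
  define z where "z j = x j c" for j
  define v where "v j = deriv (x j) c" for j
  have cz: "cyc c n z" using b S(2) by (auto simp: branch_def z_def[abs_def])
  note cc = cycD[OF cz]
  have v: "v (Suc j) = 2 * z j * v j + 1" "v (j + n) = v j" for j
    using branch_variation[OF b S] by (simp_all add: v_def z_def)
  define C where "C = cmod c"
  have C: "C \<ge> 200" using c by (simp add: C_def)
  obtain i where i: "\<And>j. cmod (z j) \<le> cmod (z i)"
    using periodic_bounded_by_max[of n "\<lambda>j. cmod (z j)", OF cc(1)] cc(3) by metis
  define M where "M = cmod (z i)"
  have sq: "(cmod (z j))\<^sup>2 = cmod (z (Suc j) - c)" for j by (simp add: cc(2) norm_power)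
  have M2: "M * M \<le> M + C"
    using sq[of i] norm_triangle_ineq4[of "z (Suc i)" c] i[of "Suc i"] by (simp add: M_def C_def power2_eq_square)
  have M10: "M \<le> C / 10"
  proof (rule ccontr)
    assume "\<not> M \<le> C / 10"
    then have 1: "C < 10 * M" by simp
    then have "M > 20" using C by simp
    then have "20 * M \<le> M * M" by (intro mult_right_mono) auto
    then show False using M2 1 C by linarith
  qed
  have z10: "cmod (z j) \<le> C / 10" for j using i[of j] M10 by (simp add: M_def)
  have z13: "cmod (z j) \<ge> 13" for j
  proof -
    have "C \<le> cmod (z (Suc j) - c) + cmod (z (Suc j))"
      unfolding C_def by (metis norm_minus_commute norm_triangle_sub add.commute)
    then have "13\<^sup>2 \<le> (cmod (z j))\<^sup>2" using sq[of j] z10[of "Suc j"] C by simp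
    then show ?thesis using power2_le_imp_le norm_ge_zero by blast
  qed
  obtain k where k: "\<And>j. cmod (v j) \<le> cmod (v k)" 
    using periodic_bounded_by_max[of n "\<lambda>j. cmod (v j)", OF cc(1)] v(2) by metis
  have vk: "cmod (v k) \<le> 1 / 25"
  proof -
    have "2 * cmod (z k) * cmod (v k) = cmod (v (Suc k) - 1)" by (simp add: v(1) norm_mult)
    also have "\<dots> \<le> cmod (v k) + 1" using norm_triangle_ineq4[of "v (Suc k)" 1] k[of "Suc k"] by simp
    finally have "2 * cmod (z k) * cmod (v k) \<le> cmod (v k) + 1" .
    moreover have "13 * cmod (v k) \<le> cmod (z k) * cmod (v k)" using z13[of k] by (intro mult_right_mono) auto
    ultimately show ?thesis by linarith
  qed
  have v25: "cmod (v j) \<le> 1 / 25" for j using k[of j] vk by linarith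
  have c0: "c \<noteq> 0" using c by auto
  \<comment> \<open>Substituting the orbit and velocity equations turns 2 c v/z into (1 - v')/(1 -
    z'/c), with primes for the next index. Both v' and z'/c are small.\<close>
  have t: "cmod (2 * c * (v j / z j) - 1) \<le> 1 / 2" for j
  proof -
    define w where "w = z (Suc j) / c"
    have "cmod (z (Suc j)) / C \<le> (C / 10) / C" using z10[of "Suc j"] C by (intro divide_right_mono) auto
    then have w: "cmod w \<le> 1 / 10" using C by (simp add: w_def norm_divide C_def[symmetric])
    have w1: "9 / 10 \<le> cmod (1 - w)" using norm_triangle_sub[of 1 w] w by simp
    then have wn: "1 - w \<noteq> 0" by auto
    have zn: "z j \<noteq> 0" using z13[of j] by auto
    have zz: "z j * z j = - c * (1 - w)" using c0 cc(2)[of j] by (simp add: w_def power2_eq_square field_simps)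
    have vv: "v (Suc j) - 1 = 2 * z j * v j" by (simp add: v(1))
    have "2 * c * (v j / z j) = c * (2 * z j * v j) / (z j * z j)" using zn by simp
    also have "\<dots> = (1 - v (Suc j)) / (1 - w)" unfolding zz vv[symmetric] using c0 wn by (simp add: field_simps)
    finally have "2 * c * (v j / z j) - 1 = (w - v (Suc j)) / (1 - w)" using wn by (simp add: field_simps)
    then have "cmod (2 * c * (v j / z j) - 1) = cmod (w - v (Suc j)) / cmod (1 - w)" by (simp add: norm_divide)
    also have "\<dots> \<le> (1 / 10 + 1 / 25) / (9 / 10)"
      using w w1 v25[of "Suc j"] norm_triangle_ineq4[of w "v (Suc j)"] by (intro frac_le) auto
    also have "\<dots> \<le> 1 / 2" by simp
    finally show ?thesis .
  qed
  have n: "n > 0" using cc(1) .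
  have "cmod (\<Sum>j<n. 2 * c * (v j / z j) - 1) \<le> (\<Sum>j<n. 1 / 2)" by (intro sum_norm_le t)
  then have "cmod (2 * c * (\<Sum>j<n. v j / z j) - of_nat n) \<le> n / 2" by (simp add: sum_subtractf sum_distrib_left)
  moreover have "2 * c * (\<Sum>j<n. v j / z j) - of_nat n = of_nat n * (2 * c * branch_nu n x c - 1)"
    using n by (simp add: branch_nu_def v_def z_def field_simps)
  ultimately have "n * cmod (2 * c * branch_nu n x c - 1) \<le> n / 2" by (simp add: norm_mult)
  then have "cmod (2 * c * branch_nu n x c - 1) \<le> 1 / 2" using n by (simp add: field_simps)
  then have "1 / 2 \<le> cmod (2 * c * branch_nu n x c)"
    using norm_triangle_sub[of 1 "2 * c * branch_nu n x c"] by (simp add: norm_minus_commute)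
  then have "1 \<le> 4 * C * cmod (branch_nu n x c)" by (simp add: norm_mult C_def)
  moreover have "C > 0" using C by simp
  ultimately show ?thesis unfolding C_def[symmetric] by (simp add: field_simps)
qed

section \<open>Convexity\<close>

lemma convex_closure_approx:
  fixes P :: "'a::real_normed_vector set"
  assumes "\<And>a b t. a \<in> P \<Longrightarrow> b \<in> P \<Longrightarrow> 0 < t \<Longrightarrow> t < 1 \<Longrightarrow> t *\<^sub>R a + (1 - t) *\<^sub>R b \<in> closure P"
  shows "convex (closure P)"
proof (rule convexI)
  fix x y :: 'a and u v :: real
  assume x: "x \<in> closure P" and y: "y \<in> closure P" and uv: "0 \<le> u" "0 \<le> v" "u + v = 1"
  show "u *\<^sub>R x + v *\<^sub>R y \<in> closure P"
  proof (cases "u = 0 \<or> v = 0")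
    case True
    then show ?thesis using x y uv by auto
  next
    case False
    then have u: "0 < u" "u < 1" "v = 1 - u" using uv by auto
    obtain a b where a: "\<And>n. a n \<in> P" "a \<longlonglongrightarrow> x" and b: "\<And>n. b n \<in> P" "b \<longlonglongrightarrow> y"
      using x y unfolding closure_sequential by metis
    have lim: "(\<lambda>n. u *\<^sub>R a n + v *\<^sub>R b n) \<longlonglongrightarrow> u *\<^sub>R x + v *\<^sub>R y" by (intro tendsto_intros a b)
    have "u *\<^sub>R a n + v *\<^sub>R b n \<in> closure P" for n using assms[OF a(1) b(1) u(1,2)] u(3) by simp
    then show ?thesis using lim by (rule closed_sequentially[OF closed_closure])
  qed
qed

lemma mixed_orbit_pair:
  assumes Q: "Q1 \<in> repelling_orbits c" "Q2 \<in> repelling_orbits c" "Q1 \<noteq> Q2"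
    and ex: "\<not> (c = -2 \<and> Q1 = {2})" "\<not> (c = -2 \<and> Q2 = {2})"
    and t: "0 < t" "t < 1" and e: "e > 0"
  obtains R where "R \<in> repelling_orbits c" "m \<le> card R"
    "cmod (nu c R c - (of_real t * nu c Q1 c + of_real (1 - t) * nu c Q2 c)) < e"
proof -
  define Q where "Q \<sigma> = (if \<sigma> then Q1 else Q2)" for \<sigma>
  define T where "T \<sigma> = (if \<sigma> then t else 1 - t)" for \<sigma>
  have "\<exists>R\<in>repelling_orbits c. m \<le> card R \<and>
    cmod (nu c R c - (of_real (T True) * nu c (Q True) c + of_real (T False) * nu c (Q False) c)) < e"
    by (rule mixed_orbit) (use assms in \<open>auto simp: Q_def T_def\<close>)
  then show thesis using that by (auto simp: Q_def T_def)
qed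

text \<open>The family \<open>F\<close> may lack some fixed points. Mixed orbits can be taken with
  at least two points, so they stay in \<open>F\<close> even when the exceptional fixed point has
  been removed.\<close>

lemma convex_closure_nu:
  assumes F: "F \<subseteq> repelling_orbits c" "\<And>R. R \<in> repelling_orbits c \<Longrightarrow> card R \<ge> 2 \<Longrightarrow> R \<in> F"
    and ex: "\<not> (c = -2 \<and> {2} \<in> F)"
  shows "convex (closure ((\<lambda>Q. nu c Q c) ` F))"
proof (rule convex_closure_approx)
  fix a b and t :: real
  assume a: "a \<in> (\<lambda>Q. nu c Q c) ` F" and b: "b \<in> (\<lambda>Q. nu c Q c) ` F" and t: "0 < t" "t < 1"
  obtain Q1 Q2 where Q: "Q1 \<in> F" "a = nu c Q1 c" "Q2 \<in> F" "b = nu c Q2 c" using a b by blast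
  show "t *\<^sub>R a + (1 - t) *\<^sub>R b \<in> closure ((\<lambda>Q. nu c Q c) ` F)"
  proof (cases "Q1 = Q2")
    case True
    then have "t *\<^sub>R a + (1 - t) *\<^sub>R b = a" using Q by (simp add: scaleR_left_distrib[symmetric])
    then show ?thesis using a closure_subset[of "(\<lambda>Q. nu c Q c) ` F"] by (metis subsetD)
  next
    case False
    show ?thesis
      unfolding closure_approachable
    proof (intro allI impI)
      fix e :: real assume e: "e > 0"
      have ex1: "\<not> (c = -2 \<and> Q1 = {2})" "\<not> (c = -2 \<and> Q2 = {2})" using ex Q by auto
      obtain R where R: "R \<in> repelling_orbits c" "2 \<le> card R"
        "cmod (nu c R c - (of_real t * nu c Q1 c + of_real (1 - t) * nu c Q2 c)) < e"
        using mixed_orbit_pair[OF _ _ False ex1 t e] Q F by blast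
      have "nu c R c \<in> (\<lambda>Q. nu c Q c) ` F" using F(2) R by blast
      moreover have "dist (nu c R c) (t *\<^sub>R a + (1 - t) *\<^sub>R b) < e"
        using R(3) unfolding Q(2,4) dist_norm scaleR_conv_of_real .
      ultimately show "\<exists>y\<in>(\<lambda>Q. nu c Q c) ` F. dist y (t *\<^sub>R a + (1 - t) *\<^sub>R b) < e" by blast
    qed
  qed
qed

lemma Y_set_image: "Y_set c = closure ((\<lambda>Q. nu c Q c) ` repelling_orbits c)"
  unfolding Y_set_def by (simp add: Setcompr_eq_image)

lemma minus_two_fixed_point: "{2} \<in> repelling_orbits (-2)" "nu (-2) {2} (-2) = - 1 / 6"
proof -
  have c: "cyc (-2) 1 (\<lambda>_. 2)" by (simp add: cyc_def)
  have w: "weight (\<lambda>_. 2) (\<lambda>_. 1) 1" by (simp add: weight_def)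
  have r: "range (\<lambda>_::nat. 2::complex) = {2}" by auto
  show "{2} \<in> repelling_orbits (-2)" using weight_repelling[OF c w] r by simp
  show "nu (-2) {2} (-2) = - 1 / 6"
    using nu_formula(2)[OF c w, of "\<lambda>_. - 1 / 3"] r by simp
qed

lemma minus_two_mandelbrot: "-2 \<in> mandelbrot"
proof -
  have "(quad (-2) ^^ Suc (Suc m)) 0 = 2" for m by (induction m) (auto simp: quad_def)
  then have "cmod ((quad (-2) ^^ m) 0) \<le> cmod (-2) + 2" for m
    by (cases m rule: nat.exhaust; cases "m - 1") (auto simp: quad_def)
  then show ?thesis by (simp add: mandelbrot_iff)
qed

text \<open>Ensures two distinct fixed points for every parameter outside the Mandelbrot set, as 1/4
  is the only parameter where they coincide.\<close>

lemma quarter_mandelbrot: "1/4 \<in> mandelbrot"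
proof -
  have bd: "cmod ((quad (1/4) ^^ m) 0) \<le> 1 / 2" for m
  proof (induction m)
    case (Suc m)
    let ?z = "(quad (1/4) ^^ m) 0"
    have "cmod (?z\<^sup>2 + 1/4) \<le> (cmod ?z)\<^sup>2 + 1/4" using norm_triangle_ineq[of "?z\<^sup>2" "1/4"] by (simp add: norm_power)
    also have "(cmod ?z)\<^sup>2 \<le> (1/2)\<^sup>2" using Suc by (intro power_mono) auto
    finally have "cmod (?z\<^sup>2 + 1/4) \<le> 1 / 2" by (simp add: power2_eq_square)
    then show ?case by (simp add: quad_def[of _ ?z])
  qed simp
  show ?thesis
    unfolding mandelbrot_iff
  proof
    fix m
    show "cmod ((quad (1/4) ^^ m) 0) \<le> cmod (1/4) + 2" using bd[of m] norm_ge_zero[of "1/4::complex"] by linarith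
  qed
qed

section \<open>Limits of the functions nu do not vanish identically\<close>

lemma repelling_branch:
  assumes u: "uniform_weight (ball c0 d) B" and d: "d \<le> 1 / (16 * B\<^sup>2)" and c: "c \<in> ball c0 d" and Q: "periodic_orbit c Q"
  obtains x where "branch (ball c0 d) (card Q) x" "range (\<lambda>j. x j c) = Q"
    "\<And>y. y \<in> ball c0 d \<Longrightarrow> card (range (\<lambda>j. x j y)) = card Q"
proof -
  obtain z where z: "cyc c (card Q) z" "Q = range z" by (rule periodic_orbit_obtain[OF Q])
  obtain x where x: "branch (ball c0 d) (card Q) x" "\<And>j. x j c = z j"
    "\<And>y. y \<in> ball c0 d \<Longrightarrow> card (range (\<lambda>j. x j y)) = card (range z)"
    using branch_ex[OF u d c z(1)] by blast
  show thesis
  proof (rule that[of x])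
    show "range (\<lambda>j. x j c) = Q" using x(2) z(2) by simp
    show "card (range (\<lambda>j. x j y)) = card Q" if "y \<in> ball c0 d" for y
      using x(3)[OF that] by (simp only: z(2)[symmetric])
  qed (rule x(1))
qed

text \<open>The germs of \<open>\<nu>\<close> cannot degenerate to the zero germ: the set of parameters where they do
  is bounded, open, and closed outside the Mandelbrot set, which has no holes by the
  maximum principle.\<close>

definition degenerate :: "complex \<Rightarrow> bool" where
  "degenerate c \<longleftrightarrow> c \<notin> mandelbrot \<and> (\<exists>r>0. \<forall>e>0. \<exists>n x. branch (ball c r) n x \<and> (\<forall>y\<in>ball c r. cmod (branch_nu n x y) \<le> e))"

lemma degenerate_open: "open {c. degenerate c}"
  unfolding open_contains_ball
proof
  fix c assume "c \<in> {c. degenerate c}"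
  then obtain r where c: "c \<notin> mandelbrot" and r: "r > 0"
    "\<And>e. e > 0 \<Longrightarrow> \<exists>n x. branch (ball c r) n x \<and> (\<forall>y\<in>ball c r. cmod (branch_nu n x y) \<le> e)"
    unfolding degenerate_def by auto
  obtain s where s: "s > 0" "ball c s \<subseteq> - mandelbrot"
    using c closed_mandelbrot open_contains_ball unfolding closed_def by blast
  show "\<exists>e>0. ball c e \<subseteq> {c. degenerate c}"
  proof (intro exI[of _ "min s (r / 2)"] conjI subsetI)
    fix w assume w: "w \<in> ball c (min s (r / 2))"
    have sub: "ball w (r / 2) \<subseteq> ball c r"
    proof
      fix y assume "y \<in> ball w (r / 2)"
      then show "y \<in> ball c r" using w dist_triangle[of c y w] by simp
    qed
    have "\<exists>n x. branch (ball w (r / 2)) n x \<and> (\<forall>y\<in>ball w (r / 2). cmod (branch_nu n x y) \<le> e)" if "e > 0" for e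
      using r(2)[OF that] branch_subset sub by blast
    moreover have "w \<notin> mandelbrot" using w s(2) by auto
    ultimately show "w \<in> {c. degenerate c}" using r(1) unfolding degenerate_def by (auto intro!: exI[of _ "r / 2"])
  qed (use r s in auto)
qed

text \<open>A degenerate \<open>c1\<close> near \<open>c\<close> yields branches with small values
  on a small disc. They extend to the disc about \<open>c\<close> given by uniform expansion; a
  limit of the extended functions vanishes near \<open>c1\<close>, hence everywhere, and so the
  values are also small near \<open>c\<close>.\<close>

lemma degenerate_closed:
  assumes c: "c \<in> closure {c. degenerate c}" "c \<notin> mandelbrot"
  shows "degenerate c"
proof -
  obtain d B where d: "d > 0" "uniform_weight (ball c d) B" "d \<le> 1 / (16 * B\<^sup>2)"
    using hyperbolic_outside_mandelbrot[OF c(2)] by metis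
  define S where "S = ball c d"
  obtain c1 where c1: "degenerate c1" "dist c1 c < d / 2"
    using c(1) d(1) unfolding closure_approachable by (metis half_gt_zero mem_Collect_eq)
  have c1S: "c1 \<in> S" using c1 d by (simp add: S_def dist_commute)
  obtain r where r: "r > 0" "\<And>e. e > 0 \<Longrightarrow> \<exists>n x. branch (ball c1 r) n x \<and> (\<forall>y\<in>ball c1 r. cmod (branch_nu n x y) \<le> e)"
    using c1(1) unfolding degenerate_def by blast
  define s where "s = min r (d / 2)"
  have s: "s > 0" using r d by (simp add: s_def)
  have sS: "ball c1 s \<subseteq> S"
  proof
    fix y assume "y \<in> ball c1 s"
    then show "y \<in> S" using c1(2) dist_triangle[of c y c1] by (simp add: S_def s_def dist_commute)
  qed
  \<comment> \<open>The given branch lives only on a disc about \<open>c1\<close>. Its cycle at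
    \<open>c1\<close> is continued over \<open>S\<close>, and by uniqueness the continuation agrees
    with it on the small disc.\<close>
  have "\<exists>n y. branch S n y \<and> (\<forall>w\<in>ball c1 s. cmod (branch_nu n y w) \<le> e)" if e: "e > 0" for e
  proof -
    obtain n x where x: "branch (ball c1 r) n x" "\<And>y. y \<in> ball c1 r \<Longrightarrow> cmod (branch_nu n x y) \<le> e"
      using r(2)[OF e] by blast
    have xs: "branch (ball c1 s) n x" by (rule branch_subset[OF x(1)]) (auto simp: s_def)
    have c1s: "c1 \<in> ball c1 s" using s by simp
    then have "cyc c1 n (\<lambda>j. x j c1)" using xs by (auto simp: branch_def)
    then obtain y where y: "branch S n y" "\<And>j. y j c1 = x j c1"
      using branch_ex[OF d(2,3) c1S[unfolded S_def]] unfolding S_def by metis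
    have ys: "branch (ball c1 s) n y" by (rule branch_subset[OF y(1) sS])
    have us: "uniform_weight (ball c1 s) B" using uniform_weight_subset[OF d(2)] sS by (simp add: S_def)
    have yx: "y j w = x j w" if "w \<in> ball c1 s" for j w
      by (rule branch_unique[OF us ys xs open_ball connected_ball c1s y(2) that])
    have "cmod (branch_nu n y w) \<le> e" if "w \<in> ball c1 s" for w
      using branch_nu_cong[OF open_ball that yx] x(2)[of w] that by (simp add: s_def)
    then show ?thesis using y(1) by blast
  qed
  then have "\<exists>n y. branch S n y \<and> (\<forall>w\<in>ball c1 s. cmod (branch_nu n y w) \<le> 1 / Suc k)" for k by simp
  then obtain n y where y: "\<And>k. branch S (n k) (y k)" "\<And>k w. w \<in> ball c1 s \<Longrightarrow> cmod (branch_nu (n k) (y k) w) \<le> 1 / Suc k"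
    by metis
  define H where "H k = branch_nu (n k) (y k)" for k
  have oS: "open S" by (simp add: S_def)
  have uS: "uniform_weight S B" using d(2) by (simp add: S_def)
  obtain g q where g: "g holomorphic_on S" "strict_mono (q :: nat \<Rightarrow> nat)"
    "\<And>K. compact K \<Longrightarrow> K \<subseteq> S \<Longrightarrow> uniform_limit K (\<lambda>k. H (q k)) g sequentially"
    "\<And>w. w \<in> S \<Longrightarrow> (\<And>k. cmod (H k w) \<le> 1 / Suc k) \<Longrightarrow> g w = 0"
  proof (rule branch_nu_Montel[where n=n and x=y, OF uS oS y(1), folded H_def])
    fix g q
    assume "g holomorphic_on S" "strict_mono (q :: nat \<Rightarrow> nat)"
      "\<And>K. compact K \<Longrightarrow> K \<subseteq> S \<Longrightarrow> uniform_limit K (\<lambda>k. H (q k)) g sequentially"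
      "\<And>w. w \<in> S \<Longrightarrow> (\<And>k. cmod (H k w) \<le> 1 / Suc k) \<Longrightarrow> g w = 0"
    then show thesis by (rule that[of g q])
  qed
  have g0: "g w = 0" if "w \<in> ball c1 s" for w
    by (rule g(4)) (use sS that y(2)[OF that] in \<open>auto simp: H_def\<close>)
  have gS: "g w = 0" if "w \<in> S" for w
    by (rule analytic_continuation_open[of "ball c1 s" S g "\<lambda>_. 0"]) (use s sS g(1) g0 that in \<open>auto simp: S_def\<close>)
  have ul: "uniform_limit (cball c (d / 2)) (\<lambda>k. H (q k)) g sequentially"
    by (rule g(3)) (use d in \<open>auto simp: S_def\<close>)
  show ?thesis
    unfolding degenerate_def
  proof (intro conjI exI[of _ "d / 2"] allI impI)
    fix e :: real assume e: "e > 0"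
    have "\<forall>\<^sub>F k in sequentially. \<forall>w\<in>cball c (d / 2). dist (H (q k) w) (g w) < e"
      using uniform_limitD[OF ul e] .
    then obtain k where k: "\<And>w. w \<in> cball c (d / 2) \<Longrightarrow> dist (H (q k) w) (g w) < e"
      using eventually_happens trivial_limit_sequentially by fastforce
    have "branch (ball c (d / 2)) (n (q k)) (y (q k))" by (rule branch_subset[OF y(1)]) (use d in \<open>auto simp: S_def\<close>)
    moreover have "cmod (branch_nu (n (q k)) (y (q k)) w) \<le> e" if "w \<in> ball c (d / 2)" for w
      using k[of w] gS[of w] that d by (simp add: H_def S_def)
    ultimately show "\<exists>n x. branch (ball c (d / 2)) n x \<and> (\<forall>y\<in>ball c (d / 2). cmod (branch_nu n x y) \<le> e)" by blast
  qed (use c d in auto)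
qed

lemma degenerate_bounded: "degenerate c \<Longrightarrow> cmod c < 200"
proof (rule ccontr)
  assume c: "degenerate c" "\<not> cmod c < 200"
  then have pos: "cmod c > 0" by linarith
  then have "1 / (8 * cmod c) > 0" by simp
  with c(1) obtain r n x where r: "r > 0" "branch (ball c r) n x" "\<And>y. y \<in> ball c r \<Longrightarrow> cmod (branch_nu n x y) \<le> 1 / (8 * cmod c)"
    unfolding degenerate_def by blast
  have "1 / (4 * cmod c) \<le> cmod (branch_nu n x c)" by (rule branch_nu_large[OF r(2) open_ball]) (use r(1) c(2) in auto)
  also have "\<dots> \<le> 1 / (8 * cmod c)" by (rule r(3)) (use r in simp)
  finally show False using pos by (simp add: field_simps)
qed

lemma not_degenerate: "\<not> degenerate a"
proof
  assume a: "degenerate a"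
  define A where "A = {c. degenerate c}"
  have A200: "A \<subseteq> cball 0 200"
  proof
    fix c assume "c \<in> A"
    then have "cmod c < 200" using degenerate_bounded by (simp add: A_def)
    then show "c \<in> cball 0 200" by simp
  qed
  then have bA: "bounded A" using bounded_cball bounded_subset by blast
  \<comment> \<open>The critical orbit is holomorphic in the parameter and bounded on the boundary
    of \<open>A\<close>, which lies in the Mandelbrot set, by 200 + 2. The bound inside puts
    \<open>a\<close> into the Mandelbrot set.\<close>
  have "cmod ((quad a ^^ m) 0) \<le> 202" for m
  proof (rule maximum_modulus_frontier[of "\<lambda>c. (quad c ^^ m) 0" A])
    show "(\<lambda>c. (quad c ^^ m) 0) holomorphic_on interior A" by (intro quad_param_holomorphic holomorphic_intros)
    show "continuous_on (closure A) (\<lambda>c. (quad c ^^ m) 0)"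
      by (intro holomorphic_on_imp_continuous_on quad_param_holomorphic holomorphic_intros)
    show "bounded A" by (rule bA)
    show "a \<in> A" using a by (simp add: A_def)
    fix c assume "c \<in> frontier A"
    then have cl: "c \<in> closure A" and "c \<notin> interior A" by (auto simp: frontier_def)
    then have "c \<notin> A" using degenerate_open by (simp add: A_def interior_open)
    then have "c \<in> mandelbrot" using degenerate_closed[of c] cl by (auto simp: A_def)
    then have 1: "cmod ((quad c ^^ m) 0) \<le> cmod c + 2" by (simp add: mandelbrot_iff)
    have "closure A \<subseteq> cball 0 200" using A200 by (simp add: closure_minimal)
    then show "cmod ((quad c ^^ m) 0) \<le> 202" using 1 cl by auto
  qed
  then have "a \<in> mandelbrot" unfolding mandelbrot_def bounded_iff by blast
  then show False using a by (simp add: degenerate_def)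
qed

section \<open>Accumulation of critical points\<close>

text \<open>A single short cycle may realise a small value. Mixing it with a little of a second
  cycle, one of the two fixed points, gives long cycles whose values are still small.\<close>

lemma small_nu_long_orbit:
  assumes c: "c0 \<notin> mandelbrot" and Y: "0 \<in> Y_set c0" and e: "e > 0"
  obtains Q where "Q \<in> repelling_orbits c0" "m \<le> card Q" "cmod (nu c0 Q c0) < e"
proof -
  obtain d B where d: "d > 0" "uniform_weight (ball c0 d) B" using hyperbolic_outside_mandelbrot[OF c] by metis
  have fixed: "{p} \<in> repelling_orbits c0" if p: "p\<^sup>2 + c0 = p" for p
  proof -
    have cy: "cyc c0 1 (\<lambda>_. p)" using p by (simp add: cyc_def)
    then obtain \<beta> where "weight (\<lambda>_. p) \<beta> B" "\<And>j. \<beta> (j + 1) = \<beta> j"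
      using d centre_in_ball unfolding uniform_weight_def by blast
    from weight_repelling[OF cy this] show ?thesis by (simp add: image_constant_conv)
  qed
  define s where "s = csqrt (1 - 4 * c0)"
  have s0: "s \<noteq> 0"
  proof
    assume "s = 0"
    then have "c0 = 1 / 4" by (simp add: s_def field_simps)
    then show False using c quarter_mandelbrot by blast
  qed
  have s2: "s\<^sup>2 = 1 - 4 * c0" by (simp add: s_def)
  have sq: "((1 + s) / 2)\<^sup>2 = (1 + 2 * s + s\<^sup>2) / 4" "((1 - s) / 2)\<^sup>2 = (1 - 2 * s + s\<^sup>2) / 4"
    by (simp_all add: power2_eq_square field_simps)
  have "((1 + s) / 2)\<^sup>2 + c0 = (1 + s) / 2" "((1 - s) / 2)\<^sup>2 + c0 = (1 - s) / 2"
    unfolding sq s2 by (simp_all add: field_simps)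
  then have two: "{(1 + s) / 2} \<in> repelling_orbits c0" "{(1 - s) / 2} \<in> repelling_orbits c0"
    using fixed by blast+
  have "(1 + s) / 2 \<noteq> (1 - s) / 2" using s0 by (simp add: field_simps)
  have "\<exists>y\<in>(\<lambda>Q. nu c0 Q c0) ` repelling_orbits c0. dist y 0 < e / 2"
    using Y half_gt_zero[OF e] unfolding Y_set_image closure_approachable by blast
  then obtain Q1 where Q1: "Q1 \<in> repelling_orbits c0" "cmod (nu c0 Q1 c0) < e / 2" by (auto simp: dist_norm)
  obtain Q2 where Q2: "Q2 \<in> repelling_orbits c0" "Q1 \<noteq> Q2"
    using two \<open>(1 + s) / 2 \<noteq> (1 - s) / 2\<close> by (metis singleton_inject)
  have ex: "\<not> (c0 = -2 \<and> Q = {2})" for Q :: "complex set" using c minus_two_mandelbrot by auto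
  define b where "b = cmod (nu c0 Q2 c0)"
  \<comment> \<open>The proportion of the second cycle, small enough for its contribution to stay
    within \<open>e / 4\<close>.\<close>
  define t where "t = min (1 / 2) (e / (4 * (b + 1)))"
  have b: "b \<ge> 0" by (simp add: b_def)
  have t: "0 < 1 - t" "1 - t < 1" "0 < t" using e b by (auto simp: t_def min_def)
  have tb: "t * b \<le> e / 4"
  proof -
    have "t * b \<le> e / (4 * (b + 1)) * (b + 1)" using b e by (intro mult_mono) (auto simp: t_def)
    also have "\<dots> = e / 4" using b by (simp add: divide_simps)
    finally show ?thesis .
  qed
  have "e / 4 > 0" using e by simp
  then obtain R where R: "R \<in> repelling_orbits c0" "m \<le> card R"
    "cmod (nu c0 R c0 - (of_real (1 - t) * nu c0 Q1 c0 + of_real (1 - (1 - t)) * nu c0 Q2 c0)) < e / 4"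
    by (rule mixed_orbit_pair[OF Q1(1) Q2 ex ex t(1,2)])
  have "cmod (of_real (1 - t) * nu c0 Q1 c0 + of_real (1 - (1 - t)) * nu c0 Q2 c0) \<le> (1 - t) * cmod (nu c0 Q1 c0) + t * b"
  proof -
    have "cmod (of_real (1 - t) * nu c0 Q1 c0) = (1 - t) * cmod (nu c0 Q1 c0)" "cmod (of_real (1 - (1 - t)) * nu c0 Q2 c0) = t * b"
      unfolding norm_mult norm_of_real b_def using t by auto
    then show ?thesis by (metis norm_triangle_ineq)
  qed
  also have "(1 - t) * cmod (nu c0 Q1 c0) \<le> 1 * cmod (nu c0 Q1 c0)" using t by (intro mult_right_mono) auto
  finally have "cmod (of_real (1 - t) * nu c0 Q1 c0 + of_real (1 - (1 - t)) * nu c0 Q2 c0) \<le> e / 2 + e / 4" using Q1(2) tb by simp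
  then have "cmod (nu c0 R c0) < e"
    using R(3) norm_triangle_sub[of "nu c0 R c0" "of_real (1 - t) * nu c0 Q1 c0 + of_real (1 - (1 - t)) * nu c0 Q2 c0"] by linarith
  with R show thesis by (intro that[of R])
qed

text \<open>Branches of growing period with values tending to 0 at \<open>c0\<close> have a limit
  function with a zero there that is not identically zero; Hurwitz's theorem moves the zero to
  nearby parameters, where the multiplier is then critical.\<close>

lemma accumulation_if:
  assumes c: "c0 \<notin> mandelbrot" and Y: "0 \<in> Y_set c0"
  shows "c0 \<in> X_accum"
proof -
  obtain d B where d: "d > 0" "uniform_weight (ball c0 d) B" "d \<le> 1 / (16 * B\<^sup>2)" using hyperbolic_outside_mandelbrot[OF c] by metis
  define S where "S = ball c0 d"
  have uS: "uniform_weight S B" and oS: "open S" and c0S: "c0 \<in> S" using d by (auto simp: S_def)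
  have "\<exists>n x. branch S n x \<and> cmod (branch_nu n x c0) < 1 / Suc k \<and> (\<forall>y\<in>S. k \<le> card (range (\<lambda>j. x j y)))" for k
  proof -
    have "1 / real (Suc k) > 0" by simp
    then obtain Q where Q: "Q \<in> repelling_orbits c0" "k \<le> card Q" "cmod (nu c0 Q c0) < 1 / Suc k"
      by (rule small_nu_long_orbit[OF c Y])
    have po: "periodic_orbit c0 Q" using Q(1) by (simp add: repelling_orbits_def)
    obtain x where x: "branch S (card Q) x" "range (\<lambda>j. x j c0) = Q" "\<And>y. y \<in> S \<Longrightarrow> card (range (\<lambda>j. x j y)) = card Q"
      using repelling_branch[OF d(2,3) c0S[unfolded S_def] po] unfolding S_def by metis
    have "nu c0 Q c0 = branch_nu (card Q) x c0" using branch_nu_eq(3)[OF uS x(1) oS c0S] unfolding x(2) .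
    then show ?thesis using x(1,3) Q(2,3) by (metis)
  qed
  then obtain n x where x: "\<And>k. branch S (n k) (x k)" "\<And>k. cmod (branch_nu (n k) (x k) c0) < 1 / Suc k"
    "\<And>k y. y \<in> S \<Longrightarrow> k \<le> card (range (\<lambda>j. x k j y))" by metis
  define H where "H k = branch_nu (n k) (x k)" for k
  obtain g q where g: "g holomorphic_on S" "strict_mono (q :: nat \<Rightarrow> nat)"
    "\<And>K. compact K \<Longrightarrow> K \<subseteq> S \<Longrightarrow> uniform_limit K (\<lambda>k. H (q k)) g sequentially"
    "\<And>w. w \<in> S \<Longrightarrow> (\<And>k. cmod (H k w) \<le> 1 / Suc k) \<Longrightarrow> g w = 0"
  proof (rule branch_nu_Montel[where n=n and x=x, OF uS oS x(1), folded H_def])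
    fix g q
    assume "g holomorphic_on S" "strict_mono (q :: nat \<Rightarrow> nat)"
      "\<And>K. compact K \<Longrightarrow> K \<subseteq> S \<Longrightarrow> uniform_limit K (\<lambda>k. H (q k)) g sequentially"
      "\<And>w. w \<in> S \<Longrightarrow> (\<And>k. cmod (H k w) \<le> 1 / Suc k) \<Longrightarrow> g w = 0"
    then show thesis by (rule that[of g q])
  qed
  have qk: "k \<le> q k" for k by (rule seq_suble[OF g(2)])
  have g0: "g c0 = 0" by (rule g(4)[OF c0S]) (use x(2) less_imp_le in \<open>auto simp: H_def\<close>)
  have nonconst: "\<not> g constant_on ball c0 r" if r: "r > 0" "r \<le> d" for r
  proof
    assume "g constant_on ball c0 r"
    then have gr: "g w = 0" if "w \<in> ball c0 r" for w
      using g0 r(1) that unfolding constant_on_def by (metis centre_in_ball)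
    have "degenerate c0"
      unfolding degenerate_def
    proof (intro conjI exI[of _ "r / 2"] allI impI)
      fix e :: real assume e: "e > 0"
      have ul: "uniform_limit (cball c0 (r / 2)) (\<lambda>k. H (q k)) g sequentially"
        by (rule g(3)) (use r in \<open>auto simp: S_def\<close>)
      have "\<forall>\<^sub>F k in sequentially. \<forall>w\<in>cball c0 (r / 2). dist (H (q k) w) (g w) < e"
        using uniform_limitD[OF ul e] .
      then obtain k where k: "\<And>w. w \<in> cball c0 (r / 2) \<Longrightarrow> dist (H (q k) w) (g w) < e"
        using eventually_happens trivial_limit_sequentially by fastforce
      have "branch (ball c0 (r / 2)) (n (q k)) (x (q k))"
        by (rule branch_subset[OF x(1)]) (use r in \<open>auto simp: S_def\<close>)
      moreover have "cmod (branch_nu (n (q k)) (x (q k)) w) \<le> e" if "w \<in> ball c0 (r / 2)" for w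
        using k[of w] gr[of w] that r by (simp add: H_def)
      ultimately show "\<exists>n x. branch (ball c0 (r / 2)) n x \<and> (\<forall>y\<in>ball c0 (r / 2). cmod (branch_nu n x y) \<le> e)" by blast
    qed (use c r in auto)
    then show False using not_degenerate by blast
  qed
  have zero: "\<exists>y\<in>ball c0 r. \<exists>k\<ge>m. H k y = 0" if r: "r > 0" "r \<le> d" for r m
  proof (rule ccontr)
    assume none: "\<not> ?thesis"
    have sub: "ball c0 r \<subseteq> S" using r by (auto simp: S_def)
    have "g c0 \<noteq> 0"
    \<comment> \<open>The shift by \<open>m\<close> restricts to late members of the sequence,
      because \<open>q (k + m) \<ge> m\<close>; their cycles have at least \<open>m\<close>
      points.\<close>
    proof (rule Hurwitz_no_zeros[of "ball c0 r" "\<lambda>k. H (q (k + m))" g c0])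
      show "H (q (k + m)) holomorphic_on ball c0 r" for k
        unfolding H_def using branch_nu_holomorphic[OF uS x(1) oS] sub holomorphic_on_subset by blast
      show "g holomorphic_on ball c0 r" using g(1) sub holomorphic_on_subset by blast
      show "uniform_limit K (\<lambda>k. H (q (k + m))) g sequentially" if K: "compact K" "K \<subseteq> ball c0 r" for K
      proof -
        have "uniform_limit K (\<lambda>k. H (q k)) g sequentially" using g(3) K sub by blast
        then show ?thesis by (rule filterlim_compose[OF _ filterlim_add_const_nat_at_top])
      qed
      show "\<not> g constant_on ball c0 r" by (rule nonconst[OF r])
      show "H (q (k + m)) y \<noteq> 0" if "y \<in> ball c0 r" for k y
        using none that qk[of "k + m"] by (metis le_trans le_add2)
    qed (use r in auto)
    then show False using g0 by simp
  qed
  show ?thesis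
    unfolding X_accum_def
  proof (rule INT_I)
    fix m :: nat assume m: "m \<in> {1..}"
    show "c0 \<in> closure (\<Union>n\<in>{m..}. critical_params n)"
      unfolding closure_approachable
    proof (intro allI impI)
      fix e :: real assume e: "e > 0"
      obtain y k where y: "y \<in> ball c0 (min e d)" "k \<ge> m" "H k y = 0" using zero[of "min e d" m] e d(1) by auto
      have yS: "y \<in> S" using y(1) by (simp add: S_def)
      define Q where "Q = range (\<lambda>j. x k j y)"
      note bn = branch_nu_eq[OF uS x(1) oS yS, of k, folded Q_def]
      have card: "m \<le> card Q" using x(3)[OF yS, of k] y(2) by (simp add: Q_def)
      have "deriv (rho y Q) y = 0"
      proof -
        have "nu y Q y = 0" using bn(3) y(3) by (simp add: H_def)
        moreover have "card Q \<noteq> 0" using card m by auto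
        ultimately show ?thesis using bn(2) by (simp add: nu_def)
      qed
      moreover have "periodic_orbit y Q" "multiplier y Q \<noteq> 1" using bn(1) by (auto simp: repelling_orbits_def)
      ultimately have "y \<in> critical_params (card Q)" by (auto simp: critical_params_def)
      then have "y \<in> (\<Union>n\<in>{m..}. critical_params n)" using card by blast
      moreover have "dist y c0 < e" using y(1) by (simp add: dist_commute)
      ultimately show "\<exists>y\<in>\<Union>n\<in>{m..}. critical_params n. dist y c0 < e" by blast
    qed
  qed
qed

text \<open>A critical parameter near \<open>c0\<close> is a zero of a function
  \<open>branch_nu\<close> on the common disc. Such functions have uniformly bounded derivatives
  near \<open>c0\<close>, so the value at \<open>c0\<close> is small.\<close>

lemma accumulation_only_if:
  assumes c: "c0 \<notin> mandelbrot" and X: "c0 \<in> X_accum"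
  shows "0 \<in> Y_set c0"
proof -
  obtain d B where d: "d > 0" "uniform_weight (ball c0 d) B" "d \<le> 1 / (16 * B\<^sup>2)" using hyperbolic_outside_mandelbrot[OF c] by metis
  define S where "S = ball c0 d"
  have uS: "uniform_weight S B" and oS: "open S" and c0S: "c0 \<in> S" using d by (auto simp: S_def)
  \<comment> \<open>The added 1 makes the bound strict, so that division by \<open>C\<close> maps
    into the open unit disc and \<open>cmetric_bound_aux\<close> serves as the Cauchy
    estimate.\<close>
  define C where "C = 2 * B\<^sup>2 + 1"
  have C: "C > 0" by (simp add: C_def add_nonneg_pos)
  show ?thesis
    unfolding Y_set_image closure_approachable
  proof (intro allI impI)
    fix e :: real assume e: "e > 0"
    \<comment> \<open>With derivative at most \<open>4 * C / d\<close>, a distance below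
      \<open>e * d / (8 * C)\<close> changes the value by at most \<open>e / 2\<close>.\<close>
    define r where "r = min (d / 2) (e * d / (8 * C))"
    have r: "r > 0" "r \<le> d / 2" "r \<le> e * d / (8 * C)" using d e C by (auto simp: r_def)
    have "c0 \<in> closure (\<Union>n\<in>{1..}. critical_params n)" using X unfolding X_accum_def by blast
    then obtain y where y: "y \<in> (\<Union>n\<in>{1..}. critical_params n)" "dist y c0 < r"
      using r(1) unfolding closure_approachable by blast
    then obtain Q where Q: "periodic_orbit y Q" "deriv (rho y Q) y = 0" by (auto simp: critical_params_def)
    have yS: "y \<in> S" using y(2) r(2) d(1) by (simp add: S_def dist_commute)
    obtain x where x: "branch S (card Q) x" "range (\<lambda>j. x j y) = Q"
      using repelling_branch[OF d(2,3) yS[unfolded S_def] Q(1)] unfolding S_def by metis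
    define H where "H = branch_nu (card Q) x"
    have Hy: "H y = 0"
      using branch_nu_eq(3)[OF uS x(1) oS yS] Q(2) unfolding x(2) by (simp add: nu_def H_def)
    have hol: "H holomorphic_on S" unfolding H_def by (rule branch_nu_holomorphic[OF uS x(1) oS])
    have HC: "cmod (H w) < C" if "w \<in> S" for w
      using branch_nu_eq(4)[OF uS x(1) oS that] by (simp add: H_def C_def)
    have der: "cmod (deriv H w) \<le> 4 * C / d" if w: "w \<in> ball c0 (d / 2)" for w
    proof -
      have wS: "w \<in> S" using w d by (simp add: S_def)
      have "cmod (deriv (\<lambda>w. H w / of_real C) w) \<le> 2 / (d / 2)"
      proof (rule cmetric_bound_aux)
        show "(\<lambda>w. H w / of_real C) holomorphic_on S" using hol C by (intro holomorphic_intros) auto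
        show "(\<lambda>w. H w / of_real C) ` S \<subseteq> ball 0 1" using HC C by (auto simp: norm_divide)
        show "ball w (d / 2) \<subseteq> S"
        proof
          fix a assume "a \<in> ball w (d / 2)"
          then show "a \<in> S" using w dist_triangle[of c0 a w] by (simp add: S_def)
        qed
      qed (use d in simp)
      moreover have "deriv (\<lambda>w. H w / of_real C) w = deriv H w / of_real C"
        by (rule DERIV_imp_deriv, rule DERIV_cdivide, rule holomorphic_derivI[OF hol oS wS])
      ultimately show ?thesis using C by (simp add: norm_divide field_simps)
    qed
    have "cmod (H c0 - H y) \<le> 4 * C / d * cmod (c0 - y)"
    proof (rule field_differentiable_bound[of "ball c0 (d / 2)" H "deriv H"])
      fix w assume w: "w \<in> ball c0 (d / 2)"
      have wS: "w \<in> S" using w d by (simp add: S_def)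
      show "(H has_field_derivative deriv H w) (at w within ball c0 (d / 2))"
        using holomorphic_derivI[OF hol oS wS] has_field_derivative_at_within by blast
      show "cmod (deriv H w) \<le> 4 * C / d" by (rule der[OF w])
    qed (use d y(2) r(2) in \<open>auto simp: dist_commute\<close>)
    also have "\<dots> \<le> 4 * C / d * r" using y(2) C d by (intro mult_left_mono) (auto simp: dist_norm norm_minus_commute)
    also have "\<dots> \<le> 4 * C / d * (e * d / (8 * C))" using r(3) C d by (intro mult_left_mono) auto
    also have "\<dots> = e / 2" using C d by (simp add: field_simps)
    finally have "cmod (H c0) < e" using Hy e by simp
    moreover have "H c0 \<in> (\<lambda>Q. nu c0 Q c0) ` repelling_orbits c0"
      using imageI[OF branch_nu_eq(1)[OF uS x(1) oS c0S], of "\<lambda>Q. nu c0 Q c0"]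
        branch_nu_eq(3)[OF uS x(1) oS c0S] by (simp add: H_def)
    ultimately show "\<exists>a\<in>(\<lambda>Q. nu c0 Q c0) ` repelling_orbits c0. dist a 0 < e"
      by (intro bexI[of _ "H c0"]) (simp_all add: dist_norm)
  qed
qed

lemma Y_set_bounded:
  assumes c: "c0 \<notin> mandelbrot"
  shows "bounded (Y_set c0)"
proof -
  obtain d B where d: "d > 0" "uniform_weight (ball c0 d) B" "d \<le> 1 / (16 * B\<^sup>2)" using hyperbolic_outside_mandelbrot[OF c] by metis
  have c0: "c0 \<in> ball c0 d" using d by simp
  have "cmod (nu c0 Q c0) \<le> 2 * B\<^sup>2" if Q: "Q \<in> repelling_orbits c0" for Q
  proof -
    have po: "periodic_orbit c0 Q" using Q by (simp add: repelling_orbits_def)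
    obtain x where x: "branch (ball c0 d) (card Q) x" "range (\<lambda>j. x j c0) = Q"
      using repelling_branch[OF d(2,3) c0 po] by metis
    show ?thesis using branch_nu_eq(3,4)[OF d(2) x(1) open_ball c0] unfolding x(2) by simp
  qed
  then show ?thesis unfolding Y_set_image by (intro bounded_closure) (auto simp: bounded_iff)
qed

theorem theorem2:
  shows "(\<forall>c. c \<noteq> -2 \<longrightarrow> convex (Y_set c)) \<and>
         (\<exists>S. convex S \<and> Y_set (-2) = S \<union> {-1/6}) \<and>
         (\<forall>c. c \<notin> mandelbrot \<longrightarrow> bounded (Y_set c)) \<and>
         (\<forall>c. c \<notin> mandelbrot \<longrightarrow> (c \<in> X_accum \<longleftrightarrow> 0 \<in> Y_set c))"
proof (intro conjI allI impI)
  show "convex (Y_set c)" if "c \<noteq> -2" for c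
    unfolding Y_set_image by (rule convex_closure_nu) (use that in auto)
  \<comment> \<open>Only the fixed point 2 is set aside; it contributes the isolated value
    \<open>- 1 / 6\<close> or one that lies in the convex part anyway.\<close>
  define F where "F = repelling_orbits (-2) - {{2}}"
  have "repelling_orbits (-2) = insert {2} F" using minus_two_fixed_point(1) by (auto simp: F_def)
  then have "Y_set (-2) = closure ((\<lambda>Q. nu (-2) Q (-2)) ` F) \<union> {-1/6}"
    unfolding Y_set_image by (simp add: minus_two_fixed_point(2) closure_insert)
  moreover have "convex (closure ((\<lambda>Q. nu (-2) Q (-2)) ` F))"
    by (rule convex_closure_nu) (auto simp: F_def)
  ultimately show "\<exists>S. convex S \<and> Y_set (-2) = S \<union> {-1/6}" by blast
  show "bounded (Y_set c)" if "c \<notin> mandelbrot" for c by (rule Y_set_bounded[OF that])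
  show "c \<in> X_accum \<longleftrightarrow> 0 \<in> Y_set c" if "c \<notin> mandelbrot" for c
    using accumulation_if[OF that] accumulation_only_if[OF that] by blast
qed

end
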